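(* Let $\Phi_1,\Phi_2,\Phi_3$ be polynomials with $\Phi_1'-\Phi_2'=\Phi_3'$, $\phi_j=\operatorname{Re}\Phi_j$, let $\alpha\in[0,1]$, and let $\vec\mu=(\mu_1,\mu_2,\mu_3)\in\mathcal M_\alpha$ be an $\alpha$-critical measure, with associated algebraic equation $\xi^3-R(z)\xi+D(z)=0$. Given $j\in\{1,2,3\}$, let $\Sigma$ be an open analytic arc in $\operatorname{supp}\mu_j\setminus S_\alpha$ not containing any branch point of the equation $\xi^3-R(z)\xi+D(z)=0$. Then there exists a constant $l=l(\Sigma)\in\mathbb{R}$ for which both the equilibrium condition $$\sum_{k=1}^3a_{j,k}U^{\mu_k}(z)+\frac{\phi_j(z)}{2}=l$$ and the $S$-property $$\frac{\partial}{\partial n_+}\left(\sum_{k=1}^3a_{j,k}U^{\mu_k}(z)+\frac{\phi_j(z)}2\right)=\frac{\partial}{\partial n_-}\left(\sum_{k=1}^3a_{j,k}U^{\mu_k}(z)+\frac{\phi_j(z)}2\right)$$ hold true for $z\in\Sigma$, where $n_\pm$ are the unit normal vectors to $\Sigma$, pointing in the opposite directions.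
   Context: The interaction matrix is $$A=(a_{j,k})=\begin{pmatrix}1&\frac12&\frac12\\ \frac12&1&-\frac12\\ \frac12&-\frac12&1\end{pmatrix}.$$ For compactly supported measures, $I(\mu,\nu)=\iint\log\frac1{|x-y|}\,d\mu(x)d\nu(y)$, and $$E(\vec\mu)=\sum_{j,k=1}^3a_{j,k}I(\mu_j,\mu_k)+\sum_{j=1}^3\int\phi_j\,d\mu_j .$$ $|\mu|$ denotes total mass. $\mathcal M_\alpha$ is the set of triples $\vec\mu=(\mu_1,\mu_2,\mu_3)$ of non-negative Borel measures with compact supports in $\mathbb{C}$ of zero plane Lebesgue measure, with $E(\vec\mu)$ finite, $|\mu_1|+|\mu_2|=1$, $|\mu_1|+|\mu_3|=\alpha$, $|\mu_2|-|\mu_3|=1-\alpha$, and with $S_\alpha=\bigcup_{1\le j<k\le3}(\operatorname{supp}\mu_j\cap\operatorname{supp}\mu_k)$ finite. For $t\in\mathbb{C}$ and a (complex-valued) $h\in C^2(\mathbb{C})$, $\mu^t$ is the pushforward of $\mu$ under $z\mapsto z+th(z)$. $\vec\mu$ is $\alpha$-critical if $\vec\mu\in\mathcal M_\alpha$ and $\lim_{t\to0}\frac{E(\vec\mu^t)-E(\vec\mu)}{t}=0$ for every $h\in C^2(\mathbb{C})$. $U^\lambda(z)=\int\log\frac1{|x-z|}d\lambda(x)$ is the logarithmic potential and $C^\lambda(z)=\int\frac{d\lambda(x)}{x-z}$ (principal value) the Cauchy transform. Known fact (another theorem of the paper): if $\vec\mu$ is $\alpha$-critical, the functions $\xi_1=\frac{\Phi_1'}{3}+\frac{\Phi_2'}{3}+C^{\mu_1}+C^{\mu_2}$,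 $\xi_2=-\frac{\Phi_1'}{3}-\frac{\Phi_3'}{3}-C^{\mu_1}-C^{\mu_3}$, $\xi_3=-\frac{\Phi_2'}{3}+\frac{\Phi_3'}{3}-C^{\mu_2}+C^{\mu_3}$ are, $\operatorname{mes}_2$-a.e. on $\mathbb{C}$, the three solutions of one algebraic equation $\xi^3-R(z)\xi+D(z)=0$ with $R$ a polynomial and $D$ a rational function with poles of order at most $2$ (the "associated algebraic equation"); and each $\mu_j$ is supported on a finite union of analytic arcs and is absolutely continuous with respect to arclength. A branch point of the equation is a point near which its three solutions cannot be chosen as single-valued meromorphic functions. The derivatives $\partial/\partial n_\pm$ are one-sided normal derivatives from the two sides of $\Sigma$. *)

theory Defs
  imports "HOL-Complex_Analysis.Complex_Analysis"
begin

text \<open>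
  Triples are indexed by the three-element type \<open>3\<close>, whose elements are \<open>1\<close>, \<open>2\<close> and
  \<open>3\<close> (the last one being equal to \<open>0\<close>, so the order of the type is not the order of the indices).
\<close>

definition interaction :: "real^3^3" where
  "interaction = vector [vector [1,   1/2,  1/2],
                         vector [1/2, 1,   -1/2],
                         vector [1/2, -1/2, 1]]"


subsection \<open>Logarithmic energies and potentials\<close>

text \<open>
  The value \<open>\<infinity>\<close> on the diagonal is essential: in HOL, \<open>ln 0\<close> is a real number, so without it
  point masses would have finite energy.
\<close>
definition log_kernel :: "complex \<Rightarrow> complex \<Rightarrow> ereal" where
  "log_kernel x y = (if x = y then \<infinity> else ereal (ln (1 / cmod (x - y))))"

text \<open>
  Integral of an extended real function as the difference of the integrals of its positive and
  negative parts (\<^const>\<open>e2ennreal\<close> truncates negative values to 0). For \<^const>\<open>log_kernel\<close> and finite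
  compactly supported measures, the integral of the negative part is finite.
\<close>
definition ereal_integral :: "'a measure \<Rightarrow> ('a \<Rightarrow> ereal) \<Rightarrow> ereal" where
  "ereal_integral M f =
     enn2ereal (\<integral>\<^sup>+x. e2ennreal (f x) \<partial>M) - enn2ereal (\<integral>\<^sup>+x. e2ennreal (- f x) \<partial>M)"

definition mutual_energy :: "complex measure \<Rightarrow> complex measure \<Rightarrow> ereal" where
  "mutual_energy \<mu> \<nu> = ereal_integral (\<mu> \<Otimes>\<^sub>M \<nu>) (\<lambda>(x, y). log_kernel x y)"

definition log_potential :: "complex measure \<Rightarrow> complex \<Rightarrow> ereal" where
  "log_potential \<mu> z = ereal_integral \<mu> (\<lambda>x. log_kernel x z)"

definition ext_field :: "(3 \<Rightarrow> complex poly) \<Rightarrow> 3 \<Rightarrow> complex \<Rightarrow> real" where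
  "ext_field \<Phi> j z = Re (poly (\<Phi> j) z)"

text \<open>
  In \<^typ>\<open>ereal\<close>, \<open>\<infinity> + (- \<infinity>) = \<infinity>\<close>; hence the energy is finite exactly if all
  mutual energies are finite, i.e. an undefined sum counts as not finite.
\<close>
definition energy :: "(3 \<Rightarrow> complex poly) \<Rightarrow> (3 \<Rightarrow> complex measure) \<Rightarrow> ereal" where
  "energy \<Phi> \<mu> =
     (\<Sum>j\<in>UNIV. \<Sum>k\<in>UNIV. ereal (interaction $ j $ k) * mutual_energy (\<mu> j) (\<mu> k))
     + ereal (\<Sum>j\<in>UNIV. \<integral>z. ext_field \<Phi> j z \<partial>\<mu> j)"

definition total_potential ::
    "(3 \<Rightarrow> complex poly) \<Rightarrow> (3 \<Rightarrow> complex measure) \<Rightarrow> 3 \<Rightarrow> complex \<Rightarrow> ereal" where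
  "total_potential \<Phi> \<mu> j z =
     (\<Sum>k\<in>UNIV. ereal (interaction $ j $ k) * log_potential (\<mu> k) z) + ereal (ext_field \<Phi> j z / 2)"


subsection \<open>Critical measures\<close>

definition msupp :: "complex measure \<Rightarrow> complex set" where
  "msupp \<mu> = {z. \<forall>U. open U \<and> z \<in> U \<longrightarrow> emeasure \<mu> U \<noteq> 0}"

definition supp_overlap :: "(3 \<Rightarrow> complex measure) \<Rightarrow> complex set" where
  "supp_overlap \<mu> = (msupp (\<mu> 1) \<inter> msupp (\<mu> 2)) \<union> (msupp (\<mu> 1) \<inter> msupp (\<mu> 3))
                  \<union> (msupp (\<mu> 2) \<inter> msupp (\<mu> 3))"

definition admissible ::
    "(3 \<Rightarrow> complex poly) \<Rightarrow> real \<Rightarrow> (3 \<Rightarrow> complex measure) \<Rightarrow> bool" where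
  "admissible \<Phi> \<alpha> \<mu> \<longleftrightarrow>
     (\<forall>j. sets (\<mu> j) = sets borel \<and> finite_measure (\<mu> j) \<and>
          compact (msupp (\<mu> j)) \<and> msupp (\<mu> j) \<in> null_sets lborel) \<and>
     \<bar>energy \<Phi> \<mu>\<bar> \<noteq> \<infinity> \<and>
     measure (\<mu> 1) UNIV + measure (\<mu> 2) UNIV = 1 \<and>
     measure (\<mu> 1) UNIV + measure (\<mu> 3) UNIV = \<alpha> \<and>
     measure (\<mu> 2) UNIV - measure (\<mu> 3) UNIV = 1 - \<alpha> \<and>
     finite (supp_overlap \<mu>)"

text \<open>Twice continuously differentiable in the real sense.\<close>
definition C2_function :: "(complex \<Rightarrow> complex) \<Rightarrow> bool" where
  "C2_function h \<longleftrightarrow>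
     (\<exists>(h' :: complex \<Rightarrow> complex \<Rightarrow>\<^sub>L complex) (h'' :: complex \<Rightarrow> complex \<Rightarrow>\<^sub>L (complex \<Rightarrow>\<^sub>L complex)).
        (\<forall>z. (h has_derivative blinfun_apply (h' z)) (at z)) \<and>
        (\<forall>z. (h' has_derivative blinfun_apply (h'' z)) (at z)) \<and>
        continuous_on UNIV h'')"

definition variation ::
    "(complex \<Rightarrow> complex) \<Rightarrow> complex \<Rightarrow> (3 \<Rightarrow> complex measure) \<Rightarrow> 3 \<Rightarrow> complex measure" where
  "variation h t \<mu> j = distr (\<mu> j) borel (\<lambda>z. z + t * h z)"

text \<open>
  \<^const>\<open>real_of_ereal\<close> sends \<open>\<plusminus>\<infinity>\<close> to 0, but for small \<open>t\<close> the map \<open>z \<mapsto> z + t h(z)\<close> is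
  bi-Lipschitz on the supports, so that the varied energies are finite as well.
\<close>
definition critical ::
    "(3 \<Rightarrow> complex poly) \<Rightarrow> real \<Rightarrow> (3 \<Rightarrow> complex measure) \<Rightarrow> bool" where
  "critical \<Phi> \<alpha> \<mu> \<longleftrightarrow> admissible \<Phi> \<alpha> \<mu> \<and>
     (\<forall>h. C2_function h \<longrightarrow>
        ((\<lambda>t. complex_of_real (real_of_ereal (energy \<Phi> (variation h t \<mu>))
                               - real_of_ereal (energy \<Phi> \<mu>)) / t) \<longlongrightarrow> 0) (at 0))"


subsection \<open>The associated algebraic equation\<close>

definition cauchy_transform :: "complex measure \<Rightarrow> complex \<Rightarrow> complex" where
  "cauchy_transform \<mu> z = Lim (at_right 0) (\<lambda>\<epsilon>. LINT x:{x. cmod (x - z) > \<epsilon>}|\<mu>. 1 / (x - z))"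

definition xi1 :: "(3 \<Rightarrow> complex poly) \<Rightarrow> (3 \<Rightarrow> complex measure) \<Rightarrow> complex \<Rightarrow> complex" where
  "xi1 \<Phi> \<mu> z = poly (pderiv (\<Phi> 1)) z / 3 + poly (pderiv (\<Phi> 2)) z / 3
     + cauchy_transform (\<mu> 1) z + cauchy_transform (\<mu> 2) z"

definition xi2 :: "(3 \<Rightarrow> complex poly) \<Rightarrow> (3 \<Rightarrow> complex measure) \<Rightarrow> complex \<Rightarrow> complex" where
  "xi2 \<Phi> \<mu> z = - poly (pderiv (\<Phi> 1)) z / 3 - poly (pderiv (\<Phi> 3)) z / 3
     - cauchy_transform (\<mu> 1) z - cauchy_transform (\<mu> 3) z"

definition xi3 :: "(3 \<Rightarrow> complex poly) \<Rightarrow> (3 \<Rightarrow> complex measure) \<Rightarrow> complex \<Rightarrow> complex" where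
  "xi3 \<Phi> \<mu> z = - poly (pderiv (\<Phi> 2)) z / 3 + poly (pderiv (\<Phi> 3)) z / 3
     - cauchy_transform (\<mu> 2) z + cauchy_transform (\<mu> 3) z"

text \<open>The solutions of \<open>X\<^sup>3 - r X + d = 0\<close>, listed with multiplicity, are \<open>a\<close>, \<open>b\<close>, \<open>c\<close>.\<close>
definition cubic_solutions :: "complex \<Rightarrow> complex \<Rightarrow> complex \<Rightarrow> complex \<Rightarrow> complex \<Rightarrow> bool" where
  "cubic_solutions r d a b c \<longleftrightarrow>
     (\<forall>X. X ^ 3 - r * X + d = (X - a) * (X - b) * (X - c))"

text \<open>The values of \<open>D\<close> at its poles (zero, by division by zero) play no role.\<close>
definition rational_poles_le2 :: "(complex \<Rightarrow> complex) \<Rightarrow> bool" where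
  "rational_poles_le2 D \<longleftrightarrow>
     (\<exists>P Q. Q \<noteq> 0 \<and> coprime P Q \<and> (\<forall>z. order z Q \<le> 2) \<and> D = (\<lambda>z. poly P z / poly Q z))"

definition associated_equation ::
    "(3 \<Rightarrow> complex poly) \<Rightarrow> (3 \<Rightarrow> complex measure) \<Rightarrow> complex poly \<Rightarrow> (complex \<Rightarrow> complex) \<Rightarrow> bool"
  where
  "associated_equation \<Phi> \<mu> R D \<longleftrightarrow> rational_poles_le2 D \<and>
     (AE z in lborel. cubic_solutions (poly R z) (D z) (xi1 \<Phi> \<mu> z) (xi2 \<Phi> \<mu> z) (xi3 \<Phi> \<mu> z))"

text \<open>
  \<^term>\<open>f meromorphic_on {z}\<close> says that \<open>f\<close> is meromorphic in a neighbourhood of \<open>z\<close>, its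
  value at \<open>z\<close> being irrelevant; \<^term>\<open>at z\<close> is the filter of punctured neighbourhoods of \<open>z\<close>.
\<close>
definition branch_point :: "complex poly \<Rightarrow> (complex \<Rightarrow> complex) \<Rightarrow> complex \<Rightarrow> bool" where
  "branch_point R D z \<longleftrightarrow>
     \<not> (\<exists>f g h. f meromorphic_on {z} \<and> g meromorphic_on {z} \<and> h meromorphic_on {z} \<and>
          (\<forall>\<^sub>F w in at z. cubic_solutions (poly R w) (D w) (f w) (g w) (h w)))"


subsection \<open>Analytic arcs and normal derivatives\<close>

text \<open>
  \<open>\<gamma>\<close> is given on a complex neighbourhood of the interval \<open>(0,1)\<close>; its restriction to the interval
  is a real-analytic regular parametrization and a homeomorphism onto the arc.
\<close>
definition analytic_parametrization :: "(complex \<Rightarrow> complex) \<Rightarrow> complex set \<Rightarrow> bool" where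
  "analytic_parametrization \<gamma> \<Sigma> \<longleftrightarrow>
     \<gamma> analytic_on (complex_of_real ` {0<..<1}) \<and>
     (\<forall>s\<in>{0<..<1}. deriv \<gamma> (complex_of_real s) \<noteq> 0) \<and>
     (\<exists>g. homeomorphism (complex_of_real ` {0<..<1}) \<Sigma> \<gamma> g)"

definition open_analytic_arc :: "complex set \<Rightarrow> bool" where
  "open_analytic_arc \<Sigma> \<longleftrightarrow> (\<exists>\<gamma>. analytic_parametrization \<gamma> \<Sigma>)"

text \<open>\<open>\<bullet>\<close> is the inner product of the plane, so the first condition is orthogonality to the tangent.\<close>
definition unit_normal :: "complex set \<Rightarrow> complex \<Rightarrow> complex \<Rightarrow> bool" where
  "unit_normal \<Sigma> z n \<longleftrightarrow>
     (\<exists>\<gamma> s. analytic_parametrization \<gamma> \<Sigma> \<and> s \<in> {0<..<1} \<and> \<gamma> (complex_of_real s) = z \<and>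
            n \<bullet> deriv \<gamma> (complex_of_real s) = 0) \<and>
     cmod n = 1"

text \<open>One-sided derivative of \<open>f\<close> at \<open>z\<close> along the ray from \<open>z\<close> in direction \<open>n\<close>.\<close>
definition has_onesided_derivative ::
    "(complex \<Rightarrow> real) \<Rightarrow> complex \<Rightarrow> complex \<Rightarrow> real \<Rightarrow> bool" where
  "has_onesided_derivative f z n d \<longleftrightarrow>
     ((\<lambda>s. f (z + s *\<^sub>R n)) has_real_derivative d) (at_right 0)"

end

theory Submission
  imports Defs
begin

text \<open>
  Fix a point \<open>z\<close> of the arc. The other two measures have no mass near \<open>z\<close>, so the total potential
  \<open>W\<close> of \<open>\<mu> j\<close> is there the logarithmic potential of \<open>\<mu> j\<close> plus a harmonic function, and its complex
  gradient (twice the derivative with respect to \<open>z\<close>) is \<open>C + e\<close>, where \<open>C\<close> is the Cauchy transform of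
  \<open>\<mu> j\<close> and \<open>e\<close> is holomorphic. Exactly one of the three solutions \<open>\<xi>\<close> does not involve \<open>\<mu> j\<close>; it is
  a holomorphic function \<open>r\<close> near \<open>z\<close>, and the difference of the other two is \<open>2 (C + e)\<close>. By Vieta,
  \<open>(C + e)\<^sup>2 = R - 3/4 r\<^sup>2\<close> almost everywhere. Because \<open>z\<close> is not a branch point, \<open>r\<close> is one of three
  meromorphic branches, and half the difference of the other two is a holomorphic square root \<open>q\<close> of
  the right-hand side (\<open>square_root_off_branch_points\<close>). So the gradient of the
  superharmonic function \<open>W\<close> takes almost everywhere one of the two values \<open>q\<close> and \<open>-q\<close>.

  This determines \<open>W\<close>. Averaging over small discs turns the almost everywhere information into the
  Lipschitz type bound \<open>W_segment\<close>: along a segment, \<open>W\<close> changes by at most the supremum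
  of \<open>\<bar>Re (q (b - a))\<bar>\<close>. Hence \<open>W\<close> is finite and continuous, and if \<open>q z = 0\<close> its gradient at \<open>z\<close> is
  zero. If \<open>q z \<noteq> 0\<close>, a primitive \<open>P\<close> of \<open>q\<close> with \<open>P z = 0\<close> is a local coordinate in which \<open>W\<close> depends
  only on \<open>x = Re P\<close>, say \<open>W = \<phi> x\<close>. The slope of \<open>\<phi>\<close> is \<open>1\<close> or \<open>-1\<close> off the support, that is on a dense
  set, because the support has empty interior. By the minimum principle, \<open>\<phi> x - m x\<close> has no local
  minimum for \<open>m\<close> other than \<open>1\<close> and \<open>-1\<close>. Such a \<open>\<phi>\<close> is either affine near \<open>0\<close> or equal to \<open>\<phi> 0 - \<bar>x\<bar>\<close>
  (\<open>affine_or_peak\<close>). It is not affine, since \<open>W\<close> would then be harmonic near the support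
  point \<open>z\<close> (\<open>harmonic_imp_not_in_msupp\<close>).

  So \<open>W\<close> is locally a roof \<open>W z - \<bar>Re P\<bar>\<close> whose ridge \<open>Re P = 0\<close> contains the support
  (\<open>W_roof\<close>). The two slopes of a roof agree, which is the \<open>S\<close>-property, and \<open>W\<close> is
  constant on the ridge. At a zero of \<open>q\<close>, where there is no roof, the gradient vanishes, so
  along the arc the derivative of \<open>W\<close> is zero everywhere and the equilibrium condition follows
  (\<open>constant_along_arc\<close>).
\<close>

section \<open>Null sets, primitives and curves\<close>

lemma open_null_set_lborel:
  fixes U :: "'a::euclidean_space set"
  assumes "open U" "U \<in> null_sets lborel"
  shows "U = {}"
  using assms open_not_negligible[of U] by (auto simp: negligible_iff_null_sets null_sets_completionI)

lemma continuous_AE_zero: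
  fixes h :: "'a::euclidean_space \<Rightarrow> 'b::real_normed_vector"
  assumes S: "open S" and cont: "continuous_on S h" and AE: "AE w in lborel. w \<in> S \<longrightarrow> h w = 0"
    and w: "w \<in> S"
  shows "h w = 0"
proof -
  have op: "open {w \<in> S. h w \<noteq> 0}"
    using continuous_open_preimage[OF cont S, of "- {0}"] by (simp add: vimage_def Int_def open_Compl)
  have "{w \<in> S. h w \<noteq> 0} \<in> null_sets lborel"
  proof (subst AE_iff_null_sets)
    show "AE w in lborel. w \<notin> {w \<in> S. h w \<noteq> 0}"
      using AE by eventually_elim auto
  qed (use op in auto)
  then show ?thesis using open_null_set_lborel[OF op] w by blast
qed

lemma holomorphic_primitive:
  assumes S: "open S" and g: "\<And>w. w \<in> S \<Longrightarrow> (g has_field_derivative g' w) (at w)"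
  shows "g holomorphic_on S" and "g' holomorphic_on S"
proof -
  show *: "g holomorphic_on S"
    using g by (meson field_differentiable_at_within field_differentiable_def holomorphic_onI)
  then have "deriv g holomorphic_on S" using S by (rule holomorphic_deriv)
  then show "g' holomorphic_on S"
    by (rule holomorphic_transform) (use g in \<open>auto intro: DERIV_imp_deriv\<close>)
qed

lemma segment_in_convex:
  fixes a b :: complex
  assumes "convex S" "a \<in> S" "b \<in> S" "t \<in> {0..1}"
  shows "a + of_real t * (b - a) \<in> S"
  using convexD_alt[OF assms(1-3), of t] assms(4) by (simp add: algebra_simps scaleR_conv_of_real)

lemma has_integral_Re_primitive:
  assumes S: "convex S" "a \<in> S" "b \<in> S"
    and g: "\<And>w. w \<in> S \<Longrightarrow> (g has_field_derivative g' w) (at w)"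
  shows "((\<lambda>t. Re (g' (a + of_real t * (b - a)) * (b - a))) has_integral Re (g b) - Re (g a)) {0..1}"
proof -
  let ?l = "\<lambda>t. a + of_real t * (b - a)"
  have "((\<lambda>t. Re (g' (?l t) * (b - a))) has_integral Re (g (?l 1)) - Re (g (?l 0))) {0..1}"
  proof (rule fundamental_theorem_of_calculus)
    fix t :: real assume t: "t \<in> {0..1}"
    have "((\<lambda>t. a + t *\<^sub>R (b - a)) has_vector_derivative (b - a)) (at t within {0..1})"
      by (auto intro!: derivative_eq_intros)
    then have "(?l has_vector_derivative (b - a)) (at t within {0..1})"
      by (simp add: scaleR_conv_of_real)
    from field_vector_diff_chain_within[OF this, of g "g' (?l t)"] g[OF segment_in_convex[OF S t]]
    have "((\<lambda>t. g (?l t)) has_vector_derivative (b - a) * g' (?l t)) (at t within {0..1})"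
      by (simp add: o_def has_field_derivative_at_within)
    from bounded_linear.has_vector_derivative[OF bounded_linear_Re this]
    show "((\<lambda>t. Re (g (?l t))) has_vector_derivative Re (g' (?l t) * (b - a))) (at t within {0..1})"
      by (simp only: mult.commute)
  qed simp
  then show ?thesis by simp
qed

lemma abs_Re_mult_le:
  assumes "cmod x \<le> Q"
  shows "\<bar>Re (x * v)\<bar> \<le> Q * cmod v"
proof -
  have "\<bar>Re (x * v)\<bar> \<le> cmod x * cmod v" by (metis abs_Re_le_cmod norm_mult)
  also have "\<dots> \<le> Q * cmod v" using assms by (rule mult_right_mono) simp
  finally show ?thesis .
qed

lemma isCont_tendsto_nhds: "isCont f x \<Longrightarrow> (f \<longlongrightarrow> f x) (nhds x)"
  by (simp add: isCont_def tendsto_at_iff_tendsto_nhds)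

text \<open>
  A first order bound on \<open>V\<close> turns into a vanishing derivative along every curve whose velocity
  is orthogonal to the covector \<open>Re (c * _)\<close>. The set \<open>A\<close> allows for bounds that only hold on the
  trace of the curve.
\<close>
lemma zero_derivative_along_curve:
  fixes f :: "real \<Rightarrow> complex" and V :: "complex \<Rightarrow> real"
  assumes f: "(f has_vector_derivative L) (at t)" and orth: "Re (c * L) = 0"
    and A: "\<forall>\<^sub>F u in nhds t. f u \<in> A"
    and V: "\<And>\<epsilon>. \<epsilon> > 0 \<Longrightarrow> \<forall>\<^sub>F w in nhds (f t). w \<in> A \<longrightarrow>
      \<bar>V w - V (f t)\<bar> \<le> \<bar>Re (c * (w - f t))\<bar> + \<epsilon> * cmod (w - f t)"
  shows "((\<lambda>u. V (f u)) has_real_derivative 0) (at t)"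
proof -
  have "\<exists>d>0. \<forall>u. norm (u - t) < d \<longrightarrow> norm (V (f u) - V (f t) - 0 * (u - t)) \<le> \<epsilon> * norm (u - t)"
    if \<epsilon>: "\<epsilon> > 0" for \<epsilon>
  proof -
    define \<epsilon>1 where "\<epsilon>1 = min 1 (\<epsilon> / (2 * (cmod (c) + 1)))"
    define \<epsilon>2 where "\<epsilon>2 = \<epsilon> / (2 * (cmod L + 1))"
    have pos: "\<epsilon>1 > 0" "\<epsilon>2 > 0" using \<epsilon> by (auto simp: \<epsilon>1_def \<epsilon>2_def intro!: divide_pos_pos add_nonneg_pos mult_pos_pos)
    have half: "\<epsilon> / (2 * y) * y = \<epsilon> / 2" if "y \<noteq> 0" for y using that by simp
    have "\<epsilon>1 * (cmod (c) + 1) \<le> \<epsilon> / (2 * (cmod (c) + 1)) * (cmod (c) + 1)"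
      by (intro mult_right_mono) (auto simp: \<epsilon>1_def)
    also have "\<dots> = \<epsilon> / 2" by (rule half) (smt (verit) norm_ge_zero)
    finally have e1: "\<epsilon>1 * cmod (c) \<le> \<epsilon> / 2" using pos by (simp add: distrib_left)
    have "\<epsilon>2 * (cmod L + \<epsilon>1) \<le> \<epsilon>2 * (cmod L + 1)" using pos by (intro mult_left_mono) (auto simp: \<epsilon>1_def)
    also have "\<dots> = \<epsilon> / 2" unfolding \<epsilon>2_def by (rule half) (smt (verit) norm_ge_zero)
    finally have e2: "\<epsilon>2 * (cmod L + \<epsilon>1) \<le> \<epsilon> / 2" .
    obtain d1 where d1: "d1 > 0" "\<And>u. norm (u - t) < d1 \<Longrightarrow> norm (f u - f t - (u - t) *\<^sub>R L) \<le> \<epsilon>1 * norm (u - t)"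
      using f pos(1) unfolding has_vector_derivative_def has_derivative_at_alt by blast
    have "isCont f t" using f by (rule has_vector_derivative_continuous)
    from eventually_compose_filterlim[OF V[OF pos(2)] isCont_tendsto_nhds[OF this]] A
    have "\<forall>\<^sub>F u in nhds t. \<bar>V (f u) - V (f t)\<bar> \<le> \<bar>Re (c * (f u - f t))\<bar> + \<epsilon>2 * cmod (f u - f t)"
      by eventually_elim simp
    then obtain d2 where d2: "d2 > 0" "\<And>u. norm (u - t) < d2 \<Longrightarrow>
        \<bar>V (f u) - V (f t)\<bar> \<le> \<bar>Re (c * (f u - f t))\<bar> + \<epsilon>2 * cmod (f u - f t)"
      unfolding eventually_nhds_metric dist_norm by blast
    have "norm (V (f u) - V (f t) - 0 * (u - t)) \<le> \<epsilon> * norm (u - t)" if u: "norm (u - t) < min d1 d2" for u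
    proof -
      let ?r = "f u - f t - (u - t) *\<^sub>R L"
      have r: "cmod ?r \<le> \<epsilon>1 * \<bar>u - t\<bar>" using d1(2)[of u] u by simp
      have "f u - f t = ?r + (u - t) *\<^sub>R L" by simp
      then have split: "Re (c * (f u - f t)) = Re (c * ?r) + (u - t) * Re (c * L)"
        by (metis distrib_left mult_scaleR_right plus_complex.sel(1) scaleR_complex.sel(1))
      have "\<bar>Re (c * ?r)\<bar> \<le> cmod (c) * cmod ?r" by (rule abs_Re_mult_le) simp
      also have "\<dots> \<le> cmod (c) * (\<epsilon>1 * \<bar>u - t\<bar>)" using r by (intro mult_left_mono) auto
      also have "\<dots> \<le> \<epsilon> / 2 * \<bar>u - t\<bar>" using mult_right_mono[OF e1, of "\<bar>u - t\<bar>"] by (simp add: mult_ac)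
      finally have 1: "\<bar>Re (c * (f u - f t))\<bar> \<le> \<epsilon> / 2 * \<bar>u - t\<bar>" using split orth by simp
      have "cmod (f u - f t) \<le> cmod ?r + cmod ((u - t) *\<^sub>R L)" using norm_triangle_ineq[of ?r "(u - t) *\<^sub>R L"] by simp
      also have "\<dots> \<le> (cmod L + \<epsilon>1) * \<bar>u - t\<bar>" using r unfolding distrib_right norm_scaleR real_norm_def by (simp only: mult.commute add.commute add_left_mono)
      finally have "\<epsilon>2 * cmod (f u - f t) \<le> \<epsilon>2 * ((cmod L + \<epsilon>1) * \<bar>u - t\<bar>)" using pos by (intro mult_left_mono) auto
      also have "\<dots> \<le> \<epsilon> / 2 * \<bar>u - t\<bar>" using mult_right_mono[OF e2, of "\<bar>u - t\<bar>"] by (simp add: mult_ac)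
      finally have 2: "\<epsilon>2 * cmod (f u - f t) \<le> \<epsilon> / 2 * \<bar>u - t\<bar>" .
      have "\<bar>V (f u) - V (f t)\<bar> \<le> \<epsilon> / 2 * \<bar>u - t\<bar> + \<epsilon> / 2 * \<bar>u - t\<bar>" using d2(2)[of u] u 1 2 by auto
      also have "\<dots> = \<epsilon> * \<bar>u - t\<bar>" by simp
      finally show ?thesis by simp
    qed
    moreover have "min d1 d2 > 0" using d1(1) d2(1) by simp
    ultimately show ?thesis by blast
  qed
  then show ?thesis
    unfolding has_field_derivative_def has_derivative_at_alt using bounded_linear_mult_right[of "0::real"] by blast
qed


section \<open>Circle means and disc integrals\<close>

lemma lborel_distr_orthogonal:
  fixes R :: "real^'n::{finite,wellorder} \<Rightarrow> real^'n::_"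
  assumes R: "orthogonal_transformation R"
  shows "distr lborel borel R = lborel"
proof (rule lborel_eqI[symmetric])
  have lin: "linear R" using R by (simp add: orthogonal_transformation_linear)
  then have [measurable]: "R \<in> borel_measurable borel"
    by (intro borel_measurable_continuous_onI linear_continuous_on) (simp add: linear_conv_bounded_linear)
  obtain T where T: "orthogonal_transformation T" "\<And>x. T (R x) = x" "\<And>x. R (T x) = x"
    using R orthogonal_transformation_inv orthogonal_transformation_bij
    by (metis bij_inv_eq_iff)
  fix l u :: "real^'n::_" assume lu: "\<And>b. b \<in> Basis \<Longrightarrow> l \<bullet> b \<le> u \<bullet> b"
  have pre: "R -` box l u = T ` box l u"
  proof (intro equalityI subsetI)
    fix x assume "x \<in> R -` box l u"
    then have "R x \<in> box l u" "x = T (R x)" using T(2) by simp_all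
    then show "x \<in> T ` box l u" by blast
  qed (use T(3) in auto)
  have box: "box l u \<in> lmeasurable" by simp
  have meas: "R -` box l u \<in> sets borel"
    using measurable_sets[of R borel borel "box l u"] by simp
  have "T ` box l u \<in> lmeasurable" "measure lebesgue (T ` box l u) = measure lebesgue (box l u)"
    using T(1) box by (rule measurable_orthogonal_image measure_orthogonal_image)+
  then have "emeasure lebesgue (T ` box l u) = ennreal (measure lebesgue (box l u))"
    by (metis emeasure_eq_measure2)
  also have "\<dots> = emeasure lebesgue (box l u)"
    using box by (metis emeasure_eq_measure2)
  finally have "emeasure lborel (R -` box l u) = emeasure lborel (box l u)"
    using meas by (simp add: pre[symmetric])
  then show "emeasure (distr lborel borel R) (box l u) = (\<Prod>b\<in>Basis. (u - l) \<bullet> b)"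
    using lu by (simp add: emeasure_distr)
qed simp

text \<open>
  Multiplication by \<open>u\<close> is an orthogonal transformation of the plane, seen as \<^typ>\<open>real^2\<close> through
  its real and imaginary parts.
\<close>
lemma lborel_complex_rotation:
  assumes "cmod u = 1"
  shows "distr lborel borel (\<lambda>z. u * z) = (lborel :: complex measure)"
proof -
  define J :: "real^2 \<Rightarrow> complex" where "J = (\<lambda>v. Complex (v$1) (v$2))"
  define R :: "real^2 \<Rightarrow> real^2" where
    "R = (\<lambda>v. vector [Re u * v$1 - Im u * v$2, Im u * v$1 + Re u * v$2])"
  have contJ: "continuous_on UNIV J"
    unfolding J_def complex_eq_iff Complex_eq by (intro continuous_intros)
  then have [measurable]: "J \<in> borel_measurable borel"
    by (rule borel_measurable_continuous_onI)
  have linR: "linear R"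
    unfolding R_def by (rule linearI) (auto simp: vec_eq_iff forall_2 algebra_simps)
  then have [measurable]: "R \<in> borel_measurable borel"
    by (intro borel_measurable_continuous_onI linear_continuous_on) (simp add: linear_conv_bounded_linear)
  have uu: "Re u * Re u + Im u * Im u = 1"
    using assms by (metis cmod_power2 one_power2 power2_eq_square)
  have "norm (R v) = norm v" for v
  proof -
    have "(Re u * v$1 - Im u * v$2)\<^sup>2 + (Im u * v$1 + Re u * v$2)\<^sup>2
        = (Re u * Re u + Im u * Im u) * ((v$1)\<^sup>2 + (v$2)\<^sup>2)" by algebra
    then show ?thesis by (simp add: norm_vec_def L2_set_def sum_2 R_def uu)
  qed
  then have orth: "orthogonal_transformation R"
    using linR by (simp add: orthogonal_transformation)
  have J: "distr lborel borel J = lborel"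
  proof (rule lborel_eqI[symmetric])
    fix l w :: complex assume lw: "\<And>b. b \<in> Basis \<Longrightarrow> l \<bullet> b \<le> w \<bullet> b"
    let ?l = "vector [Re l, Im l] :: real^2" and ?w = "vector [Re w, Im w] :: real^2"
    have pre: "J -` box l w = box ?l ?w"
      by (auto simp: J_def box_def Basis_complex_def inner_complex_def Basis_vec_def inner_axis forall_2)
    have bas: "(Basis :: (real^2) set) = {axis 1 1, axis 2 1}"
      by (auto simp: Basis_vec_def UNIV_2)
    have ne: "axis 1 1 \<noteq> (axis 2 1 :: real^2)" by (simp add: axis_eq_axis)
    have "Re l \<le> Re w" "Im l \<le> Im w" using lw[of 1] lw[of \<i>]
      by (simp_all add: Basis_complex_def inner_complex_def)
    then have "emeasure lborel (box ?l ?w) = ennreal ((Re w - Re l) * (Im w - Im l))"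
      using ne unfolding emeasure_lborel_box_eq bas
      by (auto simp: inner_axis Basis_complex_def inner_complex_def)
    then show "emeasure (distr lborel borel J) (box l w) = (\<Prod>b\<in>Basis. (w - l) \<bullet> b)"
      by (simp add: emeasure_distr pre Basis_complex_def inner_complex_def)
  qed simp
  have comm: "u * J v = J (R v)" for v
    by (simp add: J_def R_def complex_eq_iff)
  have "distr lborel borel (\<lambda>z. u * z) = distr (distr lborel borel J) borel (\<lambda>z. u * z)"
    by (simp add: J)
  also have "\<dots> = distr lborel borel (\<lambda>v. J (R v))"
    by (simp add: distr_distr o_def comm)
  also have "\<dots> = distr (distr lborel borel R) borel J"
    by (simp add: distr_distr o_def)
  also have "\<dots> = lborel" by (simp add: lborel_distr_orthogonal[OF orth] J)
  finally show ?thesis .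
qed

definition circle_mean :: "(complex \<Rightarrow> 'b) \<Rightarrow> complex \<Rightarrow> 'b::{banach,second_countable_topology}" where
  "circle_mean f \<zeta> = (LINT t:{0..1}|lborel. f (\<zeta> * cis (2 * pi * t)))"

text \<open>
  This replaces polar coordinates: the integral over the disc does not change when the integrand is
  rotated, hence not when it is averaged over all rotations either. All disc integrals below are
  evaluated in this way, since the circle means of the functions in question are known.
\<close>
lemma disc_integral_circle_mean:
  fixes f :: "complex \<Rightarrow> 'b::{banach,second_countable_topology}"
  assumes int: "set_integrable lborel (ball 0 \<delta>) f"
    and [measurable]: "f \<in> borel_measurable borel"
  shows "set_integrable lborel (ball 0 \<delta>) (circle_mean f)"
    and "(LINT \<zeta>:ball 0 \<delta>|lborel. circle_mean f \<zeta>) = (LINT \<zeta>:ball 0 \<delta>|lborel. f \<zeta>)"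
proof -
  define F where "F = (\<lambda>t \<zeta>. indicator {0..1} t *\<^sub>R indicator (ball 0 \<delta>) \<zeta> *\<^sub>R f (\<zeta> * cis (2 * pi * t)))"
  have "(\<lambda>p :: real \<times> complex. snd p * cis (2 * pi * fst p)) \<in> borel_measurable borel"
    by (intro borel_measurable_continuous_onI continuous_intros)
  then have "(\<lambda>p :: real \<times> complex. snd p * cis (2 * pi * fst p)) \<in> borel_measurable (lborel \<Otimes>\<^sub>M lborel)"
    by (simp add: lborel_prod)
  then have [measurable]: "(\<lambda>p. f (snd p * cis (2 * pi * fst p))) \<in> borel_measurable (lborel \<Otimes>\<^sub>M lborel)"
    by (rule measurable_compose) measurable
  have [measurable]: "ball 0 \<delta> \<in> sets (borel :: complex measure)" by simp
  have [measurable]: "(\<lambda>p. F (fst p) (snd p)) \<in> borel_measurable (lborel \<Otimes>\<^sub>M lborel)"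
    unfolding F_def by measurable
  then have Fm: "(case_prod F) \<in> borel_measurable (lborel \<Otimes>\<^sub>M lborel)"
    by (simp add: case_prod_beta')
  define G where "G = (\<lambda>\<zeta>. indicator (ball 0 \<delta>) \<zeta> *\<^sub>R f \<zeta>)"
  have rot: "indicator (ball 0 \<delta>) \<zeta> *\<^sub>R f (\<zeta> * cis s) = G (cis s * \<zeta>)" for \<zeta> s
    by (simp add: G_def indicator_def norm_mult mult.commute)
  have GI: "integrable lborel G" using int by (simp add: set_integrable_def G_def)
  have [measurable]: "G \<in> borel_measurable borel"
    unfolding G_def by measurable
  have Gr: "integrable lborel (\<lambda>\<zeta>. G (cis s * \<zeta>))"
    "(LINT \<zeta>|lborel. G (cis s * \<zeta>)) = (LINT \<zeta>|lborel. G \<zeta>)"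
    "(LINT \<zeta>|lborel. norm (G (cis s * \<zeta>))) = (LINT \<zeta>|lborel. norm (G \<zeta>))" for s
  proof -
    have d: "distr lborel borel (\<lambda>z. cis s * z) = (lborel :: complex measure)"
      by (rule lborel_complex_rotation) simp
    have m: "(\<lambda>z. cis s * z) \<in> measurable (lborel :: complex measure) borel" by simp
    show "integrable lborel (\<lambda>\<zeta>. G (cis s * \<zeta>))"
      using integrable_distr[OF m, of G] GI unfolding d by simp
    show "(LINT \<zeta>|lborel. G (cis s * \<zeta>)) = (LINT \<zeta>|lborel. G \<zeta>)"
      using integral_distr[OF m, of G] unfolding d by simp
    show "(LINT \<zeta>|lborel. norm (G (cis s * \<zeta>))) = (LINT \<zeta>|lborel. norm (G \<zeta>))"
      using integral_distr[OF m, of "\<lambda>\<zeta>. norm (G \<zeta>)"] unfolding d by simp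
  qed
  have Ft: "F t = (\<lambda>\<zeta>. indicator {0..1} t *\<^sub>R G (cis (2 * pi * t) * \<zeta>))" for t
    by (simp add: F_def rot)
  have one: "(LINT t|lborel. indicator {0..1::real} t *\<^sub>R c) = c" for c :: 'b
    by (subst integral_scaleR_left) (auto simp: emeasure_lborel_Icc_eq)
  have one': "(LINT t|lborel. indicator {0..1::real} t * c) = c" for c :: real
    by (subst integral_mult_left_zero) (auto simp: emeasure_lborel_Icc_eq)
  have FI: "integrable (lborel \<Otimes>\<^sub>M lborel) (case_prod F)"
  proof (rule lborel_pair.Fubini_integrable[OF Fm])
    have "(LINT y|lborel. norm (F t y)) = indicator {0..1} t * (LINT \<zeta>|lborel. norm (G \<zeta>))" for t
    proof -
      have "norm (F t y) = indicator {0..1} t * norm (G (cis (2 * pi * t) * y))" for y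
        by (simp add: Ft indicator_def)
      then show ?thesis
        by (simp add: Gr(3))
    qed
    moreover have "integrable lborel (\<lambda>t::real. indicator {0..1} t * (LINT \<zeta>|lborel. norm (G \<zeta>)))"
      by (intro integrable_mult_left) (auto simp: emeasure_lborel_Icc_eq)
    ultimately show "integrable lborel (\<lambda>t. LINT y|lborel. norm (case_prod F (t, y)))"
      by simp
    show "AE t in lborel. integrable lborel (\<lambda>y. case_prod F (t, y))"
      by (simp add: Ft Gr del: scaleR_scaleR)
  qed
  have inner: "(LINT t|lborel. F t \<zeta>) = indicator (ball 0 \<delta>) \<zeta> *\<^sub>R circle_mean f \<zeta>" for \<zeta>
    unfolding F_def circle_mean_def set_lebesgue_integral_def
    by (subst scaleR_left_commute) (rule integral_scaleR_right)
  have sw: "integrable lborel (\<lambda>\<zeta>. LINT t|lborel. F t \<zeta>)"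
    using lborel_pair.integrable_snd[OF FI] by simp
  then show "set_integrable lborel (ball 0 \<delta>) (circle_mean f)"
    by (simp add: set_integrable_def inner)
  have "(LINT \<zeta>:ball 0 \<delta>|lborel. circle_mean f \<zeta>) = (LINT \<zeta>|lborel. LINT t|lborel. F t \<zeta>)"
    by (simp add: set_lebesgue_integral_def inner)
  also have "\<dots> = (LINT t|lborel. LINT \<zeta>|lborel. F t \<zeta>)"
    by (rule lborel_pair.Fubini_integral[OF FI])
  also have "\<dots> = (LINT t|lborel. indicator {0..1::real} t *\<^sub>R (LINT \<zeta>|lborel. G \<zeta>))"
    unfolding Ft by (simp add: Gr del: scaleR_scaleR)
  also have "\<dots> = (LINT \<zeta>:ball 0 \<delta>|lborel. f \<zeta>)"
    by (simp add: one set_lebesgue_integral_def G_def)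
  finally show "(LINT \<zeta>:ball 0 \<delta>|lborel. circle_mean f \<zeta>) = (LINT \<zeta>:ball 0 \<delta>|lborel. f \<zeta>)" .
qed


lemma has_integral_circle_mean:
  assumes f: "f holomorphic_on cball 0 1"
  shows "((\<lambda>t. f (cis (2 * pi * t))) has_integral f 0) {0..1}"
proof -
  have "((\<lambda>u. f u / (u - 0)) has_contour_integral (2 * of_real pi * \<i> * f 0)) (circlepath 0 1)"
    by (rule Cauchy_integral_circlepath_simple[OF f]) simp
  note hci = this[unfolded has_contour_integral_def]
  have vd: "circlepath 0 1 = (\<lambda>t. exp (2 * of_real pi * \<i> * of_real t))"
    by (simp add: circlepath)
  have "((\<lambda>t. f (exp (2 * of_real pi * \<i> * of_real t)) * (2 * of_real pi * \<i>))
      has_integral (2 * of_real pi * \<i> * f 0)) {0..1}"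
  proof (rule has_integral_eq[OF _ hci])
    fix x :: real assume "x \<in> {0..1}"
    then have "vector_derivative (circlepath 0 1) (at x within {0..1})
        = 2 * of_real pi * \<i> * exp (2 * of_real pi * \<i> * of_real x)"
      using vector_derivative_circlepath01[of x 0 1] by simp
    then show "f (circlepath 0 1 x) / (circlepath 0 1 x - 0) * vector_derivative (circlepath 0 1) (at x within {0..1})
        = f (exp (2 * of_real pi * \<i> * of_real x)) * (2 * of_real pi * \<i>)"
      by (simp add: vd)
  qed
  then have "((\<lambda>t. f (exp (2 * of_real pi * \<i> * of_real t)) * (2 * of_real pi * \<i>) / (2 * of_real pi * \<i>))
      has_integral (2 * of_real pi * \<i> * f 0 / (2 * of_real pi * \<i>))) {0..1}"
    by (rule has_integral_divide)
  then show ?thesis by (simp add: cis_conv_exp mult_ac)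
qed

text \<open>
  The circle run through backwards serves functions that are holomorphic outside a disc, where the
  variable is the inverse of \<open>cis\<close>.
\<close>
lemma has_integral_circle_mean_neg:
  assumes f: "f holomorphic_on cball 0 1"
  shows "((\<lambda>t. f (cis (- (2 * pi * t)))) has_integral f 0) {0..1}"
proof -
  have "((\<lambda>t. f (cis (2 * pi * ((-1) *\<^sub>R t + 1)))) has_integral (1 / \<bar>-1\<bar> ^ DIM(real)) *\<^sub>R f 0)
      ((\<lambda>t. (1 / (-1)) *\<^sub>R t + - ((1 / (-1)) *\<^sub>R 1)) ` cbox 0 (1::real))"
    by (rule has_integral_affinity) (use has_integral_circle_mean[OF f] in auto)
  moreover have "(\<lambda>t. (1 / (-1)) *\<^sub>R t + - ((1 / (-1)) *\<^sub>R 1)) ` cbox 0 (1::real) = {0..1}"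
    by (auto simp: image_iff intro!: bexI[of _ "1 - _"])
  moreover have "cis (2 * pi * ((-1) *\<^sub>R t + 1)) = cis (- (2 * pi * t))" for t
    by (simp add: complex_eq_iff right_diff_distrib cos_diff sin_diff)
  ultimately show ?thesis by simp
qed

lemma set_integrable_circle:
  fixes f :: "complex \<Rightarrow> 'b::euclidean_space"
  assumes "continuous_on (cball 0 1) f"
  shows "set_integrable lborel {0..1} (\<lambda>t. f (cis (s * t)))"
proof -
  have "continuous_on {0..1} (\<lambda>t. f (cis (s * t)))"
    by (intro continuous_on_compose2[OF assms] continuous_intros) auto
  then show ?thesis
    unfolding set_integrable_def by (intro borel_integrable_compact) auto
qed

lemma integral_circle_holomorphic:
  assumes f: "f holomorphic_on cball 0 1"
  shows "(LINT t:{0..1}|lborel. f (cis (2 * pi * t))) = f 0"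
    and "(LINT t:{0..1}|lborel. f (cis (- (2 * pi * t)))) = f 0"
    and "(LINT t:{0..1}|lborel. Re (f (cis (2 * pi * t)))) = Re (f 0)"
    and "(LINT t:{0..1}|lborel. Re (f (cis (- (2 * pi * t))))) = Re (f 0)"
proof -
  have c: "continuous_on (cball 0 1) f" using f by (rule holomorphic_on_imp_continuous_on)
  have i: "set_integrable lborel {0..1} (\<lambda>t. f (cis (2 * pi * t)))"
    "set_integrable lborel {0..1} (\<lambda>t. f (cis (- (2 * pi * t))))"
    using set_integrable_circle[OF c, of "2*pi"] set_integrable_circle[OF c, of "- (2*pi)"] by simp_all
  show 1: "(LINT t:{0..1}|lborel. f (cis (2 * pi * t))) = f 0"
    using set_borel_integral_eq_integral(2)[OF i(1)] has_integral_circle_mean[OF f]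
    by (simp add: integral_unique)
  show 2: "(LINT t:{0..1}|lborel. f (cis (- (2 * pi * t)))) = f 0"
    using set_borel_integral_eq_integral(2)[OF i(2)] has_integral_circle_mean_neg[OF f]
    by (simp add: integral_unique)
  have re: "(LINT t:{0..1}|lborel. Re (h t)) = Re (LINT t:{0..1}|lborel. h t)"
    if "set_integrable lborel {0..1} h" for h :: "real \<Rightarrow> complex"
    using that unfolding set_lebesgue_integral_def set_integrable_def
    by (subst integral_Re[symmetric]) auto
  show "(LINT t:{0..1}|lborel. Re (f (cis (2 * pi * t)))) = Re (f 0)"
    "(LINT t:{0..1}|lborel. Re (f (cis (- (2 * pi * t))))) = Re (f 0)"
    using re[OF i(1)] re[OF i(2)] 1 2 by simp_all
qed

text \<open>
  For \<open>\<zeta>\<close> closer to the origin than \<open>y\<close>, the integrand is holomorphic on the disc bounded by the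
  circle and the mean is the value at the centre. Otherwise it is holomorphic outside, and the mean
  is the value at infinity, which is \<open>0\<close>.
\<close>
lemma circle_mean_inverse:
  shows "cmod \<zeta> < cmod y \<Longrightarrow> circle_mean (\<lambda>w. 1 / (y - w)) \<zeta> = 1 / y"
    and "cmod y < cmod \<zeta> \<Longrightarrow> circle_mean (\<lambda>w. 1 / (y - w)) \<zeta> = 0"
proof -
  assume *: "cmod \<zeta> < cmod y"
  have "y \<noteq> \<zeta> * w" if "cmod w \<le> 1" for w
    using * that mult_left_le[of "cmod w" "cmod \<zeta>"] by (auto simp: norm_mult)
  then have "(\<lambda>w. 1 / (y - \<zeta> * w)) holomorphic_on cball 0 1"
    by (intro holomorphic_intros) auto
  from integral_circle_holomorphic(1)[OF this] show "circle_mean (\<lambda>w. 1 / (y - w)) \<zeta> = 1 / y"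
    by (simp add: circle_mean_def)
next
  assume *: "cmod y < cmod \<zeta>"
  then have nz: "\<zeta> \<noteq> 0" by auto
  have ne: "\<zeta> \<noteq> y * w" if "cmod w \<le> 1" for w
    using * that mult_left_le[of "cmod w" "cmod y"] by (auto simp: norm_mult)
  then have "(\<lambda>w. w / (y * w - \<zeta>)) holomorphic_on cball 0 1"
    by (intro holomorphic_intros) auto
  note integral_circle_holomorphic(2)[OF this]
  moreover have "cis (- x) / (y * cis (- x) - \<zeta>) = 1 / (y - \<zeta> * cis x)" for x
  proof -
    have "y * cis (- x) - \<zeta> = cis (- x) * (y - \<zeta> * cis x)"
      by (simp add: algebra_simps cis_mult)
    then show ?thesis by (simp add: cis_neq_zero)
  qed
  ultimately show "circle_mean (\<lambda>w. 1 / (y - w)) \<zeta> = 0"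
    by (simp add: circle_mean_def)
qed

text \<open>
  Jensen's formula for one zero. As in the previous lemma, a factor of modulus \<open>cmod y\<close> or \<open>cmod \<zeta>\<close>
  leaves the logarithm of a zero-free holomorphic function with value \<open>1\<close> at the centre.
\<close>
lemma circle_mean_ln:
  shows "cmod \<zeta> < cmod y \<Longrightarrow> circle_mean (\<lambda>w. ln (cmod (y - w))) \<zeta> = ln (cmod y)"
    and "cmod y < cmod \<zeta> \<Longrightarrow> circle_mean (\<lambda>w. ln (cmod (y - w))) \<zeta> = ln (cmod \<zeta>)"
proof -
  have hol: "(\<lambda>w. Ln (1 - a * w) + c) holomorphic_on cball 0 1" if "cmod a < 1" for a c
  proof -
    have "1 - a * w \<notin> \<real>\<^sub>\<le>\<^sub>0" if "w \<in> cball 0 1" for w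
    proof -
      have "cmod (a * w) < 1"
        using that \<open>cmod a < 1\<close> mult_left_le[of "cmod w" "cmod a"] by (simp add: norm_mult)
      then have "Re (1 - a * w) > 0" using abs_Re_le_cmod[of "a * w"] by simp
      then show ?thesis by (auto simp: complex_nonpos_Reals_iff)
    qed
    then show ?thesis by (intro holomorphic_intros) auto
  qed
  have re: "Re (Ln (1 - a * w) + of_real (ln (cmod b))) = ln (cmod (b * (1 - a * w)))"
    if "cmod a < 1" "cmod w \<le> 1" "b \<noteq> 0" for a b w
  proof -
    have "cmod (a * w) < 1"
      using that mult_left_le[of "cmod w" "cmod a"] by (simp add: norm_mult)
    then have "1 - a * w \<noteq> 0" by auto
    then show ?thesis using that by (simp add: norm_mult ln_mult)
  qed
  {
    assume *: "cmod \<zeta> < cmod y"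
    then have y: "y \<noteq> 0" and a: "cmod (\<zeta> / y) < 1" by (auto simp: norm_divide divide_less_eq_1)
    have "Re (Ln (1 - \<zeta> / y * cis x) + of_real (ln (cmod y))) = ln (cmod (y - \<zeta> * cis x))" for x
      using re[OF a, of "cis x" y] y by (simp add: right_diff_distrib)
    with integral_circle_holomorphic(3)[OF hol[OF a, of "of_real (ln (cmod y))"]]
    have "(LINT t:{0..1}|lborel. ln (cmod (y - \<zeta> * cis (2 * pi * t)))) = Re (Ln (1 - \<zeta> / y * 0) + of_real (ln (cmod y)))"
      by (simp only:)
    then show "circle_mean (\<lambda>w. ln (cmod (y - w))) \<zeta> = ln (cmod y)"
      by (simp add: circle_mean_def)
  }
  {
    assume *: "cmod y < cmod \<zeta>"
    then have z: "\<zeta> \<noteq> 0" and a: "cmod (y / \<zeta>) < 1" by (auto simp: norm_divide divide_less_eq_1)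
    have "Re (Ln (1 - y / \<zeta> * cis (- x)) + of_real (ln (cmod \<zeta>))) = ln (cmod (y - \<zeta> * cis x))" for x
    proof -
      have "cmod (\<zeta> * (1 - y / \<zeta> * cis (- x))) = cmod (\<zeta> - y * cis (- x)) * cmod (cis x)"
        using z by (simp add: right_diff_distrib)
      also have "\<dots> = cmod (\<zeta> * cis x - y)"
        by (simp only: norm_mult[symmetric] left_diff_distrib mult.assoc cis_mult) simp
      finally show ?thesis
        using re[OF a, of "cis (-x)" \<zeta>] z by (simp add: norm_minus_commute)
    qed
    with integral_circle_holomorphic(4)[OF hol[OF a, of "of_real (ln (cmod \<zeta>))"]]
    have "(LINT t:{0..1}|lborel. ln (cmod (y - \<zeta> * cis (2 * pi * t)))) = Re (Ln (1 - y / \<zeta> * 0) + of_real (ln (cmod \<zeta>)))"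
      by (simp only:)
    then show "circle_mean (\<lambda>w. ln (cmod (y - w))) \<zeta> = ln (cmod \<zeta>)"
      by (simp add: circle_mean_def)
  }
qed

lemma ball_in_borel [measurable]: "ball z r \<in> sets (borel :: complex measure)"
  by simp

text \<open>
  On the dyadic annulus with outer radius \<open>2\<close> to the power \<open>-n\<close> the integrand is at most \<open>2\<close> to the
  power \<open>n + 1\<close>, while the area is of order \<open>4\<close> to the power \<open>-n\<close>.
\<close>
lemma nn_integral_inverse_norm_unit_ball:
  "(\<integral>\<^sup>+\<zeta>. ennreal (1 / cmod \<zeta>) * indicator (ball 0 1) \<zeta> \<partial>lborel) \<le> ennreal (4 * pi)"
proof -
  let ?T = "\<lambda>n \<zeta>. ennreal (2 ^ Suc n) * indicator (ball (0::complex) (1 / 2 ^ n)) \<zeta>"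
  have "ennreal (1 / cmod \<zeta>) * indicator (ball 0 1) \<zeta> \<le> (\<Sum>n. ?T n \<zeta>)" for \<zeta>
  proof (cases "\<zeta> \<noteq> 0 \<and> cmod \<zeta> < 1")
    case True
    obtain N where "(1/2) ^ N < cmod \<zeta>"
      using real_arch_pow_inv[of "cmod \<zeta>" "1/2"] True by auto
    then have "1 / 2 ^ N < cmod \<zeta>" by (simp add: power_one_over)
    moreover have "1 / 2 ^ Suc N \<le> (1 / 2 ^ N :: real)" by (simp add: field_simps)
    ultimately have N: "1 / 2 ^ Suc N \<le> cmod \<zeta>" by linarith
    define n where "n = (LEAST n. 1 / 2 ^ Suc n \<le> cmod \<zeta>)"
    have n: "1 / 2 ^ Suc n \<le> cmod \<zeta>" unfolding n_def using N by (rule LeastI)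
    have "cmod \<zeta> < 1 / 2 ^ n"
    proof (cases n)
      case 0 then show ?thesis using True by simp
    next
      case (Suc m)
      then show ?thesis using not_less_Least[of m "\<lambda>n. 1 / 2 ^ Suc n \<le> cmod \<zeta>"] n_def by simp
    qed
    moreover have "1 / cmod \<zeta> \<le> 2 ^ Suc n"
      using n True by (simp add: field_simps)
    ultimately have "ennreal (1 / cmod \<zeta>) * indicator (ball 0 1) \<zeta> \<le> ?T n \<zeta>"
      using True by (simp add: ennreal_leI)
    also have "\<dots> \<le> (\<Sum>n. ?T n \<zeta>)"
      using sum_le_suminf[of "\<lambda>n. ?T n \<zeta>" "{n}"] by (simp add: summableI del: sum_mult_indicator)
    finally show ?thesis .
  next
    case False
    then have "ennreal (1 / cmod \<zeta>) * indicator (ball 0 1) \<zeta> = 0"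
      by (auto simp: indicator_def)
    then show ?thesis by (simp only: zero_le)
  qed
  then have "(\<integral>\<^sup>+\<zeta>. ennreal (1 / cmod \<zeta>) * indicator (ball 0 1) \<zeta> \<partial>lborel)
      \<le> (\<integral>\<^sup>+\<zeta>. (\<Sum>n. ?T n \<zeta>) \<partial>lborel)"
    by (intro nn_integral_mono) auto
  also have "\<dots> = (\<Sum>n. \<integral>\<^sup>+\<zeta>. ?T n \<zeta> \<partial>lborel)"
  proof (rule nn_integral_suminf)
    fix n
    have [measurable]: "ball 0 (1 / 2 ^ n) \<in> sets (borel :: complex measure)" by simp
    show "?T n \<in> borel_measurable lborel" by measurable
  qed
  also have "\<dots> = (\<Sum>n. ennreal (2 * pi * (1/2) ^ n))"
  proof (rule suminf_cong)
    fix n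
    have "(\<integral>\<^sup>+\<zeta>. ?T n \<zeta> \<partial>lborel) = ennreal (2 ^ Suc n) * ennreal (pi * (1 / 2 ^ n)\<^sup>2)"
      by (subst nn_integral_cmult_indicator) (auto simp: emeasure_ball unit_ball_vol_2)
    also have "\<dots> = ennreal (2 * pi * (1/2) ^ n)"
      by (subst ennreal_mult[symmetric]) (auto simp: power2_eq_square field_simps)
    finally show "(\<integral>\<^sup>+\<zeta>. ?T n \<zeta> \<partial>lborel) = ennreal (2 * pi * (1/2) ^ n)" .
  qed
  also have "\<dots> = ennreal (\<Sum>n. 2 * pi * (1/2) ^ n)"
    by (intro suminf_ennreal2) (auto intro!: summable_mult)
  also have "(\<Sum>n. 2 * pi * (1/2) ^ n) = 4 * pi"
    by (subst suminf_mult) (auto simp: suminf_geometric)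
  finally show ?thesis .
qed

text \<open>
  The bound does not depend on the position of the singularity \<open>y\<close>. This uniformity is what makes
  Fubini's theorem applicable to \<open>y\<close> distributed according to a finite measure.
\<close>
lemma nn_integral_inverse_norm_ball:
  fixes y z :: complex
  assumes "r \<ge> 0"
  shows "(\<integral>\<^sup>+\<zeta>. ennreal (1 / cmod (y - \<zeta>)) * indicator (ball z r) \<zeta> \<partial>lborel)
    \<le> ennreal (4 * pi + pi * r\<^sup>2)"
proof -
  have "(\<integral>\<^sup>+\<zeta>. ennreal (1 / cmod (y - \<zeta>)) * indicator (ball z r) \<zeta> \<partial>lborel)
      \<le> (\<integral>\<^sup>+\<zeta>. ennreal (1 / cmod (\<zeta> - y)) * indicator (ball 0 1) (\<zeta> - y) + indicator (ball z r) \<zeta> \<partial>lborel)"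
    (is "_ \<le> integral\<^sup>N _ (\<lambda>\<zeta>. ?f \<zeta> + _)")
  proof (intro nn_integral_mono)
    fix \<zeta> :: complex
    show "ennreal (1 / cmod (y - \<zeta>)) * indicator (ball z r) \<zeta>
       \<le> ennreal (1 / cmod (\<zeta> - y)) * indicator (ball 0 1) (\<zeta> - y) + indicator (ball z r) \<zeta>"
    proof -
      define d where "d = cmod (\<zeta> - y)"
      have d: "cmod (y - \<zeta>) = d" by (simp add: d_def norm_minus_commute)
      have "d \<ge> 1 \<Longrightarrow> ennreal (1 / d) \<le> 1"
        by (simp add: divide_le_eq_1)
      then show ?thesis unfolding d d_def[symmetric]
        by (cases "d < 1") (auto simp: indicator_def d_def)
    qed
  qed
  also have "\<dots> = (\<integral>\<^sup>+\<zeta>. ?f \<zeta> \<partial>lborel) + emeasure lborel (ball z r)"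
    by (subst nn_integral_add) auto
  also have "(\<integral>\<^sup>+\<zeta>. ?f \<zeta> \<partial>lborel)
      = (\<integral>\<^sup>+\<zeta>. ennreal (1 / cmod \<zeta>) * indicator (ball 0 1) \<zeta> \<partial>distr lborel borel (\<lambda>\<zeta>. (-y) + \<zeta>))"
    by (subst nn_integral_distr) auto
  also have "\<dots> \<le> ennreal (4 * pi)"
    unfolding lborel_distr_plus by (rule nn_integral_inverse_norm_unit_ball)
  also have "emeasure lborel (ball z r) = ennreal (pi * r\<^sup>2)"
    using assms by (simp add: emeasure_ball unit_ball_vol_2)
  finally show ?thesis
    using assms by (simp add: ennreal_plus add_right_mono)
qed


lemma integrable_indicator_ball: "integrable lborel (indicator (ball z r) :: complex \<Rightarrow> real)"
  by (intro integrable_real_indicator emeasure_bounded_finite) auto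

lemma set_integrable_inverse_ball:
  fixes y z :: complex
  shows "set_integrable lborel (ball z r) (\<lambda>\<zeta>. 1 / (y - \<zeta>))"
proof (cases "r \<ge> 0")
  case True
  have m: "(\<lambda>\<zeta>. indicator (ball z r) \<zeta> *\<^sub>R (1 / (y - \<zeta>))) \<in> borel_measurable lborel"
    by measurable
  have "(\<integral>\<^sup>+\<zeta>. ennreal (norm (indicator (ball z r) \<zeta> *\<^sub>R (1 / (y - \<zeta>)))) \<partial>lborel)
      = (\<integral>\<^sup>+\<zeta>. ennreal (1 / cmod (y - \<zeta>)) * indicator (ball z r) \<zeta> \<partial>lborel)"
    by (intro nn_integral_cong) (auto simp: indicator_def norm_divide)
  also have "\<dots> < \<infinity>"
    using nn_integral_inverse_norm_ball[OF True, of y z] by (simp add: order_le_less_trans)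
  finally show ?thesis
    unfolding set_integrable_def using m by (intro integrableI_bounded) auto
next
  case False
  then have b: "ball z r = {}" by simp
  show ?thesis unfolding set_integrable_def b by simp
qed

lemma abs_ln_le: "t \<ge> 0 \<Longrightarrow> \<bar>ln t\<bar> \<le> t + 1 / t" for t :: real
proof (cases "t = 0")
  case False
  assume "t \<ge> 0"
  then have "t > 0" using False by simp
  then have "ln t \<le> t - 1" "- ln t \<le> 1 / t - 1" "1 / t > 0"
    using ln_le_minus_one[of t] ln_le_minus_one[of "1/t"] by (simp_all add: ln_div)
  then show ?thesis using \<open>t > 0\<close> by (simp only: abs_le_iff) linarith
qed simp

lemma set_integrable_ln_ball:
  fixes y z :: complex
  shows "set_integrable lborel (ball z r) (\<lambda>\<zeta>. ln (cmod (y - \<zeta>)))"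
  unfolding set_integrable_def
proof (rule Bochner_Integration.integrable_bound)
  have "integrable lborel (\<lambda>\<zeta>. norm (indicator (ball z r) \<zeta> *\<^sub>R (1 / (y - \<zeta>))))"
    by (rule integrable_norm) (use set_integrable_inverse_ball[of z r y] in \<open>simp add: set_integrable_def\<close>)
  moreover have "integrable lborel (\<lambda>\<zeta>. indicator (ball z r) \<zeta> * (cmod (y - z) + r))"
    by (intro integrable_mult_left integrable_indicator_ball)
  ultimately show "integrable lborel (\<lambda>\<zeta>. norm (indicator (ball z r) \<zeta> *\<^sub>R (1 / (y - \<zeta>)))
      + indicator (ball z r) \<zeta> * (cmod (y - z) + r))"
    by (rule Bochner_Integration.integrable_add)
  show "AE \<zeta> in lborel. norm (indicator (ball z r) \<zeta> *\<^sub>R ln (cmod (y - \<zeta>)))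
      \<le> norm (norm (indicator (ball z r) \<zeta> *\<^sub>R (1 / (y - \<zeta>)))
      + indicator (ball z r) \<zeta> * (cmod (y - z) + r))"
  proof (rule AE_I2)
    fix \<zeta>
    show "norm (indicator (ball z r) \<zeta> *\<^sub>R ln (cmod (y - \<zeta>)))
      \<le> norm (norm (indicator (ball z r) \<zeta> *\<^sub>R (1 / (y - \<zeta>)))
      + indicator (ball z r) \<zeta> * (cmod (y - z) + r))"
    proof (cases "\<zeta> \<in> ball z r")
      case True
      then have "cmod (y - \<zeta>) \<le> cmod (y - z) + r"
        using norm_triangle_ineq[of "y - z" "z - \<zeta>"] by (simp add: dist_norm)
      then show ?thesis
        using abs_ln_le[of "cmod (y - \<zeta>)"] True by (simp add: norm_divide)
    qed simp
  qed
qed measurable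

lemma AE_not_on_circle: "AE \<zeta> in lborel. cmod \<zeta> \<noteq> r"
proof -
  have "sphere (0::complex) r \<in> null_sets lborel"
    using negligible_sphere[of "0::complex" r] by (simp add: negligible_iff_null_sets null_sets_completion_iff)
  then show ?thesis by (rule AE_I') auto
qed

lemma content_complex_ball: "r \<ge> 0 \<Longrightarrow> measure lborel (ball (z::complex) r) = pi * r\<^sup>2"
  by (simp add: content_ball unit_ball_vol_2)

lemma disc_integral_inverse:
  fixes y :: complex
  assumes "\<delta> > 0"
  shows "(LINT \<zeta>:ball 0 \<delta>|lborel. 1 / (y - \<zeta>)) = of_real (pi * (min (cmod y) \<delta>)\<^sup>2) / y"
proof -
  have "(LINT \<zeta>:ball 0 \<delta>|lborel. 1 / (y - \<zeta>))
      = (LINT \<zeta>:ball 0 \<delta>|lborel. circle_mean (\<lambda>w. 1 / (y - w)) \<zeta>)"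
    by (subst disc_integral_circle_mean(2)) (auto intro: set_integrable_inverse_ball)
  also have "\<dots> = (LINT \<zeta>|lborel. indicator (ball (0::complex) (min (cmod y) \<delta>)) \<zeta> *\<^sub>R (1 / y))"
    unfolding set_lebesgue_integral_def
  proof (rule Bochner_Integration.integral_cong_AE)
    show "AE \<zeta> in lborel. indicator (ball 0 \<delta>) \<zeta> *\<^sub>R circle_mean (\<lambda>w. 1 / (y - w)) \<zeta>
        = indicator (ball 0 (min (cmod y) \<delta>)) \<zeta> *\<^sub>R (1 / y)"
      using AE_not_on_circle[of "cmod y"]
    proof eventually_elim
      case (elim \<zeta>)
      then consider "cmod \<zeta> < cmod y" | "cmod y < cmod \<zeta>" by linarith
      then show ?case
        by cases (auto simp: circle_mean_inverse indicator_def)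
    qed
    show "(\<lambda>\<zeta>. indicator (ball 0 \<delta>) \<zeta> *\<^sub>R circle_mean (\<lambda>w. 1 / (y - w)) \<zeta>) \<in> borel_measurable lborel"
      using disc_integral_circle_mean(1)[OF set_integrable_inverse_ball, of y \<delta>]
      by (auto simp: set_integrable_def)
  qed measurable
  also have "\<dots> = measure lborel (ball (0::complex) (min (cmod y) \<delta>)) *\<^sub>R (1 / y)"
    by (subst integral_scaleR_left) (auto simp: integrable_indicator_ball)
  also have "\<dots> = of_real (pi * (min (cmod y) \<delta>)\<^sup>2) / y"
    using assms by (subst content_complex_ball) (auto simp: scaleR_conv_of_real)
  finally show ?thesis .
qed

text \<open>
  The logarithmic kernel is superharmonic; the strict inequality detects a singularity inside the
  disc and later shows that a potential is not harmonic near points of the support.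
\<close>
lemma disc_integral_ln:
  fixes y :: complex
  assumes "\<delta> > 0" "y \<noteq> 0"
  shows "pi * \<delta>\<^sup>2 * ln (cmod y) \<le> (LINT \<zeta>:ball 0 \<delta>|lborel. ln (cmod (y - \<zeta>)))"
    and "cmod y < \<delta> \<Longrightarrow> pi * \<delta>\<^sup>2 * ln (cmod y) < (LINT \<zeta>:ball 0 \<delta>|lborel. ln (cmod (y - \<zeta>)))"
proof -
  let ?m = "circle_mean (\<lambda>w. ln (cmod (y - w)))"
  let ?h = "\<lambda>\<zeta>. indicator (ball 0 \<delta>) \<zeta> *\<^sub>R ?m \<zeta> - indicator (ball 0 \<delta>) \<zeta> *\<^sub>R ln (cmod y)"
  have mi: "set_integrable lborel (ball 0 \<delta>) ?m"
    by (rule disc_integral_circle_mean(1)[OF set_integrable_ln_ball]) measurable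
  have eq: "(LINT \<zeta>:ball 0 \<delta>|lborel. ln (cmod (y - \<zeta>))) = (LINT \<zeta>:ball 0 \<delta>|lborel. ?m \<zeta>)"
    by (subst disc_integral_circle_mean(2)) (auto intro: set_integrable_ln_ball)
  have ci: "integrable lborel (\<lambda>\<zeta>::complex. indicator (ball 0 \<delta>) \<zeta> *\<^sub>R ln (cmod y))"
    by (intro integrable_scaleR_left integrable_indicator_ball)
  have hi: "integrable lborel ?h"
    using mi ci unfolding set_integrable_def by (rule Bochner_Integration.integrable_diff)
  have "(LINT \<zeta>|lborel. ?h \<zeta>) = (LINT \<zeta>:ball 0 \<delta>|lborel. ?m \<zeta>)
      - (LINT \<zeta>|lborel. indicator (ball (0::complex) \<delta>) \<zeta> *\<^sub>R ln (cmod y))"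
    using mi ci unfolding set_integrable_def set_lebesgue_integral_def
    by (rule Bochner_Integration.integral_diff)
  also have "(LINT \<zeta>|lborel. indicator (ball (0::complex) \<delta>) \<zeta> *\<^sub>R ln (cmod y)) = pi * \<delta>\<^sup>2 * ln (cmod y)"
    using assms content_complex_ball[of \<delta> 0]
    by (subst integral_scaleR_left) (auto simp: integrable_indicator_ball)
  finally have h: "(LINT \<zeta>|lborel. ?h \<zeta>)
      = (LINT \<zeta>:ball 0 \<delta>|lborel. ln (cmod (y - \<zeta>))) - pi * \<delta>\<^sup>2 * ln (cmod y)"
    by (simp add: eq)
  have AE: "AE \<zeta> in lborel. 0 \<le> ?h \<zeta> \<and> (cmod y < cmod \<zeta> \<longrightarrow> cmod \<zeta> < \<delta> \<longrightarrow> 0 < ?h \<zeta>)"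
    using AE_not_on_circle[of "cmod y"]
  proof eventually_elim
    case (elim \<zeta>)
    then consider "cmod \<zeta> < cmod y" | "cmod y < cmod \<zeta>" by linarith
    then show ?case
    proof cases
      case 2
      then have "ln (cmod y) < ln (cmod \<zeta>)" using assms by (subst ln_less_cancel_iff) auto
      then show ?thesis using assms 2 by (auto simp: circle_mean_ln indicator_def)
    qed (use assms in \<open>auto simp: circle_mean_ln indicator_def\<close>)
  qed
  have nn: "0 \<le> (LINT \<zeta>|lborel. ?h \<zeta>)"
    using AE by (intro integral_nonneg_AE) auto
  then show "pi * \<delta>\<^sup>2 * ln (cmod y) \<le> (LINT \<zeta>:ball 0 \<delta>|lborel. ln (cmod (y - \<zeta>)))"
    using h by linarith
  assume "cmod y < \<delta>"
  show "pi * \<delta>\<^sup>2 * ln (cmod y) < (LINT \<zeta>:ball 0 \<delta>|lborel. ln (cmod (y - \<zeta>)))"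
  proof (rule ccontr)
    assume "\<not> ?thesis"
    then have "(LINT \<zeta>|lborel. ?h \<zeta>) = 0" using h nn by linarith
    then have "AE \<zeta> in lborel. ?h \<zeta> = 0"
      using AE by (subst (asm) integral_nonneg_eq_0_iff_AE[OF hi]) auto
    with AE have "AE \<zeta> in lborel. \<zeta> \<notin> ball 0 \<delta> - cball (0::complex) (cmod y)"
      by eventually_elim auto
    then have "ball 0 \<delta> - cball (0::complex) (cmod y) \<in> null_sets lborel"
      by (subst AE_iff_null_sets) auto
    moreover have "open (ball 0 \<delta> - cball (0::complex) (cmod y))" by (auto intro: open_Diff)
    ultimately have "ball 0 \<delta> - cball (0::complex) (cmod y) = {}"
      by (intro open_null_set_lborel)
    moreover have "of_real ((cmod y + \<delta>) / 2) \<in> ball 0 \<delta> - cball (0::complex) (cmod y)"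
      using \<open>cmod y < \<delta>\<close> assms by (simp add: norm_of_real[symmetric] del: of_real_divide of_real_add)
    ultimately show False by blast
  qed
qed


section \<open>The kernels averaged over a disc\<close>

text \<open>
  The logarithmic kernel smoothed at scale \<open>\<delta>\<close>: the singularity is replaced by a quadratic cap, glued
  to \<open>- ln (cmod y)\<close> with matching first derivative. Everything is written in terms of \<open>(cmod y)\<^sup>2\<close>, a
  polynomial in the real coordinates, so that derivatives along lines need no case for \<open>y = 0\<close>.
\<close>
definition disc_kernel :: "real \<Rightarrow> complex \<Rightarrow> real" where
  "disc_kernel \<delta> y = (if (cmod y)\<^sup>2 < \<delta>\<^sup>2 then (1 - (cmod y)\<^sup>2 / \<delta>\<^sup>2) / 2 - ln (\<delta>\<^sup>2) / 2 else - ln ((cmod y)\<^sup>2) / 2)"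

text \<open>
  The complex gradient that belongs to \<open>disc_kernel\<close>; it is the mean of \<open>1 / (y - \<zeta>)\<close> over
  the disc of radius \<open>\<delta>\<close> (\<open>disc_integral_inverse_eq_gradient\<close>).
\<close>
definition disc_gradient :: "real \<Rightarrow> complex \<Rightarrow> complex" where
  "disc_gradient \<delta> y = cnj y / of_real (max ((cmod y)\<^sup>2) (\<delta>\<^sup>2))"

lemma disc_kernel_measurable [measurable]: "disc_kernel \<delta> \<in> borel_measurable borel"
  unfolding disc_kernel_def by measurable

lemma disc_gradient_measurable [measurable]: "disc_gradient \<delta> \<in> borel_measurable borel"
proof -
  have [measurable]: "cnj \<in> borel_measurable borel"
    "(complex_of_real :: real \<Rightarrow> complex) \<in> borel_measurable borel"
    by (intro borel_measurable_continuous_onI continuous_intros)+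
  show ?thesis unfolding disc_gradient_def by measurable
qed

lemma has_real_derivative_glue:
  fixes f :: "real \<Rightarrow> real"
  assumes "(f1 has_real_derivative D) (at x)" "(f2 has_real_derivative D) (at x)"
    and "\<And>t. t \<le> x \<Longrightarrow> f t = f1 t" "\<And>t. t \<ge> x \<Longrightarrow> f t = f2 t"
  shows "(f has_real_derivative D) (at x)"
proof -
  have "((\<lambda>t. (f t - f x) / (t - x)) \<longlongrightarrow> D) (at_left x)"
  proof (rule Lim_transform_eventually)
    show "((\<lambda>t. (f1 t - f1 x) / (t - x)) \<longlongrightarrow> D) (at_left x)"
      using assms(1) by (auto simp: has_field_derivative_iff filterlim_at_split)
    show "\<forall>\<^sub>F t in at_left x. (f1 t - f1 x) / (t - x) = (f t - f x) / (t - x)"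
      by (auto simp: eventually_at_filter assms(3) intro!: always_eventually)
  qed
  moreover have "((\<lambda>t. (f t - f x) / (t - x)) \<longlongrightarrow> D) (at_right x)"
  proof (rule Lim_transform_eventually)
    show "((\<lambda>t. (f2 t - f2 x) / (t - x)) \<longlongrightarrow> D) (at_right x)"
      using assms(2) by (auto simp: has_field_derivative_iff filterlim_at_split)
    show "\<forall>\<^sub>F t in at_right x. (f2 t - f2 x) / (t - x) = (f t - f x) / (t - x)"
      by (auto simp: eventually_at_filter assms(4) intro!: always_eventually)
  qed
  ultimately show ?thesis by (simp add: has_field_derivative_iff filterlim_at_split)
qed

lemma disc_kernel_line_derivative:
  assumes "\<delta> > 0"
  shows "((\<lambda>t. disc_kernel \<delta> (y - of_real t * v)) has_real_derivative
      Re (disc_gradient \<delta> (y - of_real t * v) * v)) (at t)"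
proof -
  define a where "a = \<delta>\<^sup>2"
  have a: "a > 0" using assms by (simp add: a_def)
  define g where "g = (\<lambda>s. if s < a then (1 - s / a) / 2 - ln a / 2 else - ln s / 2)"
  have g: "(g has_real_derivative - 1 / (2 * max s a)) (at s)" for s
  proof -
    have d1: "((\<lambda>s. (1 - s / a) / 2 - ln a / 2) has_real_derivative - 1 / (2 * a)) (at s)"
      using a by (auto intro!: derivative_eq_intros)
    have d2: "((\<lambda>s. - ln s / 2) has_real_derivative - 1 / (2 * s)) (at s)" if "s \<ge> a"
      using a that by (auto intro!: derivative_eq_intros simp: field_simps)
    consider "s < a" | "s = a" | "s > a" by linarith
    then show ?thesis
    proof cases
      case 1
      then have "((\<lambda>s. (1 - s / a) / 2 - ln a / 2) has_real_derivative - 1 / (2 * max s a)) (at s)"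
        using d1 by (simp add: max_def)
      then show ?thesis
        by (rule has_field_derivative_transform_within_open[OF _ open_lessThan])
           (use 1 in \<open>auto simp: g_def\<close>)
    next
      case 2
      show ?thesis
      proof (rule has_real_derivative_glue)
        show "((\<lambda>s. (1 - s / a) / 2 - ln a / 2) has_real_derivative - 1 / (2 * max s a)) (at s)"
          "((\<lambda>s. - ln s / 2) has_real_derivative - 1 / (2 * max s a)) (at s)"
          using d1 d2 2 by simp_all
      qed (use 2 a in \<open>auto simp: g_def\<close>)
    next
      case 3
      then have "((\<lambda>s. - ln s / 2) has_real_derivative - 1 / (2 * max s a)) (at s)"
        using d2 by (simp add: max_def)
      then show ?thesis
        by (rule has_field_derivative_transform_within_open[OF _ open_greaterThan])
           (use 3 in \<open>auto simp: g_def\<close>)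
    qed
  qed
  let ?w = "\<lambda>t. y - of_real t * v"
  have "((\<lambda>t. (Re y - t * Re v)\<^sup>2 + (Im y - t * Im v)\<^sup>2) has_real_derivative
      - 2 * (Re (?w t) * Re v + Im (?w t) * Im v)) (at t)"
    by (auto intro!: derivative_eq_intros simp: algebra_simps)
  then have n: "((\<lambda>t. (cmod (?w t))\<^sup>2) has_real_derivative
      - 2 * (Re (?w t) * Re v + Im (?w t) * Im v)) (at t)"
    by (simp add: cmod_power2)
  have "((\<lambda>t. g ((cmod (?w t))\<^sup>2)) has_real_derivative
      - 1 / (2 * max ((cmod (?w t))\<^sup>2) a) * (- 2 * (Re (?w t) * Re v + Im (?w t) * Im v))) (at t)"
    by (rule DERIV_chain2[OF g n])
  moreover have "disc_kernel \<delta> w = g ((cmod w)\<^sup>2)" for w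
    by (simp add: disc_kernel_def g_def a_def)
  moreover have "Re (disc_gradient \<delta> w * v) = (Re w * Re v + Im w * Im v) / max ((cmod w)\<^sup>2) a" for w
  proof -
    have "disc_gradient \<delta> w * v = (cnj w * v) / of_real (max ((cmod w)\<^sup>2) a)"
      by (simp add: disc_gradient_def a_def)
    then show ?thesis by (simp only: Re_divide_of_real) simp
  qed
  moreover have "- 1 / (2 * m) * (- 2 * u) = u / m" for m u :: real
    by simp
  ultimately show ?thesis by (simp only:)
qed

lemma continuous_disc_gradient: 
  assumes "\<delta> > 0"
  shows "continuous_on S (disc_gradient \<delta>)"
proof -
  have "max ((cmod y)\<^sup>2) (\<delta>\<^sup>2) > 0" for y using assms by (simp add: less_max_iff_disj)
  then have "complex_of_real (max ((cmod y)\<^sup>2) (\<delta>\<^sup>2)) \<noteq> 0" for y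
    by (metis of_real_eq_0_iff less_irrefl)
  then show ?thesis unfolding disc_gradient_def
    by (intro continuous_intros) blast
qed

lemma norm_disc_gradient_le:
  assumes "\<delta> > 0"
  shows "cmod (disc_gradient \<delta> y) \<le> 1 / \<delta>"
proof (cases "cmod y \<le> \<delta>")
  case True
  then have "max ((cmod y)\<^sup>2) (\<delta>\<^sup>2) = \<delta>\<^sup>2" by (simp add: max_absorb2 power_mono)
  then have "cmod (disc_gradient \<delta> y) = cmod y / \<delta>\<^sup>2"
    by (simp add: disc_gradient_def norm_divide norm_power)
  also have "\<dots> \<le> \<delta> / \<delta>\<^sup>2" using True by (rule divide_right_mono) simp
  finally show ?thesis using assms by (simp add: power2_eq_square)
next
  case False
  then have "max ((cmod y)\<^sup>2) (\<delta>\<^sup>2) = (cmod y)\<^sup>2" using assms by (simp add: max_def power2_less_imp_less)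
  then have "cmod (disc_gradient \<delta> y) = cmod y / (cmod y)\<^sup>2"
    by (simp add: disc_gradient_def norm_divide norm_power)
  then have "cmod (disc_gradient \<delta> y) = 1 / cmod y"
    by (simp add: power2_eq_square)
  then show ?thesis using False assms by (simp add: frac_le)
qed

lemma disc_kernel_line_integral:
  assumes "\<delta> > 0"
  shows "(LINT t:{0..1}|lborel. Re (disc_gradient \<delta> (y - of_real t * v) * v))
    = disc_kernel \<delta> (y - v) - disc_kernel \<delta> y"
proof -
  have "((\<lambda>t. Re (disc_gradient \<delta> (y - of_real t * v) * v)) has_integral
      disc_kernel \<delta> (y - of_real 1 * v) - disc_kernel \<delta> (y - of_real 0 * v)) {0..1}"
    by (rule fundamental_theorem_of_calculus)
       (use disc_kernel_line_derivative[OF assms] in \<open>auto simp: has_real_derivative_iff_has_vector_derivative[symmetric] intro: has_field_derivative_at_within\<close>)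
  moreover have "set_integrable lborel {0..1} (\<lambda>t. Re (disc_gradient \<delta> (y - of_real t * v) * v))"
    unfolding set_integrable_def
    by (intro borel_integrable_compact continuous_intros continuous_on_compose2[OF continuous_disc_gradient[OF assms, of UNIV]]) auto
  ultimately show ?thesis
    by (simp add: set_borel_integral_eq_integral(2) integral_unique)
qed

lemma disc_kernel_eq_ln:
  assumes "\<delta> > 0" "cmod y \<ge> \<delta>"
  shows "disc_kernel \<delta> y = - ln (cmod y)"
proof -
  have "\<not> (cmod y)\<^sup>2 < \<delta>\<^sup>2" using assms by (simp add: not_less power_mono)
  moreover have "cmod y > 0" using assms by linarith
  ultimately show ?thesis by (simp add: disc_kernel_def ln_realpow)
qed

lemma disc_gradient_eq_inverse:
  assumes "\<delta> > 0" "cmod y \<ge> \<delta>"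
  shows "disc_gradient \<delta> y = 1 / y"
proof -
  have "max ((cmod y)\<^sup>2) (\<delta>\<^sup>2) = (cmod y)\<^sup>2"
    using power_mono[of \<delta> "cmod y" 2] assms by (simp add: max_def)
  then have "disc_gradient \<delta> y = cnj y / (y * cnj y)"
    by (simp only: disc_gradient_def complex_norm_square)
  moreover have "y \<noteq> 0" using assms by auto
  ultimately show ?thesis by simp
qed

lemma disc_integral_inverse_eq_gradient:
  assumes "\<delta> > 0"
  shows "(LINT \<zeta>:ball 0 \<delta>|lborel. 1 / (y - \<zeta>)) = of_real (pi * \<delta>\<^sup>2) * disc_gradient \<delta> y"
proof (cases "y = 0")
  case False
  show ?thesis
  proof (cases "cmod y \<ge> \<delta>")
    case True
    then show ?thesis using assms disc_gradient_eq_inverse[OF assms True]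
      by (simp add: disc_integral_inverse min_def)
  next
    case F: False
    then have "max ((cmod y)\<^sup>2) (\<delta>\<^sup>2) = \<delta>\<^sup>2"
      using power_mono[of "cmod y" \<delta> 2] by (simp add: max_def)
    then have "of_real (pi * \<delta>\<^sup>2) * disc_gradient \<delta> y = of_real pi * cnj y"
      using assms by (simp add: disc_gradient_def)
    moreover have "of_real (pi * (min (cmod y) \<delta>)\<^sup>2) / y = of_real pi * (y * cnj y) / y"
      using F by (simp add: min_def complex_norm_square[symmetric])
    ultimately show ?thesis
      using False by (simp add: disc_integral_inverse[OF assms])
  qed
next
  case True
  with disc_integral_inverse[OF assms, of y] show ?thesis by (simp add: disc_gradient_def)
qed

text \<open>
  The smoothed kernels increase to the logarithmic kernel as \<open>\<delta>\<close> tends to \<open>0\<close>, which is what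
  monotone convergence needs. If \<open>c\<close> is the square of the larger of the two numbers \<open>\<delta>'\<close> and
  \<open>cmod y\<close>, the inequality reduces to \<open>ln t \<le> t - 1\<close> for \<open>t = c / \<delta>\<^sup>2\<close>.
\<close>
lemma disc_kernel_antimono:
  assumes "0 < \<delta>'" "\<delta>' \<le> \<delta>"
  shows "disc_kernel \<delta> y \<le> disc_kernel \<delta>' y"
proof -
  define s a b where "s = (cmod y)\<^sup>2" and "a = \<delta>\<^sup>2" and "b = \<delta>'\<^sup>2"
  have ab: "0 < b" "b \<le> a" using assms by (auto simp: a_def b_def intro: power_mono)
  have ln: "(1 - s / a) / 2 - ln a / 2 \<le> - ln c / 2 + (1 - s/c) / 2" if "0 < c" "s \<le> c" "c \<le> a" "s \<ge> 0" for c
  proof -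
    have "ln (c / a) \<le> c / a - 1" using that by (intro ln_le_minus_one) auto
    then have "ln c - ln a \<le> c / a - 1" using that ab by (simp add: ln_div)
    moreover have "s * (1 / c - 1 / a) \<le> c * (1 / c - 1 / a)"
      using that by (intro mult_right_mono) (auto simp: frac_le)
    then have "s / c - s / a \<le> 1 - c / a" using that by (simp add: right_diff_distrib)
    moreover have "(1 - p) / 2 - la / 2 \<le> - lc / 2 + (1 - q) / 2"
      if "lc - la \<le> r - 1" "q - p \<le> 1 - r" for p q r la lc :: real
      using that by (simp add: field_simps)
    ultimately show ?thesis by blast
  qed
  have s: "s \<ge> 0" by (simp add: s_def)
  have "(if s < a then (1 - s / a) / 2 - ln a / 2 else - ln s / 2)
     \<le> (if s < b then (1 - s / b) / 2 - ln b / 2 else - ln s / 2)"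
    using ln[of b] ln[of s] ab s by auto
  then show ?thesis unfolding disc_kernel_def s_def a_def b_def .
qed

lemma disc_kernel_bounds:
  assumes "\<delta> > 0" "cmod y \<le> M" "\<delta> \<le> M"
  shows "- ln M \<le> disc_kernel \<delta> y" "disc_kernel \<delta> y \<le> 1/2 - ln \<delta>"
proof -
  have "disc_kernel M y \<le> disc_kernel \<delta> y" by (rule disc_kernel_antimono) (use assms in auto)
  moreover have "- ln M \<le> disc_kernel M y"
  proof (cases "(cmod y)\<^sup>2 < M\<^sup>2")
    case True
    then have "(cmod y)\<^sup>2 / M\<^sup>2 \<le> 1" using assms by (auto simp: divide_le_eq_1)
    then show ?thesis using True assms by (simp add: disc_kernel_def ln_realpow)
  next
    case False
    then have "cmod y = M" using assms
      by (metis linorder_not_le norm_ge_zero order.antisym pos2 power_strict_mono)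
    then show ?thesis using assms by (simp add: disc_kernel_def ln_realpow)
  qed
  ultimately show "- ln M \<le> disc_kernel \<delta> y" by linarith
  show "disc_kernel \<delta> y \<le> 1/2 - ln \<delta>"
  proof (cases "cmod y \<ge> \<delta>")
    case True
    then have "ln \<delta> \<le> ln (cmod y)" using assms by (subst ln_le_cancel_iff) auto
    then show ?thesis by (simp add: disc_kernel_eq_ln[OF assms(1) True])
  next
    case False
    then have "(cmod y)\<^sup>2 < \<delta>\<^sup>2" using assms by (intro power_strict_mono) auto
    then show ?thesis using assms by (simp add: disc_kernel_def ln_realpow field_simps)
  qed
qed

lemma disc_integral_translate:
  fixes f :: "complex \<Rightarrow> 'b::{banach,second_countable_topology}"
  shows "(LINT \<zeta>:ball z \<delta>|lborel. f \<zeta>) = (LINT \<zeta>:ball 0 \<delta>|lborel. f (z + \<zeta>))"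
proof (cases "set_integrable lborel (ball z \<delta>) f")
  case True
  then have m: "(\<lambda>\<zeta>. indicator (ball z \<delta>) \<zeta> *\<^sub>R f \<zeta>) \<in> borel_measurable borel"
    by (auto simp: set_integrable_def)
  have "(LINT \<zeta>:ball z \<delta>|lborel. f \<zeta>)
      = (LINT \<zeta>|distr lborel borel (\<lambda>\<zeta>. z + \<zeta>). indicator (ball z \<delta>) \<zeta> *\<^sub>R f \<zeta>)"
    by (simp add: lborel_distr_plus set_lebesgue_integral_def)
  also have "\<dots> = (LINT \<zeta>|lborel. indicator (ball z \<delta>) (z + \<zeta>) *\<^sub>R f (z + \<zeta>))"
    by (rule integral_distr[OF _ m]) simp
  also have "\<dots> = (LINT \<zeta>:ball 0 \<delta>|lborel. f (z + \<zeta>))"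
    unfolding set_lebesgue_integral_def
    by (intro Bochner_Integration.integral_cong) (auto simp: indicator_def dist_norm)
  finally show ?thesis .
next
  case False
  have "set_integrable lborel (ball z \<delta>) f" if "set_integrable lborel (ball 0 \<delta>) (\<lambda>\<zeta>. f (z + \<zeta>))"
  proof -
    have m: "(\<lambda>\<zeta>. indicator (ball 0 \<delta>) \<zeta> *\<^sub>R f (z + \<zeta>)) \<in> borel_measurable borel"
      using that by (auto simp: set_integrable_def)
    have "integrable (distr lborel borel (\<lambda>\<zeta>. -z + \<zeta>)) (\<lambda>\<zeta>. indicator (ball 0 \<delta>) \<zeta> *\<^sub>R f (z + \<zeta>))"
      using that unfolding lborel_distr_plus set_integrable_def .
    then have "integrable lborel (\<lambda>\<zeta>. indicator (ball 0 \<delta>) (-z + \<zeta>) *\<^sub>R f (z + (-z + \<zeta>)))"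
      by (subst (asm) integrable_distr_eq[OF _ m]) auto
    moreover have "indicator (ball 0 \<delta>) (-z + \<zeta>) = (indicator (ball z \<delta>) \<zeta> :: real)" for \<zeta>
      by (auto simp: indicator_def dist_norm norm_minus_commute)
    ultimately show ?thesis by (simp add: set_integrable_def)
  qed
  with False have n: "\<not> set_integrable lborel (ball 0 \<delta>) (\<lambda>\<zeta>. f (z + \<zeta>))" by blast
  show ?thesis
    using False n unfolding set_lebesgue_integral_def set_integrable_def
    by (metis (no_types, lifting) not_integrable_integral_eq)
qed

text \<open>The mean value property, again from the circle means.\<close>
lemma disc_integral_holomorphic:
  assumes \<sigma>: "\<sigma> holomorphic_on ball z r" and "0 < \<delta>" "\<delta> < r"
  shows "set_integrable lborel (ball z \<delta>) (\<lambda>\<zeta>. Re (\<sigma> \<zeta>))"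
    and "(LINT \<zeta>:ball z \<delta>|lborel. Re (\<sigma> \<zeta>)) = pi * \<delta>\<^sup>2 * Re (\<sigma> z)"
proof -
  have cont: "continuous_on (cball z \<delta>) (\<lambda>\<zeta>. Re (\<sigma> \<zeta>))"
    using assms by (intro continuous_intros holomorphic_on_imp_continuous_on holomorphic_on_subset[OF \<sigma>]) auto
  have "set_integrable lborel (cball z \<delta>) (\<lambda>\<zeta>. Re (\<sigma> \<zeta>))"
    unfolding set_integrable_def by (rule borel_integrable_compact[OF _ cont]) simp
  then show "set_integrable lborel (ball z \<delta>) (\<lambda>\<zeta>. Re (\<sigma> \<zeta>))"
    by (rule set_integrable_subset) auto
  define f where "f = (\<lambda>\<zeta>. indicator (cball 0 \<delta>) \<zeta> *\<^sub>R Re (\<sigma> (z + \<zeta>)))"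
  have cont': "continuous_on (cball 0 \<delta>) (\<lambda>\<zeta>. Re (\<sigma> (z + \<zeta>)))"
    by (rule continuous_on_compose2[OF cont]) (auto intro!: continuous_intros simp: dist_norm)
  have fint: "integrable lborel f"
    unfolding f_def by (rule borel_integrable_compact[OF _ cont']) simp
  then have "set_integrable lborel (ball 0 \<delta>) f"
    using integrable_mult_indicator[of "ball 0 \<delta>" lborel f] by (simp add: set_integrable_def)
  moreover have "f \<in> borel_measurable borel" using borel_measurable_integrable[OF fint] by simp
  ultimately have "(LINT \<zeta>:ball 0 \<delta>|lborel. f \<zeta>) = (LINT \<zeta>:ball 0 \<delta>|lborel. circle_mean f \<zeta>)"
    by (simp add: disc_integral_circle_mean(2))
  also have "\<dots> = (LINT \<zeta>|lborel. indicator (ball (0::complex) \<delta>) \<zeta> *\<^sub>R Re (\<sigma> z))"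
    unfolding set_lebesgue_integral_def
  proof (rule Bochner_Integration.integral_cong[OF refl])
    fix \<zeta> :: complex
    show "indicator (ball 0 \<delta>) \<zeta> *\<^sub>R circle_mean f \<zeta> = indicator (ball 0 \<delta>) \<zeta> *\<^sub>R Re (\<sigma> z)"
    proof (cases "\<zeta> \<in> ball 0 \<delta>")
      case True
      have in_ball: "z + \<zeta> * w \<in> ball z r" if "w \<in> cball 0 1" for w
        using that True assms mult_mono[of "cmod \<zeta>" \<delta> "cmod w" 1] by (simp add: dist_norm norm_mult)
      have "(\<sigma> \<circ> (\<lambda>w. z + \<zeta> * w)) holomorphic_on cball 0 1"
        by (intro holomorphic_on_compose_gen[OF _ \<sigma>] holomorphic_intros) (use in_ball in auto)
      from integral_circle_holomorphic(3)[OF this] True show ?thesis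
        by (simp add: circle_mean_def f_def norm_mult)
    qed simp
  qed
  also have "\<dots> = pi * \<delta>\<^sup>2 * Re (\<sigma> z)"
    using assms content_complex_ball[of \<delta> 0]
    by (subst integral_scaleR_left) (auto simp: integrable_indicator_ball)
  finally have "(LINT \<zeta>:ball 0 \<delta>|lborel. f \<zeta>) = pi * \<delta>\<^sup>2 * Re (\<sigma> z)" .
  moreover have "(LINT \<zeta>:ball 0 \<delta>|lborel. f \<zeta>) = (LINT \<zeta>:ball 0 \<delta>|lborel. Re (\<sigma> (z + \<zeta>)))"
    unfolding set_lebesgue_integral_def f_def
    by (intro Bochner_Integration.integral_cong) (auto simp: indicator_def)
  ultimately show "(LINT \<zeta>:ball z \<delta>|lborel. Re (\<sigma> \<zeta>)) = pi * \<delta>\<^sup>2 * Re (\<sigma> z)"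
    by (subst disc_integral_translate) simp
qed


section \<open>Potentials and Cauchy transforms of a compactly supported measure\<close>

locale plane_measure = finite_measure \<mu> for \<mu> :: "complex measure" +
  assumes sets_eq [measurable_cong]: "sets \<mu> = sets borel"
    and compact_msupp: "compact (msupp \<mu>)"
begin

lemma space_eq [simp]: "space \<mu> = UNIV"
  using sets_eq_imp_space_eq[OF sets_eq] by simp

text \<open>
  The complement of the support is a union of open null sets; by the Lindelof property
  countably many of them suffice.
\<close>
lemma AE_msupp: "AE x in \<mu>. x \<in> msupp \<mu>"
proof -
  let ?F = "{U. open U \<and> emeasure \<mu> U = 0}"
  obtain F where F: "F \<subseteq> ?F" "countable F" "\<Union>F = \<Union>?F"
    using Lindelof[of ?F] by auto
  have "\<Union>F \<in> null_sets \<mu>"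
  proof -
    have "(\<Union>U\<in>F. U) \<in> null_sets \<mu>"
      by (rule null_sets_UN') (use F in \<open>auto simp: null_sets_def sets_eq\<close>)
    then show ?thesis by simp
  qed
  moreover have "- msupp \<mu> = \<Union>?F" by (auto simp: msupp_def)
  ultimately show ?thesis using F(3) by (intro AE_I'[of "\<Union>F"]) auto
qed

lemma msupp_bounded: obtains M where "M > 0" "\<And>x. x \<in> msupp \<mu> \<Longrightarrow> cmod x \<le> M"
  using compact_imp_bounded[OF compact_msupp] by (auto simp: bounded_pos)

definition disc_potential :: "real \<Rightarrow> complex \<Rightarrow> real" where
  "disc_potential \<delta> z = (LINT x|\<mu>. disc_kernel \<delta> (x - z))"

definition disc_cauchy :: "real \<Rightarrow> complex \<Rightarrow> complex" where
  "disc_cauchy \<delta> z = (LINT x|\<mu>. disc_gradient \<delta> (x - z))"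

text \<open>
  The real-valued potential. Since \<open>ln 0 = 0\<close> and the Bochner integral of a non-integrable function
  is \<open>0\<close>, it is meaningful only at points of finite potential, as defined below; there it agrees
  with \<^const>\<open>log_potential\<close> (\<open>log_potential_eq\<close>).
\<close>
definition potential :: "complex \<Rightarrow> real" where
  "potential z = (LINT x|\<mu>. - ln (cmod (x - z)))"

definition cauchy :: "complex \<Rightarrow> complex" where
  "cauchy z = (LINT x|\<mu>. 1 / (x - z))"

definition finite_potential :: "complex \<Rightarrow> bool" where
  "finite_potential z \<longleftrightarrow> emeasure \<mu> {z} = 0 \<and> integrable \<mu> (\<lambda>x. - ln (cmod (x - z)))"

lemma integrable_disc_kernel:
  assumes "\<delta> > 0"
  shows "integrable \<mu> (\<lambda>x. disc_kernel \<delta> (x - z))"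
proof -
  obtain M where M: "M > 0" "\<And>x. x \<in> msupp \<mu> \<Longrightarrow> cmod x \<le> M" using msupp_bounded by blast
  define L where "L = M + cmod z + \<delta>"
  have L: "\<delta> \<le> L" using M assms by (simp add: L_def)
  have "\<bar>disc_kernel \<delta> (x - z)\<bar> \<le> \<bar>ln L\<bar> + \<bar>1/2 - ln \<delta>\<bar>" if "x \<in> msupp \<mu>" for x
  proof -
    have "cmod (x - z) \<le> L"
      using M(2)[OF that] norm_triangle_ineq4[of x z] assms by (simp add: L_def)
    from disc_kernel_bounds[OF assms this L] show ?thesis by linarith
  qed
  then have "AE x in \<mu>. norm (disc_kernel \<delta> (x - z)) \<le> \<bar>ln L\<bar> + \<bar>1/2 - ln \<delta>\<bar>"
    using AE_msupp by (auto elim!: eventually_mono)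
  then show ?thesis by (rule integrable_const_bound) measurable
qed

lemma integrable_disc_gradient:
  assumes "\<delta> > 0"
  shows "integrable \<mu> (\<lambda>x. disc_gradient \<delta> (x - z))"
  by (rule integrable_const_bound[of _ "1/\<delta>"]) (use norm_disc_gradient_le[OF assms] in auto)

lemma pair_lborel: "pair_sigma_finite \<mu> (lborel :: 'a::euclidean_space measure)"
  unfolding pair_sigma_finite_def by (simp add: sigma_finite_measure_axioms lborel.sigma_finite_measure_axioms)

text \<open>
  The fundamental theorem of calculus along a segment, integrated against the measure. The smoothed
  gradient is bounded, so the order of integration may be exchanged.
\<close>
lemma disc_potential_increment:
  assumes "\<delta> > 0"
  shows "set_integrable lborel {0..1} (\<lambda>t. Re (disc_cauchy \<delta> (a + of_real t * v) * v))"
    and "(LINT t:{0..1}|lborel. Re (disc_cauchy \<delta> (a + of_real t * v) * v))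
      = disc_potential \<delta> (a + v) - disc_potential \<delta> a"
proof -
  interpret P: pair_sigma_finite \<mu> "lborel :: real measure" by (rule pair_lborel)
  define F where "F = (\<lambda>x t. indicator {0..1::real} t *\<^sub>R Re (disc_gradient \<delta> ((x - a) - of_real t * v) * v))"
  have c: "set_integrable lborel {0..1} (\<lambda>t. Re (disc_gradient \<delta> (y - of_real t * v) * v))" for y
    unfolding set_integrable_def
    by (intro borel_integrable_compact continuous_intros continuous_on_compose2[OF continuous_disc_gradient[OF assms, of UNIV]]) auto
  have bnd: "\<bar>Re (disc_gradient \<delta> w * v)\<bar> \<le> cmod v / \<delta>" for w
    using abs_Re_le_cmod[of "disc_gradient \<delta> w * v"] mult_right_mono[OF norm_disc_gradient_le[OF assms, of w], of "cmod v"]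
    by (simp add: norm_mult)
  have [measurable]: "(complex_of_real :: real \<Rightarrow> complex) \<in> borel_measurable borel"
    by (intro borel_measurable_continuous_onI continuous_intros)
  have Fm: "case_prod F \<in> borel_measurable (\<mu> \<Otimes>\<^sub>M lborel)"
    unfolding F_def by measurable
  have one: "(LINT t|lborel. indicator {0..1::real} t * c) = c" "integrable lborel (\<lambda>t. indicator {0..1::real} t * c)" for c :: real
    by (subst integral_mult_left_zero) (auto simp: emeasure_lborel_Icc_eq)
  have FI: "integrable (\<mu> \<Otimes>\<^sub>M lborel) (case_prod F)"
  proof (rule P.Fubini_integrable[OF Fm])
    have m: "(\<lambda>x. LINT t|lborel. norm (F x t)) \<in> borel_measurable \<mu>"
      using Fm by (intro lborel.borel_measurable_lebesgue_integral) (auto simp: case_prod_beta')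
    have "norm (LINT t|lborel. norm (F x t)) \<le> cmod v / \<delta>" for x
    proof -
      have "(LINT t|lborel. norm (F x t)) \<le> (LINT t|lborel. indicator {0..1::real} t * (cmod v / \<delta>))"
      proof (rule integral_mono)
        show "integrable lborel (\<lambda>t. norm (F x t))"
          using c[of "x - a"] unfolding F_def set_integrable_def by (rule integrable_norm)
        show "integrable lborel (\<lambda>t. indicator {0..1::real} t * (cmod v / \<delta>))" by (rule one)
        show "norm (F x t) \<le> indicator {0..1} t * (cmod v / \<delta>)" for t
          using bnd by (simp add: F_def indicator_def)
      qed
      then show ?thesis by (simp add: one)
    qed
    then show "integrable \<mu> (\<lambda>x. LINT t|lborel. norm (case_prod F (x, t)))"
      using m by (intro integrable_const_bound[of _ "cmod v / \<delta>"]) auto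
    show "AE x in \<mu>. integrable lborel (\<lambda>t. case_prod F (x, t))"
      using c by (simp add: F_def set_integrable_def)
  qed
  have inner1: "(LINT t|lborel. F x t) = disc_kernel \<delta> (x - (a + v)) - disc_kernel \<delta> (x - a)" for x
    using disc_kernel_line_integral[OF assms, of "x - a" v]
    by (simp add: F_def set_lebesgue_integral_def diff_diff_eq)
  have inner2: "(LINT x|\<mu>. F x t) = indicator {0..1} t *\<^sub>R Re (disc_cauchy \<delta> (a + of_real t * v) * v)" for t
  proof -
    have i: "integrable \<mu> (\<lambda>x. disc_gradient \<delta> (x - (a + of_real t * v)) * v)"
      by (intro integrable_mult_left integrable_disc_gradient assms)
    have "Re (disc_cauchy \<delta> (a + of_real t * v) * v) = (LINT x|\<mu>. Re (disc_gradient \<delta> (x - (a + of_real t * v)) * v))"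
      unfolding disc_cauchy_def integral_mult_left_zero[symmetric] by (rule integral_Re[OF i, symmetric])
    then show ?thesis by (simp add: F_def diff_diff_eq)
  qed
  show "set_integrable lborel {0..1} (\<lambda>t. Re (disc_cauchy \<delta> (a + of_real t * v) * v))"
    using P.integrable_snd[OF FI] by (simp add: set_integrable_def inner2)
  have "(LINT t:{0..1}|lborel. Re (disc_cauchy \<delta> (a + of_real t * v) * v)) = (LINT t|lborel. LINT x|\<mu>. F x t)"
    by (simp add: inner2 set_lebesgue_integral_def)
  also have "\<dots> = (LINT x|\<mu>. LINT t|lborel. F x t)" by (rule P.Fubini_integral[OF FI])
  also have "\<dots> = disc_potential \<delta> (a + v) - disc_potential \<delta> a"
    unfolding inner1 disc_potential_def
    by (intro Bochner_Integration.integral_diff integrable_disc_kernel assms)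
  finally show "(LINT t:{0..1}|lborel. Re (disc_cauchy \<delta> (a + of_real t * v) * v))
      = disc_potential \<delta> (a + v) - disc_potential \<delta> a" .
qed

lemma integral_inverse_norm_ball:
  fixes y z :: complex
  assumes "r > 0"
  shows "(LINT \<zeta>|lborel. norm (indicator (ball z r) \<zeta> *\<^sub>R (1 / (y - \<zeta>)))) \<le> 4 * pi + pi * r\<^sup>2"
proof (rule integral_real_bounded)
  have "(\<integral>\<^sup>+\<zeta>. ennreal (norm (indicator (ball z r) \<zeta> *\<^sub>R (1 / (y - \<zeta>)))) \<partial>lborel)
      = (\<integral>\<^sup>+\<zeta>. ennreal (1 / cmod (y - \<zeta>)) * indicator (ball z r) \<zeta> \<partial>lborel)"
    by (intro nn_integral_cong) (auto simp: indicator_def norm_divide)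
  then show "(\<integral>\<^sup>+\<zeta>. ennreal (norm (indicator (ball z r) \<zeta> *\<^sub>R (1 / (y - \<zeta>)))) \<partial>lborel) \<le> ennreal (4 * pi + pi * r\<^sup>2)"
    using nn_integral_inverse_norm_ball[of r y z] assms by simp
qed simp

text \<open>
  Averaging the Cauchy transform over a disc only averages its kernel. This is the bridge by which
  information on the Cauchy transform that holds almost everywhere reaches the smoothed potential
  at every point.
\<close>
lemma disc_integral_cauchy:
  assumes "\<delta> > 0"
  shows "set_integrable lborel (ball z \<delta>) cauchy"
    and "(LINT \<zeta>:ball z \<delta>|lborel. cauchy \<zeta>) = of_real (pi * \<delta>\<^sup>2) * disc_cauchy \<delta> z"
    and "AE \<zeta> in lborel. \<zeta> \<in> ball z \<delta> \<longrightarrow> integrable \<mu> (\<lambda>x. 1 / (x - \<zeta>))"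
proof -
  interpret P: pair_sigma_finite \<mu> "lborel :: complex measure" by (rule pair_lborel)
  define F :: "complex \<Rightarrow> complex \<Rightarrow> complex" where "F = (\<lambda>x \<zeta>. indicator (ball z \<delta>) \<zeta> *\<^sub>R (1 / (x - \<zeta>)))"
  have Fm: "case_prod F \<in> borel_measurable (\<mu> \<Otimes>\<^sub>M lborel)"
    unfolding F_def by measurable
  have FI: "integrable (\<mu> \<Otimes>\<^sub>M lborel) (case_prod F)"
  proof (rule P.Fubini_integrable[OF Fm])
    have m: "(\<lambda>x. LINT \<zeta>|lborel. norm (F x \<zeta>)) \<in> borel_measurable \<mu>"
      using Fm by (intro lborel.borel_measurable_lebesgue_integral) (auto simp: case_prod_beta')
    have "norm (LINT \<zeta>|lborel. norm (F x \<zeta>)) \<le> 4 * pi + pi * \<delta>\<^sup>2" for x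
      using integral_inverse_norm_ball[OF assms, of z x] by (simp add: F_def)
    then show "integrable \<mu> (\<lambda>x. LINT \<zeta>|lborel. norm (case_prod F (x, \<zeta>)))"
      using m by (intro integrable_const_bound[of _ "4 * pi + pi * \<delta>\<^sup>2"]) auto
    show "AE x in \<mu>. integrable lborel (\<lambda>\<zeta>. case_prod F (x, \<zeta>))"
      using set_integrable_inverse_ball by (simp add: F_def set_integrable_def)
  qed
  have inner: "(LINT x|\<mu>. F x \<zeta>) = indicator (ball z \<delta>) \<zeta> *\<^sub>R cauchy \<zeta>" for \<zeta>
    by (simp add: F_def cauchy_def)
  show "set_integrable lborel (ball z \<delta>) cauchy"
    using P.integrable_snd[OF FI] by (simp add: set_integrable_def inner)
  have "(LINT \<zeta>:ball z \<delta>|lborel. cauchy \<zeta>) = (LINT \<zeta>|lborel. LINT x|\<mu>. F x \<zeta>)"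
    by (simp add: inner set_lebesgue_integral_def)
  also have "\<dots> = (LINT x|\<mu>. LINT \<zeta>|lborel. F x \<zeta>)" by (rule P.Fubini_integral[OF FI])
  also have "\<dots> = (LINT x|\<mu>. of_real (pi * \<delta>\<^sup>2) * disc_gradient \<delta> (x - z))"
  proof (rule Bochner_Integration.integral_cong[OF refl])
    fix x
    have "(LINT \<zeta>|lborel. F x \<zeta>) = (LINT \<zeta>:ball z \<delta>|lborel. 1 / (x - \<zeta>))"
      by (simp add: F_def set_lebesgue_integral_def)
    also have "\<dots> = (LINT \<zeta>:ball 0 \<delta>|lborel. 1 / ((x - z) - \<zeta>))"
      by (subst disc_integral_translate) (simp add: diff_diff_eq)
    finally show "(LINT \<zeta>|lborel. F x \<zeta>) = of_real (pi * \<delta>\<^sup>2) * disc_gradient \<delta> (x - z)"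
      by (simp only: disc_integral_inverse_eq_gradient[OF assms])
  qed
  finally show "(LINT \<zeta>:ball z \<delta>|lborel. cauchy \<zeta>) = of_real (pi * \<delta>\<^sup>2) * disc_cauchy \<delta> z"
    by (simp add: disc_cauchy_def)
  show "AE \<zeta> in lborel. \<zeta> \<in> ball z \<delta> \<longrightarrow> integrable \<mu> (\<lambda>x. 1 / (x - \<zeta>))"
    using P.AE_integrable_snd[OF FI] by (auto simp: F_def elim!: eventually_mono)
qed

lemma AE_integrable_inverse: "AE \<zeta> in lborel. integrable \<mu> (\<lambda>x. 1 / (x - \<zeta>))"
proof -
  have "AE \<zeta> in lborel. \<forall>n::nat. \<zeta> \<in> ball 0 (real (Suc n)) \<longrightarrow> integrable \<mu> (\<lambda>x. 1 / (x - \<zeta>))"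
    by (subst AE_all_countable) (intro allI disc_integral_cauchy(3), simp)
  then show ?thesis
  proof eventually_elim
    case (elim \<zeta>)
    obtain n :: nat where "cmod \<zeta> < real n" using reals_Archimedean2 by blast
    then have "\<zeta> \<in> ball 0 (real (Suc n))" by simp
    then show ?case using elim by blast
  qed
qed

lemma disc_integral_potential:
  assumes "\<delta> > 0"
  shows "set_integrable lborel (ball z \<delta>) potential"
    and "integrable \<mu> (\<lambda>x. LINT \<zeta>:ball 0 \<delta>|lborel. ln (cmod ((x - z) - \<zeta>)))"
    and "(LINT \<zeta>:ball z \<delta>|lborel. potential \<zeta>) = - (LINT x|\<mu>. (LINT \<zeta>:ball 0 \<delta>|lborel. ln (cmod ((x - z) - \<zeta>))))"
proof -
  interpret P: pair_sigma_finite \<mu> "lborel :: complex measure" by (rule pair_lborel)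
  define F :: "complex \<Rightarrow> complex \<Rightarrow> real" where "F = (\<lambda>x \<zeta>. indicator (ball z \<delta>) \<zeta> *\<^sub>R - ln (cmod (x - \<zeta>)))"
  have Fm: "case_prod F \<in> borel_measurable (\<mu> \<Otimes>\<^sub>M lborel)"
    unfolding F_def by measurable
  obtain M where M: "M > 0" "\<And>x. x \<in> msupp \<mu> \<Longrightarrow> cmod x \<le> M" using msupp_bounded by blast
  have Fi: "integrable lborel (F x)" for x
  proof -
    have "integrable lborel (\<lambda>\<zeta>. - (indicator (ball z \<delta>) \<zeta> *\<^sub>R ln (cmod (x - \<zeta>))))"
      using set_integrable_ln_ball[of z \<delta> x] by (intro integrable_minus) (simp add: set_integrable_def)
    then show ?thesis by (simp add: F_def)
  qed
  have FI: "integrable (\<mu> \<Otimes>\<^sub>M lborel) (case_prod F)"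
  proof (rule P.Fubini_integrable[OF Fm])
    have m: "(\<lambda>x. LINT \<zeta>|lborel. norm (F x \<zeta>)) \<in> borel_measurable \<mu>"
      using Fm by (intro lborel.borel_measurable_lebesgue_integral) (auto simp: case_prod_beta')
    define L where "L = (M + cmod z + \<delta>) * (pi * \<delta>\<^sup>2) + (4 * pi + pi * \<delta>\<^sup>2)"
    have "norm (LINT \<zeta>|lborel. norm (F x \<zeta>)) \<le> L" if x: "x \<in> msupp \<mu>" for x
    proof -
      let ?g = "\<lambda>\<zeta>. indicator (ball z \<delta>) \<zeta> * (M + cmod z + \<delta>) :: real"
      let ?h = "\<lambda>\<zeta>. norm (indicator (ball z \<delta>) \<zeta> *\<^sub>R (1 / (x - \<zeta>)))"
      have gi: "integrable lborel ?g" by (intro integrable_mult_left integrable_indicator_ball)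
      have hi: "integrable lborel ?h"
        by (rule integrable_norm) (use set_integrable_inverse_ball[of z \<delta> x] in \<open>simp add: set_integrable_def\<close>)
      have "(LINT \<zeta>|lborel. norm (F x \<zeta>)) \<le> (LINT \<zeta>|lborel. ?g \<zeta> + ?h \<zeta>)"
      proof (rule integral_mono)
        fix \<zeta>
        show "norm (F x \<zeta>) \<le> ?g \<zeta> + ?h \<zeta>"
        proof (cases "\<zeta> \<in> ball z \<delta>")
          case True
          then have "cmod (x - \<zeta>) \<le> M + cmod z + \<delta>"
            using norm_triangle_ineq4[of x z] norm_triangle_ineq[of "x - z" "z - \<zeta>"] M(2)[OF x]
            by (simp add: dist_norm)
          then show ?thesis
            using abs_ln_le[of "cmod (x - \<zeta>)"] True by (simp add: F_def norm_divide)
        qed (simp add: F_def)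
      qed (use Fi gi hi in auto)
      also have "\<dots> = (LINT \<zeta>|lborel. ?g \<zeta>) + (LINT \<zeta>|lborel. ?h \<zeta>)"
        using gi hi by (rule Bochner_Integration.integral_add)
      also have "(LINT \<zeta>|lborel. ?g \<zeta>) = (M + cmod z + \<delta>) * (pi * \<delta>\<^sup>2)"
        using content_complex_ball[of \<delta> z] assms by simp
      finally show ?thesis
        using integral_inverse_norm_ball[OF assms, of z x] by (simp add: L_def)
    qed
    then show "integrable \<mu> (\<lambda>x. LINT \<zeta>|lborel. norm (case_prod F (x, \<zeta>)))"
      using m AE_msupp by (intro integrable_const_bound[of _ L]) (auto elim!: eventually_mono)
    show "AE x in \<mu>. integrable lborel (\<lambda>\<zeta>. case_prod F (x, \<zeta>))"
      using Fi by simp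
  qed
  have inner: "(LINT x|\<mu>. F x \<zeta>) = indicator (ball z \<delta>) \<zeta> *\<^sub>R potential \<zeta>" for \<zeta>
    unfolding F_def potential_def by (rule integral_scaleR_right)
  have inner2: "(LINT \<zeta>|lborel. F x \<zeta>) = - (LINT \<zeta>:ball 0 \<delta>|lborel. ln (cmod ((x - z) - \<zeta>)))" for x
  proof -
    have "(LINT \<zeta>|lborel. F x \<zeta>) = - (LINT \<zeta>:ball z \<delta>|lborel. ln (cmod (x - \<zeta>)))"
      by (simp add: F_def set_lebesgue_integral_def)
    then show ?thesis
      by (subst (asm) disc_integral_translate) (simp add: diff_diff_eq)
  qed
  show "set_integrable lborel (ball z \<delta>) potential"
    using P.integrable_snd[OF FI] by (simp add: set_integrable_def inner)
  show "integrable \<mu> (\<lambda>x. LINT \<zeta>:ball 0 \<delta>|lborel. ln (cmod ((x - z) - \<zeta>)))"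
    using P.integrable_fst[OF FI] by (simp add: inner2)
  have "(LINT \<zeta>:ball z \<delta>|lborel. potential \<zeta>) = (LINT \<zeta>|lborel. LINT x|\<mu>. F x \<zeta>)"
    by (simp add: inner set_lebesgue_integral_def)
  also have "\<dots> = (LINT x|\<mu>. LINT \<zeta>|lborel. F x \<zeta>)" by (rule P.Fubini_integral[OF FI])
  finally show "(LINT \<zeta>:ball z \<delta>|lborel. potential \<zeta>) = - (LINT x|\<mu>. (LINT \<zeta>:ball 0 \<delta>|lborel. ln (cmod ((x - z) - \<zeta>))))"
    by (simp add: inner2)
qed

text \<open>
  Superharmonicity, integrated from the kernel. In the case of equality the nonnegative integrand
  vanishes almost everywhere, but it is positive at every point of the disc.
\<close>
lemma potential_super_mean:
  assumes fin: "finite_potential z" and d: "\<delta> > 0"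
  shows "(LINT \<zeta>:ball z \<delta>|lborel. potential \<zeta>) \<le> pi * \<delta>\<^sup>2 * potential z"
    and "(LINT \<zeta>:ball z \<delta>|lborel. potential \<zeta>) = pi * \<delta>\<^sup>2 * potential z \<Longrightarrow> emeasure \<mu> (ball z \<delta>) = 0"
proof -
  let ?m = "\<lambda>x. LINT \<zeta>:ball 0 \<delta>|lborel. ln (cmod ((x - z) - \<zeta>))"
  let ?h = "\<lambda>x. ?m x - - (pi * \<delta>\<^sup>2 * - ln (cmod (x - z)))"
  have i1: "integrable \<mu> ?m" by (rule disc_integral_potential(2)[OF d])
  have i2: "integrable \<mu> (\<lambda>x. - (pi * \<delta>\<^sup>2 * - ln (cmod (x - z))))"
    using fin unfolding finite_potential_def by (intro integrable_minus integrable_mult_right) auto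
  have hi: "integrable \<mu> ?h" using i1 i2 by (rule Bochner_Integration.integrable_diff)
  have "(LINT x|\<mu>. ?h x) = (LINT x|\<mu>. ?m x) - (LINT x|\<mu>. - (pi * \<delta>\<^sup>2 * - ln (cmod (x - z))))"
    using i1 i2 by (rule Bochner_Integration.integral_diff)
  also have "(LINT x|\<mu>. - (pi * \<delta>\<^sup>2 * - ln (cmod (x - z)))) = - (pi * \<delta>\<^sup>2 * potential z)"
    unfolding potential_def by (subst integral_minus, subst integral_mult_right_zero) simp
  finally have h: "(LINT x|\<mu>. ?h x) = pi * \<delta>\<^sup>2 * potential z - (LINT \<zeta>:ball z \<delta>|lborel. potential \<zeta>)"
    by (simp add: disc_integral_potential(3)[OF d])
  have "AE x in \<mu>. x \<notin> {z}"
    using fin unfolding finite_potential_def by (intro AE_not_in) (auto simp: null_sets_def sets_eq)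
  then have AE: "AE x in \<mu>. 0 \<le> ?h x \<and> (x \<in> ball z \<delta> \<longrightarrow> 0 < ?h x)"
  proof eventually_elim
    case (elim x)
    then show ?case
      using disc_integral_ln[OF d, of "x - z"] by (auto simp: dist_norm norm_minus_commute)
  qed
  have "0 \<le> (LINT x|\<mu>. ?h x)" using AE by (intro integral_nonneg_AE) auto
  then show "(LINT \<zeta>:ball z \<delta>|lborel. potential \<zeta>) \<le> pi * \<delta>\<^sup>2 * potential z" using h by linarith
  assume "(LINT \<zeta>:ball z \<delta>|lborel. potential \<zeta>) = pi * \<delta>\<^sup>2 * potential z"
  then have "(LINT x|\<mu>. ?h x) = 0" using h by linarith
  then have "AE x in \<mu>. ?h x = 0"
    using AE by (subst (asm) integral_nonneg_eq_0_iff_AE[OF hi]) auto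
  with AE have "AE x in \<mu>. x \<notin> ball z \<delta>" by eventually_elim auto
  then have "ball z \<delta> \<in> null_sets \<mu>" by (subst AE_iff_null_sets) (auto simp: sets_eq)
  then show "emeasure \<mu> (ball z \<delta>) = 0" by auto
qed


lemma disc_potential_lower_bound:
  assumes "\<delta>\<^sub>0 > 0"
  obtains L where "\<And>\<delta> x. 0 < \<delta> \<Longrightarrow> \<delta> \<le> \<delta>\<^sub>0 \<Longrightarrow> x \<in> msupp \<mu> \<Longrightarrow> - L \<le> disc_kernel \<delta> (x - z)"
proof -
  obtain M where M: "M > 0" "\<And>x. x \<in> msupp \<mu> \<Longrightarrow> cmod x \<le> M" using msupp_bounded by blast
  have "- ln (M + cmod z + \<delta>\<^sub>0) \<le> disc_kernel \<delta> (x - z)"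
    if "0 < \<delta>" "\<delta> \<le> \<delta>\<^sub>0" "x \<in> msupp \<mu>" for \<delta> x
  proof (rule disc_kernel_bounds(1))
    show "cmod (x - z) \<le> M + cmod z + \<delta>\<^sub>0"
      using M(2)[OF that(3)] norm_triangle_ineq4[of x z] assms by linarith
    show "\<delta> \<le> M + cmod z + \<delta>\<^sub>0" using that M(1) norm_ge_zero[of z] by linarith
  qed fact
  then show thesis using that by blast
qed

text \<open>
  Bounded smoothed potentials force the potential to be finite. A point mass at \<open>z\<close> is excluded first:
  it would contribute a multiple of \<open>disc_kernel \<delta> 0\<close>, which is unbounded as \<open>\<delta>\<close> tends to
  \<open>0\<close>. Then the monotone convergence theorem applies, as the kernels converge for \<open>x \<noteq> z\<close>.
\<close>
lemma disc_potential_tendsto: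
  assumes d0: "\<delta>\<^sub>0 > 0" and B: "\<And>n::nat. disc_potential (\<delta>\<^sub>0 / Suc n) z \<le> B"
  shows "finite_potential z" and "(\<lambda>n. disc_potential (\<delta>\<^sub>0 / Suc n) z) \<longlonglongrightarrow> potential z"
proof -
  let ?d = "\<lambda>n::nat. \<delta>\<^sub>0 / Suc n"
  have d: "0 < ?d n" "?d n \<le> \<delta>\<^sub>0" for n using d0 by (auto simp: divide_le_eq mult_le_cancel_left1)
  obtain L where L: "\<And>\<delta> x. 0 < \<delta> \<Longrightarrow> \<delta> \<le> \<delta>\<^sub>0 \<Longrightarrow> x \<in> msupp \<mu> \<Longrightarrow> - L \<le> disc_kernel \<delta> (x - z)"
    using disc_potential_lower_bound[OF d0] by blast
  define p where "p = measure \<mu> {z}"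
  have p_le: "p * (1/2 - ln (?d n) + L) \<le> B + L * measure \<mu> UNIV" for n
  proof -
    let ?f = "\<lambda>x. indicator {z} x * (1/2 - ln (?d n) + L) + - L :: real"
    have i1: "integrable \<mu> (\<lambda>x. indicator {z} x * (1/2 - ln (?d n) + L) :: real)"
      by (intro integrable_mult_left integrable_real_indicator) (auto simp: sets_eq less_top[symmetric] emeasure_finite)
    have i2: "integrable \<mu> (\<lambda>x. - L)" by simp
    have "(LINT x|\<mu>. ?f x) \<le> disc_potential (?d n) z"
      unfolding disc_potential_def
    proof (rule integral_mono_AE)
      show "integrable \<mu> ?f" using i1 i2 by (rule Bochner_Integration.integrable_add)
      show "integrable \<mu> (\<lambda>x. disc_kernel (?d n) (x - z))" by (rule integrable_disc_kernel[OF d(1)])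
      have "disc_kernel (?d n) 0 = 1/2 - ln (?d n)"
        using d(1)[of n] d0 by (simp add: disc_kernel_def ln_realpow del: of_nat_Suc)
      then show "AE x in \<mu>. ?f x \<le> disc_kernel (?d n) (x - z)"
        using AE_msupp L[OF d] by (auto elim!: eventually_mono simp: indicator_def)
    qed
    moreover have "(LINT x|\<mu>. ?f x) = p * (1/2 - ln (?d n) + L) - L * measure \<mu> UNIV"
      using i1 i2 by (subst Bochner_Integration.integral_add) (auto simp: p_def)
    ultimately show ?thesis using B[of n] by linarith
  qed
  (* the left-hand side of the previous bound tends to infinity with n unless p = 0 *)
  have "p = 0"
  proof (rule ccontr)
    assume "p \<noteq> 0"
    then have p: "p > 0" by (simp add: p_def zero_less_measure_iff)
    define K where "K = (B + L * measure \<mu> UNIV) / p - 1/2 + ln \<delta>\<^sub>0 - L"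
    obtain n :: nat where n: "exp K < real n" using reals_Archimedean2 by blast
    have "1/2 - ln (?d n) + L \<le> (B + L * measure \<mu> UNIV) / p"
      using p_le[of n] p by (simp add: pos_le_divide_eq mult.commute del: of_nat_Suc)
    then have "ln (real (Suc n)) \<le> K"
      using d0 by (simp add: K_def ln_div del: of_nat_Suc)
    then have "exp (ln (real (Suc n))) \<le> exp K" by (subst exp_le_cancel_iff)
    then have "real (Suc n) \<le> exp K" by (simp only: exp_ln of_nat_0_less_iff zero_less_Suc)
    with n show False by simp
  qed
  then have nz: "emeasure \<mu> {z} = 0" by (simp add: p_def emeasure_eq_measure)
  then have AEz: "AE x in \<mu>. x \<noteq> z"
    using AE_not_in[of "{z}" \<mu>] by (simp add: null_sets_def sets_eq)
  have mono: "disc_kernel (?d m) y \<le> disc_kernel (?d n) y" if "m \<le> n" for m n y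
    using d0 that by (intro disc_kernel_antimono) (auto intro!: divide_left_mono)
  have "mono (\<lambda>n. disc_potential (?d n) z)"
    unfolding disc_potential_def
    by (intro monoI integral_mono integrable_disc_kernel d mono)
  then obtain l where l: "(\<lambda>n. disc_potential (?d n) z) \<longlonglongrightarrow> l"
    using incseq_convergent[of "\<lambda>n. disc_potential (?d n) z" B] B by blast
  have mc: "integrable \<mu> (\<lambda>x. - ln (cmod (x - z)))" "(LINT x|\<mu>. - ln (cmod (x - z))) = l"
  proof -
    have i: "\<And>n. integrable \<mu> (\<lambda>x. disc_kernel (?d n) (x - z))" by (intro integrable_disc_kernel d)
    have m: "AE x in \<mu>. mono (\<lambda>n. disc_kernel (?d n) (x - z))"
      by (intro AE_I2 monoI mono)
    have lim: "AE x in \<mu>. (\<lambda>n. disc_kernel (?d n) (x - z)) \<longlonglongrightarrow> - ln (cmod (x - z))"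
      using AEz
    proof eventually_elim
      case (elim x)
      have "(\<lambda>n. \<delta>\<^sub>0 / real (Suc n)) \<longlonglongrightarrow> 0"
        by (rule LIMSEQ_Suc) (rule lim_const_over_n)
      then have "\<forall>\<^sub>F n in sequentially. ?d n < cmod (x - z)"
        using elim by (intro order_tendstoD(2)) auto
      then have "\<forall>\<^sub>F n in sequentially. disc_kernel (?d n) (x - z) = - ln (cmod (x - z))"
        by (rule eventually_mono) (use d in \<open>auto intro!: disc_kernel_eq_ln\<close>)
      then show ?case by (rule tendsto_eventually)
    qed
    have l': "(\<lambda>n. LINT x|\<mu>. disc_kernel (?d n) (x - z)) \<longlonglongrightarrow> l" using l by (simp add: disc_potential_def)
    have u: "(\<lambda>x. - ln (cmod (x - z))) \<in> borel_measurable \<mu>" by measurable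
    show "integrable \<mu> (\<lambda>x. - ln (cmod (x - z)))" "(LINT x|\<mu>. - ln (cmod (x - z))) = l"
      using integrable_monotone_convergence[OF i m lim l' u] integral_monotone_convergence[OF i m lim l' u] by auto
  qed
  show "finite_potential z" using nz mc(1) by (simp add: finite_potential_def)
  show "(\<lambda>n. disc_potential (?d n) z) \<longlonglongrightarrow> potential z" using l mc(2) by (simp add: potential_def)
qed

lemma log_potential_eq:
  assumes "finite_potential z"
  shows "log_potential \<mu> z = ereal (potential z)"
proof -
  have AEz: "AE x in \<mu>. x \<noteq> z"
    using AE_not_in[of "{z}" \<mu>] assms by (simp add: finite_potential_def null_sets_def sets_eq)
  have int: "integrable \<mu> (\<lambda>x. - ln (cmod (x - z)))" using assms by (simp add: finite_potential_def)
  have k: "log_kernel x z = ereal (- ln (cmod (x - z)))" if "x \<noteq> z" for x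
    using that by (simp add: log_kernel_def ln_div)
  have p: "(\<integral>\<^sup>+x. e2ennreal (log_kernel x z) \<partial>\<mu>) = (\<integral>\<^sup>+x. ennreal (- ln (cmod (x - z))) \<partial>\<mu>)"
    using AEz by (intro nn_integral_cong_AE) (auto elim!: eventually_mono simp: k)
  have m: "(\<integral>\<^sup>+x. e2ennreal (- log_kernel x z) \<partial>\<mu>) = (\<integral>\<^sup>+x. ennreal (- (- ln (cmod (x - z)))) \<partial>\<mu>)"
    using AEz by (intro nn_integral_cong_AE) (auto elim!: eventually_mono simp: k)
  have fin: "(\<integral>\<^sup>+x. ennreal (- ln (cmod (x - z))) \<partial>\<mu>) < \<infinity>" "(\<integral>\<^sup>+x. ennreal (- (- ln (cmod (x - z)))) \<partial>\<mu>) < \<infinity>"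
    using int integrable_minus[OF int] unfolding real_integrable_def by (auto simp: less_top)
  obtain a where a: "a \<ge> 0" "(\<integral>\<^sup>+x. ennreal (- ln (cmod (x - z))) \<partial>\<mu>) = ennreal a"
    using fin(1) by (cases "\<integral>\<^sup>+x. ennreal (- ln (cmod (x - z))) \<partial>\<mu>") auto
  obtain b where b: "b \<ge> 0" "(\<integral>\<^sup>+x. ennreal (- (- ln (cmod (x - z)))) \<partial>\<mu>) = ennreal b"
    using fin(2) by (cases "\<integral>\<^sup>+x. ennreal (- (- ln (cmod (x - z)))) \<partial>\<mu>") auto
  have "potential z = a - b"
    unfolding potential_def using a b by (subst real_lebesgue_integral_def[OF int]) simp
  then show ?thesis
    unfolding log_potential_def ereal_integral_def p m using a b by simp
qed

lemma
  assumes d: "\<delta> > 0" and far: "\<And>x. x \<in> msupp \<mu> \<Longrightarrow> \<delta> \<le> cmod (x - w)"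
  shows finite_potential_off_msupp: "finite_potential w"
    and potential_off_msupp: "potential w = disc_potential \<delta> w"
    and cauchy_off_msupp: "cauchy w = disc_cauchy \<delta> w"
    and integrable_inverse_off_msupp: "integrable \<mu> (\<lambda>x. 1 / (x - w))"
proof -
  have AE: "AE x in \<mu>. - ln (cmod (x - w)) = disc_kernel \<delta> (x - w)" "AE x in \<mu>. 1 / (x - w) = disc_gradient \<delta> (x - w)"
    using AE_msupp far by (auto elim!: eventually_mono simp: disc_kernel_eq_ln[OF d] disc_gradient_eq_inverse[OF d])
  show i: "integrable \<mu> (\<lambda>x. 1 / (x - w))"
    by (subst integrable_cong_AE[OF _ _ AE(2)]) (auto intro: integrable_disc_gradient[OF d])
  have j: "integrable \<mu> (\<lambda>x. - ln (cmod (x - w)))"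
    by (subst integrable_cong_AE[OF _ _ AE(1)]) (auto intro: integrable_disc_kernel[OF d])
  have "AE x in \<mu>. x \<notin> {w}"
    using AE_msupp by eventually_elim (use far d in force)
  then have "{w} \<in> null_sets \<mu>" by (subst AE_iff_null_sets) (auto simp: sets_eq)
  then show "finite_potential w" using j by (simp add: finite_potential_def null_sets_def)
  show "potential w = disc_potential \<delta> w"
    unfolding potential_def disc_potential_def by (rule integral_cong_AE[OF _ _ AE(1)]) measurable
  show "cauchy w = disc_cauchy \<delta> w"
    unfolding cauchy_def disc_cauchy_def by (rule integral_cong_AE[OF _ _ AE(2)]) measurable
qed

lemma far_from_msupp:
  assumes "p \<notin> msupp \<mu>"
  obtains r where "r > 0" "\<And>x w. x \<in> msupp \<mu> \<Longrightarrow> w \<in> ball p r \<Longrightarrow> r \<le> cmod (x - w)"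
proof -
  have "open (- msupp \<mu>)" using compact_imp_closed[OF compact_msupp] by (simp add: open_Compl)
  then obtain r where r: "r > 0" "ball p r \<subseteq> - msupp \<mu>" using assms by (auto elim: openE)
  have "r / 2 \<le> cmod (x - w)" if "x \<in> msupp \<mu>" "w \<in> ball p (r / 2)" for x w
  proof -
    have "r \<le> dist p x" using that r by force
    then show ?thesis using that dist_triangle[of p x w] by (simp add: dist_norm norm_minus_commute)
  qed
  then show thesis using r that[of "r / 2"] by auto
qed

text \<open>
  The difference quotient of \<open>1 / (x - w)\<close> is \<open>1 / ((x - w) (x - z))\<close>, whose distance from
  \<open>1 / (x - z)\<^sup>2\<close> is uniformly of order \<open>cmod (w - z)\<close> as long as \<open>x\<close> stays away from both points.
\<close>
lemma cauchy_has_field_derivative: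
  assumes z: "z \<notin> msupp \<mu>"
  shows "\<exists>c. (cauchy has_field_derivative c) (at z)"
proof -
  obtain d where d: "d > 0" and far: "\<And>x w. x \<in> msupp \<mu> \<Longrightarrow> w \<in> ball z d \<Longrightarrow> d \<le> cmod (x - w)"
    using far_from_msupp[OF z] by blast
  have zb: "z \<in> ball z d" using d by simp
  define D where "D = (\<lambda>w. LINT x|\<mu>. 1 / ((x - w) * (x - z)))"
  have int: "integrable \<mu> (\<lambda>x. 1 / ((x - w) * (x - z)))" if "w \<in> ball z d" for w
  proof (rule integrable_const_bound[of _ "1 / (d * d)"])
    show "AE x in \<mu>. norm (1 / ((x - w) * (x - z))) \<le> 1 / (d * d)"
      using AE_msupp
    proof eventually_elim
      case (elim x)
      then show ?case using far[OF elim that] far[OF elim zb] d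
        by (auto simp: norm_divide norm_mult intro!: divide_left_mono mult_mono mult_pos_pos)
    qed
  qed measurable
  have quot: "(cauchy w - cauchy z) / (w - z) = D w" if w: "w \<in> ball z d" "w \<noteq> z" for w
  proof -
    have iw: "integrable \<mu> (\<lambda>x. 1 / (x - w))" "integrable \<mu> (\<lambda>x. 1 / (x - z))"
      using integrable_inverse_off_msupp[OF d] far w zb by blast+
    have "cauchy w - cauchy z = (LINT x|\<mu>. 1 / (x - w) - 1 / (x - z))"
      unfolding cauchy_def by (rule Bochner_Integration.integral_diff[OF iw, symmetric])
    also have "\<dots> = (LINT x|\<mu>. (w - z) * (1 / ((x - w) * (x - z))))"
    proof (rule integral_cong_AE)
      show "AE x in \<mu>. 1 / (x - w) - 1 / (x - z) = (w - z) * (1 / ((x - w) * (x - z)))"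
        using AE_msupp
      proof eventually_elim
        case (elim x)
        then have "x \<noteq> w" "x \<noteq> z" using far[OF elim w(1)] far[OF elim zb] d by auto
        then show ?case by (simp add: field_simps)
      qed
    qed measurable
    also have "\<dots> = (w - z) * D w" unfolding D_def by (rule integral_mult_right_zero)
    finally show ?thesis using w by simp
  qed
  have "(D \<longlongrightarrow> D z) (at z)"
  proof (rule Lim_null_comparison[where g = "\<lambda>w. cmod (w - z) * (measure \<mu> UNIV / (d * d * d))", THEN LIM_zero_cancel])
    show "\<forall>\<^sub>F w in at z. norm (D w - D z) \<le> cmod (w - z) * (measure \<mu> UNIV / (d * d * d))"
    proof (rule eventually_mono)
      show "\<forall>\<^sub>F w in at z. w \<in> ball z d" by (rule eventually_at_in_open') (use d in auto)
      fix w assume w: "w \<in> ball z d"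
      have eq: "D w - D z = (LINT x|\<mu>. 1 / ((x - w) * (x - z)) - 1 / ((x - z) * (x - z)))"
        unfolding D_def by (rule Bochner_Integration.integral_diff[OF int[OF w] int[OF zb], symmetric])
      have "norm (D w - D z) \<le> (LINT x|\<mu>. norm (1 / ((x - w) * (x - z)) - 1 / ((x - z) * (x - z))))"
        unfolding eq by (rule integral_norm_bound)
      also have "\<dots> \<le> (LINT x|\<mu>. cmod (w - z) / (d * d * d))"
      proof (rule integral_mono_AE)
        show "integrable \<mu> (\<lambda>x. norm (1 / ((x - w) * (x - z)) - 1 / ((x - z) * (x - z))))"
          by (intro integrable_norm Bochner_Integration.integrable_diff int w zb)
        show "AE x in \<mu>. norm (1 / ((x - w) * (x - z)) - 1 / ((x - z) * (x - z))) \<le> cmod (w - z) / (d * d * d)"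
          using AE_msupp
        proof eventually_elim
          case (elim x)
          have f: "d \<le> cmod (x - w)" "d \<le> cmod (x - z)" using far elim w zb by auto
          then have "x - w \<noteq> 0" "x - z \<noteq> 0" using d by auto
          then have "1 / ((x - w) * (x - z)) - 1 / ((x - z) * (x - z)) = (w - z) / ((x - w) * (x - z) * (x - z))"
            by (simp add: divide_simps)
          also have "norm \<dots> = cmod (w - z) / (cmod (x - w) * cmod (x - z) * cmod (x - z))"
            by (simp add: norm_divide norm_mult)
          also have "\<dots> \<le> cmod (w - z) / (d * d * d)"
            using f d by (intro divide_left_mono mult_mono mult_pos_pos) (auto intro: less_le_trans)
          finally show ?case .
        qed
      qed simp
      finally show "norm (D w - D z) \<le> cmod (w - z) * (measure \<mu> UNIV / (d * d * d))"
        by (simp add: mult.commute)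
    qed
    show "((\<lambda>w. cmod (w - z) * (measure \<mu> UNIV / (d * d * d))) \<longlongrightarrow> 0) (at z)"
      using d by (auto intro!: tendsto_eq_intros)
  qed
  then have "((\<lambda>w. (cauchy w - cauchy z) / (w - z)) \<longlongrightarrow> D z) (at z)"
  proof (rule Lim_transform_eventually)
    have "\<forall>\<^sub>F w in at z. w \<in> ball z d - {z}" by (rule eventually_at_in_open) (use d in auto)
    then show "\<forall>\<^sub>F w in at z. D w = (cauchy w - cauchy z) / (w - z)"
      by eventually_elim (use quot in auto)
  qed
  then show ?thesis by (auto simp: has_field_derivative_iff)
qed

text \<open>
  At distance at least \<open>\<delta>\<close> from the support, smoothing changes nothing, so the increments of the
  potential are line integrals of the holomorphic Cauchy transform.
\<close>
lemma potential_eq_Re_holomorphic: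
  assumes S: "convex S" "open S" and d: "\<delta> > 0"
    and far: "\<And>x w. x \<in> msupp \<mu> \<Longrightarrow> w \<in> S \<Longrightarrow> \<delta> \<le> cmod (x - w)"
  shows "\<exists>\<sigma>. \<forall>w\<in>S. (\<sigma> has_field_derivative cauchy w) (at w) \<and> potential w = Re (\<sigma> w)"
proof (cases "S = {}")
  case False
  then obtain a where a: "a \<in> S" by auto
  have "w \<notin> msupp \<mu>" if "w \<in> S" for w using far[of w w] that d by auto
  then have hol: "cauchy holomorphic_on S"
    using cauchy_has_field_derivative S
    by (meson field_differentiable_at_within field_differentiable_def holomorphic_onI)
  obtain \<sigma> where "\<And>x. x \<in> S \<Longrightarrow> (\<sigma> has_field_derivative cauchy x) (at x within S)"
    using holomorphic_convex_primitive'[OF S hol] by blast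
  then have \<sigma>: "\<And>x. x \<in> S \<Longrightarrow> (\<sigma> has_field_derivative cauchy x) (at x)"
    using at_within_open[OF _ S(2)] by metis
  have incr: "potential b - potential a = Re (\<sigma> b) - Re (\<sigma> a)" if b: "b \<in> S" for b
  proof -
    let ?l = "\<lambda>t. a + of_real t * (b - a)"
    have c: "disc_cauchy \<delta> w = cauchy w" "disc_potential \<delta> w = potential w" if "w \<in> S" for w
      using cauchy_off_msupp[OF d] potential_off_msupp[OF d] far that by auto
    have si: "set_integrable lborel {0..1} (\<lambda>t. Re (disc_cauchy \<delta> (?l t) * (b - a)))"
      by (rule disc_potential_increment(1)[OF d])
    have "((\<lambda>t. Re (disc_cauchy \<delta> (?l t) * (b - a))) has_integral Re (\<sigma> b) - Re (\<sigma> a)) {0..1}"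
    proof (rule has_integral_eq[OF _ has_integral_Re_primitive[OF S(1) a b \<sigma>]])
      show "Re (cauchy (?l t) * (b - a)) = Re (disc_cauchy \<delta> (?l t) * (b - a))" if "t \<in> {0..1}" for t
        using c(1)[OF segment_in_convex[OF S(1) a b that]] by simp
    qed
    then have "(LINT t:{0..1}|lborel. Re (disc_cauchy \<delta> (?l t) * (b - a))) = Re (\<sigma> b) - Re (\<sigma> a)"
      using set_borel_integral_eq_integral(2)[OF si] by (simp add: integral_unique)
    then show ?thesis
      using disc_potential_increment(2)[OF d, of a "b - a"] c a b by simp
  qed
  have "((\<lambda>w. \<sigma> w + of_real (potential a - Re (\<sigma> a))) has_field_derivative cauchy w) (at w)" if "w \<in> S" for w
    using \<sigma>[OF that] by (auto intro!: derivative_eq_intros)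
  then show ?thesis
    using incr by (intro exI[of _ "\<lambda>w. \<sigma> w + of_real (potential a - Re (\<sigma> a))"]) force
qed auto

text \<open>Where the integral converges absolutely, dominated convergence removes the principal value.\<close>
lemma cauchy_transform_eq:
  assumes int: "integrable \<mu> (\<lambda>x. 1 / (x - z))"
  shows "cauchy_transform \<mu> z = cauchy z"
proof -
  let ?A = "\<lambda>\<epsilon>. {x. cmod (x - z) > \<epsilon>}"
  have "((\<lambda>\<epsilon>. LINT x:?A \<epsilon>|\<mu>. 1 / (x - z)) \<longlongrightarrow> cauchy z) (at_right 0)"
    unfolding tendsto_at_iff_sequentially
  proof (intro allI impI)
    fix X :: "nat \<Rightarrow> real" assume X: "\<forall>i. X i \<in> {0<..} - {0}" "X \<longlonglongrightarrow> 0"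
    show "((\<lambda>\<epsilon>. LINT x:?A \<epsilon>|\<mu>. 1 / (x - z)) \<circ> X) \<longlonglongrightarrow> cauchy z"
      unfolding o_def set_lebesgue_integral_def cauchy_def
    proof (rule integral_dominated_convergence[where w = "\<lambda>x. norm (1 / (x - z))"])
      show "AE x in \<mu>. (\<lambda>i. indicator (?A (X i)) x *\<^sub>R (1 / (x - z))) \<longlonglongrightarrow> 1 / (x - z)"
      proof (rule AE_I2)
        fix x
        show "(\<lambda>i. indicator (?A (X i)) x *\<^sub>R (1 / (x - z))) \<longlonglongrightarrow> 1 / (x - z)"
        proof (cases "x = z")
          case False
          then have "\<forall>\<^sub>F i in sequentially. X i < cmod (x - z)"
            using X(2) by (intro order_tendstoD(2)) auto
          then have "\<forall>\<^sub>F i in sequentially. indicator (?A (X i)) x *\<^sub>R (1 / (x - z)) = 1 / (x - z)"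
            by eventually_elim simp
          then show ?thesis by (rule tendsto_eventually)
        qed simp
      qed
    qed (use int in \<open>auto simp: indicator_def\<close>)
  qed
  then show ?thesis
    unfolding cauchy_transform_def by (intro tendsto_Lim) auto
qed

end


section \<open>Functions of one variable with slopes plus or minus one\<close>

text \<open>
  A concave function lies below its tangents. Here concavity is replaced by the absence of local
  minima of \<open>\<phi> x - m x\<close>, which makes these functions quasiconcave. If \<open>\<phi>\<close> exceeded the tangent at \<open>p\<close>
  somewhere, a line through the graph at \<open>p\<close> with a slope \<open>m\<close> strictly between that of the tangent
  and that of the chord would contradict quasiconcavity; within distance \<open>1/2\<close> of \<open>c\<close> the slope \<open>m\<close>
  also avoids the two excluded values.
\<close>
lemma below_tangents:
  fixes \<phi> :: "real \<Rightarrow> real"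
  assumes cont: "continuous_on {-\<eta><..<\<eta>} \<phi>"
    and nomin: "\<And>m x. m \<noteq> 1 \<Longrightarrow> m \<noteq> -1 \<Longrightarrow> x \<in> {-\<eta><..<\<eta>} \<Longrightarrow> \<not> (\<forall>\<^sub>F y in nhds x. \<phi> x - m * x \<le> \<phi> y - m * y)"
    and c: "c = 1 \<or> c = -1" and p: "p \<in> {-\<eta><..<\<eta>}" and der: "(\<phi> has_real_derivative c) (at p)"
    and x: "x \<in> {-\<eta><..<\<eta>}"
  shows "\<phi> x \<le> \<phi> p + c * (x - p)"
proof (rule ccontr)
  have quasi: "min (\<phi> a - m * a) (\<phi> b - m * b) \<le> \<phi> r - m * r"
    if m: "m \<noteq> 1" "m \<noteq> -1" and ab: "a \<in> {-\<eta><..<\<eta>}" "b \<in> {-\<eta><..<\<eta>}" "a < r" "r < b" for m a b r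
  proof (rule ccontr)
    let ?g = "\<lambda>x. \<phi> x - m * x"
    assume "\<not> ?thesis"
    then have less: "?g r < ?g a" "?g r < ?g b" by auto
    have "continuous_on {a..b} ?g"
      using ab by (intro continuous_intros continuous_on_subset[OF cont]) auto
    then obtain y where y: "y \<in> {a..b}" "\<And>w. w \<in> {a..b} \<Longrightarrow> ?g y \<le> ?g w"
      using continuous_attains_inf[of "{a..b}" ?g] ab by auto
    have "y \<noteq> a" "y \<noteq> b" using y(2)[of r] less ab by auto
    then have yab: "y \<in> {a<..<b}" using y(1) by auto
    then have "\<forall>\<^sub>F w in nhds y. w \<in> {a<..<b}" by (intro eventually_nhds_in_open) auto
    then have "\<forall>\<^sub>F w in nhds y. ?g y \<le> ?g w" by (rule eventually_mono) (use y(2) in auto)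
    with nomin[OF m, of y] yab ab show False by auto
  qed
  assume "\<not> ?thesis"
  then have gt: "\<phi> x > \<phi> p + c * (x - p)" by simp
  then have "x \<noteq> p" by auto
  then consider "p < x" | "x < p" by linarith
  then show False
  proof cases
    case 1
    define m0 where "m0 = (\<phi> x - \<phi> p) / (x - p)"
    have m0: "\<phi> x - \<phi> p = m0 * (x - p)" using 1 by (simp add: m0_def)
    then have "c * (x - p) < m0 * (x - p)" using gt by linarith
    then have "c < m0" using 1 by simp
    \<comment> \<open>truncating \<open>m0\<close> at \<open>c + 1\<close> keeps \<open>m\<close> below \<open>c + 1\<close>, so that for \<open>c = -1\<close> it stays away from \<open>1\<close>\<close>
    define m where "m = (c + min m0 (c + 1)) / 2"
    have m: "c < m" "m < m0" "m \<noteq> 1" "m \<noteq> -1" using \<open>c < m0\<close> c unfolding m_def by (auto simp: min_def field_simps)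
    have "((\<lambda>x. \<phi> x - m * x) has_real_derivative (c - m)) (at p)"
      using der by (auto intro!: derivative_eq_intros)
    from DERIV_neg_dec_right[OF this] m obtain d where d: "d > 0"
      "\<And>h. h > 0 \<Longrightarrow> h < d \<Longrightarrow> \<phi> (p + h) - m * (p + h) < \<phi> p - m * p" by auto
    define h where "h = min (d / 2) ((x - p) / 2)"
    have h: "0 < h" "h < d" "p + h < x" using d 1 by (auto simp: h_def min_def field_simps)
    have "m * (x - p) < m0 * (x - p)" using m 1 by simp
    then have "\<phi> p - m * p < \<phi> x - m * x" using m0 by (simp add: right_diff_distrib)
    then show False using quasi[OF m(3,4) p x, of "p + h"] h d(2)[of h] by simp
  next
    case 2
    define m0 where "m0 = (\<phi> p - \<phi> x) / (p - x)"
    have m0: "\<phi> p - \<phi> x = m0 * (p - x)" using 2 by (simp add: m0_def)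
    then have "m0 * (p - x) < c * (p - x)" using gt by (simp add: algebra_simps)
    then have "m0 < c" using 2 by simp
    define m where "m = (c + max m0 (c - 1)) / 2"
    have m: "m < c" "m0 < m" "m \<noteq> 1" "m \<noteq> -1" using \<open>m0 < c\<close> c unfolding m_def by (auto simp: max_def field_simps)
    have "((\<lambda>x. \<phi> x - m * x) has_real_derivative (c - m)) (at p)"
      using der by (auto intro!: derivative_eq_intros)
    from DERIV_pos_inc_left[OF this] m obtain d where d: "d > 0"
      "\<And>h. h > 0 \<Longrightarrow> h < d \<Longrightarrow> \<phi> (p - h) - m * (p - h) < \<phi> p - m * p" by auto
    define h where "h = min (d / 2) ((p - x) / 2)"
    have h: "0 < h" "h < d" "x < p - h" using d 2 by (auto simp: h_def min_def field_simps)
    have "m0 * (p - x) < m * (p - x)" using m 2 by simp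
    then have "\<phi> p - m * p < \<phi> x - m * x" using m0 by (simp add: right_diff_distrib)
    then show False using quasi[OF m(3,4) x p, of "p - h"] h d(2)[of h] by simp
  qed
qed

text \<open>
  Comparing the tangents at two points shows that slope \<open>-1\<close> never precedes slope \<open>1\<close>, and that \<open>\<phi>\<close> is
  affine wherever the slope does not change. If it does not change at \<open>0\<close>, the first alternative
  holds; otherwise it changes from \<open>1\<close> to \<open>-1\<close> there.
\<close>
lemma affine_or_peak:
  fixes \<phi> :: "real \<Rightarrow> real"
  assumes eta: "\<eta> > 0" and cont: "continuous_on {-\<eta><..<\<eta>} \<phi>"
    and nomin: "\<And>m x. m \<noteq> 1 \<Longrightarrow> m \<noteq> -1 \<Longrightarrow> x \<in> {-\<eta><..<\<eta>} \<Longrightarrow> \<not> (\<forall>\<^sub>F y in nhds x. \<phi> x - m * x \<le> \<phi> y - m * y)"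
    and dense: "\<And>a b. -\<eta> \<le> a \<Longrightarrow> a < b \<Longrightarrow> b \<le> \<eta> \<Longrightarrow>
      \<exists>p. a < p \<and> p < b \<and> ((\<phi> has_real_derivative 1) (at p) \<or> (\<phi> has_real_derivative -1) (at p))"
  shows "(\<exists>c r. (c = 1 \<or> c = -1) \<and> r > 0 \<and> (\<forall>x. \<bar>x\<bar> < r \<longrightarrow> \<phi> x = \<phi> 0 + c * x))
    \<or> (\<forall>x. \<bar>x\<bar> < \<eta> \<longrightarrow> \<phi> x = \<phi> 0 - \<bar>x\<bar>)"
proof -
  let ?I = "{-\<eta><..<\<eta>}"
  let ?D = "\<lambda>c p. (c = 1 \<or> c = -1) \<and> p \<in> ?I \<and> (\<phi> has_real_derivative c) (at p)"
  have tangent: "\<phi> x \<le> \<phi> p + c * (x - p)" if "?D c p" "x \<in> ?I" for c p x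
    using below_tangents[OF cont nomin, of c p x] that by blast
  have dense': "\<exists>c p. a < p \<and> p < b \<and> ?D c p" if ab: "-\<eta> \<le> a" "a < b" "b \<le> \<eta>" for a b
  proof -
    obtain p where "a < p" "p < b" "(\<phi> has_real_derivative 1) (at p) \<or> (\<phi> has_real_derivative -1) (at p)"
      using dense[OF ab] by blast
    moreover from this ab have "p \<in> ?I" by auto
    ultimately show ?thesis by blast
  qed
  have mono: "c = 1 \<or> c' = -1" if "?D c p" "?D c' p'" "p < p'" for c c' p p'
    using tangent[OF that(1), of p'] tangent[OF that(2), of p] that by auto
  \<comment> \<open>on an interval where all known slopes are equal, the function is affine\<close>
  have affine: "\<phi> y - \<phi> x = c * (y - x)"
    if ab: "-\<eta> \<le> a" "b \<le> \<eta>" and cc: "\<And>c' p. ?D c' p \<Longrightarrow> a < p \<Longrightarrow> p < b \<Longrightarrow> c' = c"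
      and xy: "x \<in> {a<..<b}" "y \<in> {a<..<b}" for a b c x y
  proof -
    define X where "X = {p. ?D c p \<and> a < p \<and> p < b}"
    have X: "\<phi> p - c * p = \<phi> p' - c * p'" if "p \<in> X" "p' \<in> X" for p p'
      using tangent[of c p p'] tangent[of c p' p] that by (auto simp: X_def algebra_simps)
    have near: "\<exists>f. (\<forall>n. f n \<in> X) \<and> f \<longlonglongrightarrow> x" if "x \<in> {a<..<b}" for x
    proof -
      have "x \<in> closure X"
        unfolding closure_approachable
      proof (intro allI impI)
        fix e :: real assume e: "e > 0"
        define b' where "b' = min b (x + e)"
        have "-\<eta> \<le> x" "x < b'" "b' \<le> \<eta>" using that ab e by (auto simp: b'_def)
        then obtain c' p where p: "x < p" "p < b'" "?D c' p" using dense'[of x b'] by blast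
        then have "a < p" "p < b" using that by (auto simp: b'_def)
        then have "p \<in> X" using p cc[of c' p] by (auto simp: X_def)
        moreover have "dist p x < e" using p by (auto simp: dist_real_def b'_def)
        ultimately show "\<exists>y\<in>X. dist y x < e" by blast
      qed
      then show ?thesis by (simp add: closure_sequential)
    qed
    have lim: "(\<lambda>n. \<phi> (f n) - c * f n) \<longlonglongrightarrow> \<phi> x - c * x" if "x \<in> {a<..<b}" "f \<longlonglongrightarrow> x" for f :: "nat \<Rightarrow> real" and x
    proof -
      have "x \<in> ?I" using that(1) ab by auto
      then have "isCont \<phi> x" using cont by (simp add: continuous_on_eq_continuous_at)
      then show ?thesis using that(2) by (intro tendsto_intros isCont_tendsto_compose[of _ \<phi>])
    qed
    obtain f where f: "\<And>n. f n \<in> X" "f \<longlonglongrightarrow> x" using near[OF xy(1)] by blast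
    obtain g where g: "\<And>n. g n \<in> X" "g \<longlonglongrightarrow> y" using near[OF xy(2)] by blast
    have "(\<lambda>n. \<phi> (f n) - c * f n) = (\<lambda>n. \<phi> (g n) - c * g n)" using X f(1) g(1) by blast
    then have "\<phi> x - c * x = \<phi> y - c * y"
      using lim[OF xy(1) f(2)] lim[OF xy(2) g(2)] LIMSEQ_unique by metis
    then show ?thesis by (simp add: algebra_simps)
  qed
  consider (left) p where "?D (-1) p" "p < 0" | (right) p where "?D 1 p" "p > 0"
    | (peak) "\<And>p c. ?D c p \<Longrightarrow> p < 0 \<Longrightarrow> c = 1" "\<And>p c. ?D c p \<Longrightarrow> p > 0 \<Longrightarrow> c = -1"
    by blast
  then show ?thesis
  proof cases
    case left
    have "\<phi> x = \<phi> 0 + (-1) * x" if "\<bar>x\<bar> < min (-p) \<eta>" for x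
    proof -
      have "\<phi> x - \<phi> 0 = (-1) * (x - 0)"
      proof (rule affine[of p \<eta> "-1" 0 x])
        show "c' = -1" if "?D c' p'" "p < p'" "p' < \<eta>" for c' p'
          using mono[OF left(1) that(1,2)] by auto
      qed (use left that in auto)
      then show ?thesis by simp
    qed
    moreover have "min (-p) \<eta> > 0" using left eta by simp
    ultimately show ?thesis by blast
  next
    case right
    have "\<phi> x = \<phi> 0 + 1 * x" if "\<bar>x\<bar> < min p \<eta>" for x
    proof -
      have "\<phi> x - \<phi> 0 = 1 * (x - 0)"
      proof (rule affine[of "-\<eta>" p 1 0 x])
        show "c' = 1" if "?D c' p'" "-\<eta> < p'" "p' < p" for c' p'
          using mono[OF that(1) right(1) that(3)] by auto
      qed (use right that in auto)
      then show ?thesis by simp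
    qed
    moreover have "min p \<eta> > 0" using right eta by simp
    ultimately show ?thesis by blast
  next
    case peak
    have cont0: "isCont \<phi> 0" using cont eta by (simp add: continuous_on_eq_continuous_at)
    have "\<phi> x = \<phi> 0 - \<bar>x\<bar>" if x: "\<bar>x\<bar> < \<eta>" for x
    proof -
      consider "x = 0" | "x < 0" | "x > 0" by linarith
      then show ?thesis
      proof cases
        case 2
        have ev: "\<forall>\<^sub>F y in at_left 0. \<phi> y = \<phi> x + (y - x)"
        proof (rule eventually_at_leftI[of x])
          fix y assume "y \<in> {x<..<0}"
          then have "\<phi> y - \<phi> x = 1 * (y - x)"
            by (intro affine[of "-\<eta>" 0 1 x y] peak(1)) (use x eta 2 in auto)
          then show "\<phi> y = \<phi> x + (y - x)" by simp
        qed (use 2 in auto)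
        have "((\<lambda>y. \<phi> x + (y - x)) \<longlongrightarrow> \<phi> x + (0 - x)) (at_left 0)"
          by (intro tendsto_intros)
        then have "(\<phi> \<longlongrightarrow> \<phi> x + (0 - x)) (at_left 0)"
          by (rule Lim_transform_eventually) (use ev in \<open>auto elim: eventually_mono\<close>)
        moreover have "(\<phi> \<longlongrightarrow> \<phi> 0) (at_left 0)"
          using cont0 unfolding isCont_def by (rule filterlim_mono) (auto simp: at_within_le_at)
        ultimately have "\<phi> 0 = \<phi> x + (0 - x)" by (intro tendsto_unique[of "at_left 0" \<phi>]) auto
        then show ?thesis using 2 by simp
      next
        case 3
        have ev: "\<forall>\<^sub>F y in at_right 0. \<phi> y = \<phi> x - (y - x)"
        proof (rule eventually_at_rightI[of _ x])
          fix y assume "y \<in> {0<..<x}"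
          then have "\<phi> y - \<phi> x = (-1) * (y - x)"
            by (intro affine[of 0 \<eta> "-1" x y] peak(2)) (use x eta 3 in auto)
          then show "\<phi> y = \<phi> x - (y - x)" by simp
        qed (use 3 in auto)
        have "((\<lambda>y. \<phi> x - (y - x)) \<longlongrightarrow> \<phi> x - (0 - x)) (at_right 0)"
          by (intro tendsto_intros)
        then have "(\<phi> \<longlongrightarrow> \<phi> x - (0 - x)) (at_right 0)"
          by (rule Lim_transform_eventually) (use ev in \<open>auto elim: eventually_mono\<close>)
        moreover have "(\<phi> \<longlongrightarrow> \<phi> 0) (at_right 0)"
          using cont0 unfolding isCont_def by (rule filterlim_mono) (auto simp: at_within_le_at)
        ultimately have "\<phi> 0 = \<phi> x - (0 - x)" by (intro tendsto_unique[of "at_right 0" \<phi>]) auto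
        then show ?thesis using 3 by simp
      qed simp
    qed
    then show ?thesis by blast
  qed
qed

context plane_measure
begin

lemma disc_potential_le:
  assumes fin: "finite_potential z" and d: "\<delta> > 0"
  shows "disc_potential \<delta> z \<le> potential z"
  unfolding disc_potential_def potential_def
proof (rule integral_mono_AE)
  show "integrable \<mu> (\<lambda>x. - ln (cmod (x - z)))" using fin by (simp add: finite_potential_def)
  have "AE x in \<mu>. x \<noteq> z"
    using AE_not_in[of "{z}" \<mu>] fin by (simp add: finite_potential_def null_sets_def sets_eq)
  then show "AE x in \<mu>. disc_kernel \<delta> (x - z) \<le> - ln (cmod (x - z))"
  proof eventually_elim
    case (elim x)
    have "disc_kernel \<delta> (x - z) \<le> disc_kernel (min \<delta> (cmod (x - z))) (x - z)"
      using elim d by (intro disc_kernel_antimono) auto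
    also have "\<dots> = - ln (cmod (x - z))" using elim d by (intro disc_kernel_eq_ln) auto
    finally show ?case .
  qed
qed (rule integrable_disc_kernel[OF d])

lemma disc_potential_tendsto_potential:
  assumes "finite_potential z" "\<delta>\<^sub>0 > 0"
  shows "(\<lambda>n::nat. disc_potential (\<delta>\<^sub>0 / Suc n) z) \<longlonglongrightarrow> potential z"
  using assms by (intro disc_potential_tendsto(2)[where B = "potential z"] disc_potential_le) auto

section \<open>The minimum principle\<close>

text \<open>
  Subtracting the minimal value leaves a nonnegative continuous function whose mean over each disc
  around \<open>z\<close> is at most its value at \<open>z\<close>, namely \<open>0\<close>.
\<close>
lemma minimum_principle:
  assumes r: "r > 0" and \<sigma>: "\<sigma> holomorphic_on ball z r"
    and fin: "finite_potential z"
    and cont: "continuous_on (ball z r) potential"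
    and min: "\<And>w. w \<in> ball z r \<Longrightarrow> potential z + Re (\<sigma> z) \<le> potential w + Re (\<sigma> w)"
    and w: "w \<in> ball z r"
  shows "potential w + Re (\<sigma> w) = potential z + Re (\<sigma> z)"
proof -
  define \<delta> where "\<delta> = (dist z w + r) / 2"
  have d: "\<delta> > 0" "\<delta> < r" "w \<in> ball z \<delta>"
    using r w zero_le_dist[of z w] by (auto simp: \<delta>_def simp del: zero_le_dist)
  define c where "c = potential z + Re (\<sigma> z)"
  let ?u = "\<lambda>w. potential w + Re (\<sigma> w) - c"
  let ?i = "indicator (ball z \<delta>) :: complex \<Rightarrow> real"
  have i1: "integrable lborel (\<lambda>\<zeta>. ?i \<zeta> *\<^sub>R potential \<zeta>)"
    using disc_integral_potential(1)[OF d(1), of z] by (simp add: set_integrable_def)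
  have i2: "integrable lborel (\<lambda>\<zeta>. ?i \<zeta> *\<^sub>R Re (\<sigma> \<zeta>))"
    using disc_integral_holomorphic(1)[OF \<sigma> d(1,2)] by (simp add: set_integrable_def)
  have i3: "integrable lborel (\<lambda>\<zeta>. ?i \<zeta> *\<^sub>R c)"
    by (intro integrable_scaleR_left integrable_indicator_ball)
  have i12: "integrable lborel (\<lambda>\<zeta>. ?i \<zeta> *\<^sub>R potential \<zeta> + ?i \<zeta> *\<^sub>R Re (\<sigma> \<zeta>))"
    using i1 i2 by (rule Bochner_Integration.integrable_add)
  have u: "?i \<zeta> *\<^sub>R ?u \<zeta> = (?i \<zeta> *\<^sub>R potential \<zeta> + ?i \<zeta> *\<^sub>R Re (\<sigma> \<zeta>)) - ?i \<zeta> *\<^sub>R c" for \<zeta>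
    by (simp add: algebra_simps)
  have iu: "integrable lborel (\<lambda>\<zeta>. ?i \<zeta> *\<^sub>R ?u \<zeta>)"
    unfolding u by (rule Bochner_Integration.integrable_diff[OF i12 i3])
  have "(LINT \<zeta>|lborel. ?i \<zeta> *\<^sub>R ?u \<zeta>) = (LINT \<zeta>:ball z \<delta>|lborel. potential \<zeta>)
      + (LINT \<zeta>:ball z \<delta>|lborel. Re (\<sigma> \<zeta>)) - (LINT \<zeta>|lborel. ?i \<zeta> *\<^sub>R c)"
    unfolding u set_lebesgue_integral_def
    by (subst Bochner_Integration.integral_diff[OF i12 i3], subst Bochner_Integration.integral_add[OF i1 i2]) simp
  also have "(LINT \<zeta>|lborel. ?i \<zeta> *\<^sub>R c) = pi * \<delta>\<^sup>2 * c"
    using content_complex_ball[of \<delta> z] d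
    by (subst integral_scaleR_left) (auto simp: integrable_indicator_ball)
  also have "(LINT \<zeta>:ball z \<delta>|lborel. Re (\<sigma> \<zeta>)) = pi * \<delta>\<^sup>2 * Re (\<sigma> z)"
    by (rule disc_integral_holomorphic(2)[OF \<sigma> d(1,2)])
  finally have "(LINT \<zeta>|lborel. ?i \<zeta> *\<^sub>R ?u \<zeta>) \<le> 0"
    using potential_super_mean(1)[OF fin d(1)] by (simp add: c_def algebra_simps)
  moreover have nn: "0 \<le> ?i \<zeta> *\<^sub>R ?u \<zeta>" for \<zeta>
    using min[of \<zeta>] d by (auto simp: indicator_def c_def)
  then have "0 \<le> (LINT \<zeta>|lborel. ?i \<zeta> *\<^sub>R ?u \<zeta>)" by (intro integral_nonneg_AE) auto
  ultimately have "(LINT \<zeta>|lborel. ?i \<zeta> *\<^sub>R ?u \<zeta>) = 0" by linarith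
  then have AE: "AE \<zeta> in lborel. ?i \<zeta> *\<^sub>R ?u \<zeta> = 0"
    using nn by (subst (asm) integral_nonneg_eq_0_iff_AE[OF iu]) auto
  have contu: "continuous_on (ball z \<delta>) ?u"
    using d by (intro continuous_intros continuous_on_subset[OF cont] holomorphic_on_imp_continuous_on
        holomorphic_on_subset[OF \<sigma>]) auto
  have "?u w = 0"
    by (rule continuous_AE_zero[OF open_ball contu _ d(3)])
       (use AE in \<open>auto elim!: eventually_mono simp: indicator_def\<close>)
  then show ?thesis by (simp add: c_def)
qed

lemma harmonic_imp_not_in_msupp:
  assumes r: "r > 0" and \<sigma>: "\<sigma> holomorphic_on ball z r"
    and fin: "finite_potential z"
    and eq: "\<And>w. w \<in> ball z r \<Longrightarrow> potential w = Re (\<sigma> w)"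
  shows "z \<notin> msupp \<mu>"
proof -
  define \<delta> where "\<delta> = r / 2"
  have d: "\<delta> > 0" "\<delta> < r" using r by (auto simp: \<delta>_def)
  have "(LINT \<zeta>:ball z \<delta>|lborel. potential \<zeta>) = (LINT \<zeta>:ball z \<delta>|lborel. Re (\<sigma> \<zeta>))"
    using eq d by (intro set_lebesgue_integral_cong) auto
  also have "\<dots> = pi * \<delta>\<^sup>2 * potential z"
    using disc_integral_holomorphic(2)[OF \<sigma> d] eq[of z] r by simp
  finally have "emeasure \<mu> (ball z \<delta>) = 0"
    by (rule potential_super_mean(2)[OF fin d(1)])
  then show ?thesis using d(1) unfolding msupp_def by (auto intro!: exI[of _ "ball z \<delta>"])
qed

end


section \<open>Potentials whose gradient takes two opposite values\<close>

text \<open>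
  \<open>s\<close> collects the holomorphic functions whose real parts are the harmonic part of the total
  potential, namely half the external field and the weighted potentials of the measures that
  are absent from the disc.
\<close>
locale two_valued_gradient = plane_measure +
  fixes z\<^sub>0 :: complex and \<rho> :: real and e s q :: "complex \<Rightarrow> complex"
  assumes rho: "\<rho> > 0"
    and null_msupp: "msupp \<mu> \<in> null_sets lborel"
    and s_deriv: "\<And>w. w \<in> ball z\<^sub>0 \<rho> \<Longrightarrow> (s has_field_derivative e w) (at w)"
    and q_holo: "q holomorphic_on ball z\<^sub>0 \<rho>"
    and square: "AE \<zeta> in lborel. \<zeta> \<in> ball z\<^sub>0 \<rho> \<longrightarrow> (cauchy \<zeta> + e \<zeta>)\<^sup>2 = (q \<zeta>)\<^sup>2"
begin

definition W :: "complex \<Rightarrow> real" where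
  "W w = potential w + Re (s w)"

lemma s_holo: "s holomorphic_on ball z\<^sub>0 \<rho>" and e_holo: "e holomorphic_on ball z\<^sub>0 \<rho>"
  using holomorphic_primitive[OF open_ball s_deriv] by blast+

text \<open>
  On a small disc \<open>e\<close> and \<open>q\<close> are nearly constant. The mean of \<open>C + e\<close> is therefore nearly the mean of
  numbers \<open>q\<close> and \<open>-q\<close> with the same \<open>q\<close>, and its pairing with any direction \<open>v\<close> is controlled by that
  of \<open>q\<close>.
\<close>
lemma disc_cauchy_bound:
  assumes r: "r < \<rho>" and \<epsilon>: "\<epsilon> > 0"
  obtains d where "d > 0"
    "\<And>\<delta> \<zeta> v. 0 < \<delta> \<Longrightarrow> \<delta> \<le> d \<Longrightarrow> \<zeta> \<in> cball z\<^sub>0 r \<Longrightarrow>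
      \<bar>Re ((disc_cauchy \<delta> \<zeta> + e \<zeta>) * v)\<bar> \<le> \<bar>Re (q \<zeta> * v)\<bar> + \<epsilon> * cmod v"
proof -
  define R where "R = (r + \<rho>) / 2"
  have R: "r < R" "R < \<rho>" using r by (auto simp: R_def)
  have K: "cball z\<^sub>0 R \<subseteq> ball z\<^sub>0 \<rho>" using R by auto
  have "uniformly_continuous_on (cball z\<^sub>0 R) e" "uniformly_continuous_on (cball z\<^sub>0 R) q"
    using e_holo q_holo K by (auto intro!: compact_uniformly_continuous
        intro: continuous_on_subset[OF holomorphic_on_imp_continuous_on])
  moreover have "\<epsilon> / 2 > 0" using \<epsilon> by simp
  ultimately obtain d1 d2 where d12: "d1 > 0" "d2 > 0"
    "\<And>x y. x \<in> cball z\<^sub>0 R \<Longrightarrow> y \<in> cball z\<^sub>0 R \<Longrightarrow> dist y x < d1 \<Longrightarrow> dist (e y) (e x) < \<epsilon> / 2"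
    "\<And>x y. x \<in> cball z\<^sub>0 R \<Longrightarrow> y \<in> cball z\<^sub>0 R \<Longrightarrow> dist y x < d2 \<Longrightarrow> dist (q y) (q x) < \<epsilon> / 2"
    unfolding uniformly_continuous_on_def by metis
  define d where "d = min (min d1 d2) (R - r)"
  have d: "d > 0" using d12 R by (simp add: d_def)
  have "\<bar>Re ((disc_cauchy \<delta> \<zeta> + e \<zeta>) * v)\<bar> \<le> \<bar>Re (q \<zeta> * v)\<bar> + \<epsilon> * cmod v"
    if \<delta>: "0 < \<delta>" "\<delta> \<le> d" and \<zeta>: "\<zeta> \<in> cball z\<^sub>0 r" for \<delta> \<zeta> v
  proof -
    let ?B = "\<bar>Re (q \<zeta> * v)\<bar> + \<epsilon> * cmod v"
    let ?i = "indicator (ball \<zeta> \<delta>) :: complex \<Rightarrow> real"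
    have i1: "integrable lborel (\<lambda>\<xi>. ?i \<xi> *\<^sub>R cauchy \<xi>)"
      using disc_integral_cauchy(1)[OF \<delta>(1)] by (simp add: set_integrable_def)
    have i2: "integrable lborel (\<lambda>\<xi>. ?i \<xi> *\<^sub>R e \<zeta>)"
      by (intro integrable_scaleR_left integrable_indicator_ball)
    have i12: "integrable lborel (\<lambda>\<xi>. ?i \<xi> *\<^sub>R cauchy \<xi> + ?i \<xi> *\<^sub>R e \<zeta>)"
      using i1 i2 by (rule Bochner_Integration.integrable_add)
    define g where "g = (\<lambda>\<xi>. (?i \<xi> *\<^sub>R cauchy \<xi> + ?i \<xi> *\<^sub>R e \<zeta>) * v)"
    have gi: "integrable lborel g" unfolding g_def using i12 by (rule integrable_mult_left)
    have "(LINT \<xi>|lborel. g \<xi>) = ((LINT \<xi>|lborel. ?i \<xi> *\<^sub>R cauchy \<xi>) + (LINT \<xi>|lborel. ?i \<xi> *\<^sub>R e \<zeta>)) * v"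
      unfolding g_def by (subst integral_mult_left_zero, subst Bochner_Integration.integral_add[OF i1 i2]) simp
    also have "(LINT \<xi>|lborel. ?i \<xi> *\<^sub>R cauchy \<xi>) = of_real (pi * \<delta>\<^sup>2) * disc_cauchy \<delta> \<zeta>"
      using disc_integral_cauchy(2)[OF \<delta>(1), of \<zeta>] by (simp add: set_lebesgue_integral_def)
    also have "(LINT \<xi>|lborel. ?i \<xi> *\<^sub>R e \<zeta>) = of_real (pi * \<delta>\<^sup>2) * e \<zeta>"
      using \<delta>(1) content_complex_ball[of \<delta> \<zeta>]
      by (subst integral_scaleR_left) (auto simp: integrable_indicator_ball scaleR_conv_of_real)
    finally have "(LINT \<xi>|lborel. g \<xi>) = of_real (pi * \<delta>\<^sup>2) * ((disc_cauchy \<delta> \<zeta> + e \<zeta>) * v)"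
      by (simp add: algebra_simps)
    then have "Re (LINT \<xi>|lborel. g \<xi>) = pi * \<delta>\<^sup>2 * Re ((disc_cauchy \<delta> \<zeta> + e \<zeta>) * v)"
      by (simp only: Re_complex_of_real Im_complex_of_real times_complex.simps mult_zero_left diff_zero)
    then have eq: "(LINT \<xi>|lborel. Re (g \<xi>)) = pi * \<delta>\<^sup>2 * Re ((disc_cauchy \<delta> \<zeta> + e \<zeta>) * v)"
      by (simp only: integral_Re[OF gi])
    have Rgi: "integrable lborel (\<lambda>\<xi>. Re (g \<xi>))" using gi by (rule integrable_Re)
    have "\<bar>LINT \<xi>|lborel. Re (g \<xi>)\<bar> \<le> (LINT \<xi>|lborel. \<bar>Re (g \<xi>)\<bar>)"
      by (rule integral_abs_bound)
    also have "\<dots> \<le> (LINT \<xi>|lborel. ?i \<xi> *\<^sub>R ?B)"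
    proof (rule integral_mono_AE)
      show "integrable lborel (\<lambda>\<xi>. \<bar>Re (g \<xi>)\<bar>)" using Rgi by (rule integrable_abs)
      show "integrable lborel (\<lambda>\<xi>. ?i \<xi> *\<^sub>R ?B)"
        by (intro integrable_scaleR_left integrable_indicator_ball)
      show "AE \<xi> in lborel. \<bar>Re (g \<xi>)\<bar> \<le> ?i \<xi> *\<^sub>R ?B"
        using square
      proof eventually_elim
        case (elim \<xi>)
        show ?case
        proof (cases "\<xi> \<in> ball \<zeta> \<delta>")
          case True
          have dist: "dist \<xi> \<zeta> < d1" "dist \<xi> \<zeta> < d2" "dist \<xi> \<zeta> < R - r"
            using True \<delta> by (auto simp: d_def dist_commute)
          have \<xi>K: "\<xi> \<in> cball z\<^sub>0 R" using dist(3) \<zeta> dist_triangle[of z\<^sub>0 \<xi> \<zeta>] by (simp add: dist_commute)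
          have \<zeta>K: "\<zeta> \<in> cball z\<^sub>0 R" using \<zeta> R by simp
          have eq': "cmod (e \<xi> - e \<zeta>) \<le> \<epsilon> / 2" "cmod (q \<xi> - q \<zeta>) \<le> \<epsilon> / 2"
            using d12(3)[OF \<zeta>K \<xi>K dist(1)] d12(4)[OF \<zeta>K \<xi>K dist(2)] by (auto simp: dist_norm)
          have "(cauchy \<xi> + e \<xi>)\<^sup>2 = (q \<xi>)\<^sup>2" using elim \<xi>K K by blast
          then have pm: "cauchy \<xi> + e \<xi> = q \<xi> \<or> cauchy \<xi> + e \<xi> = - q \<xi>" by (simp add: power2_eq_iff)
          have "\<bar>Re ((cauchy \<xi> + e \<zeta>) * v)\<bar> \<le> \<bar>Re ((cauchy \<xi> + e \<xi>) * v)\<bar> + \<bar>Re ((e \<xi> - e \<zeta>) * v)\<bar>"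
            by (simp add: algebra_simps)
          also have "\<bar>Re ((cauchy \<xi> + e \<xi>) * v)\<bar> = \<bar>Re (q \<xi> * v)\<bar>"
            using pm by (elim disjE) (simp_all only: mult_minus_left uminus_complex.simps abs_minus_cancel)
          also have "\<bar>Re (q \<xi> * v)\<bar> \<le> \<bar>Re (q \<zeta> * v)\<bar> + \<bar>Re ((q \<xi> - q \<zeta>) * v)\<bar>"
            by (simp add: algebra_simps)
          finally have "\<bar>Re ((cauchy \<xi> + e \<zeta>) * v)\<bar>
              \<le> \<bar>Re (q \<zeta> * v)\<bar> + \<bar>Re ((q \<xi> - q \<zeta>) * v)\<bar> + \<bar>Re ((e \<xi> - e \<zeta>) * v)\<bar>" by simp
          moreover from abs_Re_mult_le[OF eq'(1), of v] abs_Re_mult_le[OF eq'(2), of v]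
          have "\<bar>Re ((e \<xi> - e \<zeta>) * v)\<bar> + \<bar>Re ((q \<xi> - q \<zeta>) * v)\<bar> \<le> \<epsilon> * cmod v" by argo
          ultimately have "\<bar>Re ((cauchy \<xi> + e \<zeta>) * v)\<bar> \<le> ?B" by linarith
          then show ?thesis using True by (simp add: g_def)
        qed (simp add: g_def)
      qed
    qed
    also have "\<dots> = pi * \<delta>\<^sup>2 * ?B"
      using \<delta>(1) content_complex_ball[of \<delta> \<zeta>]
      by (subst integral_scaleR_left) (auto simp: integrable_indicator_ball)
    finally have "pi * \<delta>\<^sup>2 * \<bar>Re ((disc_cauchy \<delta> \<zeta> + e \<zeta>) * v)\<bar> \<le> pi * \<delta>\<^sup>2 * ?B"
      unfolding eq by (simp only: abs_mult) simp
    moreover have "pi * \<delta>\<^sup>2 > 0" using \<delta>(1) by simp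
    ultimately show ?thesis by (simp only: mult_le_cancel_left_pos)
  qed
  with d show thesis using that by blast
qed

lemma disc_potential_segment:
  assumes \<delta>: "\<delta> > 0" and ab: "a \<in> ball z\<^sub>0 \<rho>" "b \<in> ball z\<^sub>0 \<rho>"
    and bnd: "\<And>t. t \<in> {0..1} \<Longrightarrow> \<bar>Re ((disc_cauchy \<delta> (a + of_real t * (b - a)) + e (a + of_real t * (b - a))) * (b - a))\<bar> \<le> M"
  shows "\<bar>(disc_potential \<delta> b + Re (s b)) - (disc_potential \<delta> a + Re (s a))\<bar> \<le> M"
proof -
  let ?l = "\<lambda>t. a + of_real t * (b - a)"
  have "((\<lambda>t. Re (disc_cauchy \<delta> (?l t) * (b - a))) has_integral
      disc_potential \<delta> b - disc_potential \<delta> a) {0..1}"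
    using set_borel_integral_eq_integral[OF disc_potential_increment(1)[OF \<delta>, of a "b - a"]]
      disc_potential_increment(2)[OF \<delta>, of a "b - a"]
    by (simp add: has_integral_integrable_integral)
  from has_integral_add[OF this has_integral_Re_primitive[OF convex_ball ab s_deriv]]
  have "((\<lambda>t. Re ((disc_cauchy \<delta> (?l t) + e (?l t)) * (b - a))) has_integral
      (disc_potential \<delta> b + Re (s b)) - (disc_potential \<delta> a + Re (s a))) {0..1}"
    by (rule has_integral_eq_rhs[OF has_integral_eq[rotated]]) (auto simp: algebra_simps)
  moreover have "0 \<le> M" using bnd[of 0] by auto
  ultimately have "norm ((disc_potential \<delta> b + Re (s b)) - (disc_potential \<delta> a + Re (s a))) \<le> M * measure lborel {0..1::real}"
    by (intro has_integral_bound_real) (use bnd in auto)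
  then show ?thesis by simp
qed

lemma exists_point_off_msupp:
  assumes "open U" "U \<noteq> {}"
  obtains p where "p \<in> U" "p \<notin> msupp \<mu>"
proof -
  have "\<not> U \<subseteq> msupp \<mu>"
  proof
    assume "U \<subseteq> msupp \<mu>"
    then have "U \<in> null_sets lborel"
      using null_sets_subset[OF null_msupp] assms(1) by auto
    then show False using open_null_set_lborel assms by blast
  qed
  then show thesis using that by blast
qed

text \<open>
  The smoothed potentials have uniformly bounded increments, and at a point off the support they are
  bounded. Hence they are bounded everywhere in the disc.
\<close>
lemma finite_potential_ball:
  assumes w: "w \<in> ball z\<^sub>0 \<rho>"
  shows "finite_potential w"
proof -
  obtain p where p: "p \<in> ball z\<^sub>0 \<rho>" "p \<notin> msupp \<mu>"
    using exists_point_off_msupp[of "ball z\<^sub>0 \<rho>"] rho by auto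
  obtain r0 where r0: "r0 > 0" "\<And>x w. x \<in> msupp \<mu> \<Longrightarrow> w \<in> ball p r0 \<Longrightarrow> r0 \<le> cmod (x - w)"
    using far_from_msupp[OF p(2)] by blast
  have fp: "finite_potential p"
    by (rule finite_potential_off_msupp[OF r0(1)]) (use r0 in auto)
  define r where "r = max (dist z\<^sub>0 p) (dist z\<^sub>0 w)"
  have r: "r < \<rho>" "p \<in> cball z\<^sub>0 r" "w \<in> cball z\<^sub>0 r" using p w by (auto simp: r_def)
  obtain d where d: "d > 0" "\<And>\<delta> \<zeta> v. 0 < \<delta> \<Longrightarrow> \<delta> \<le> d \<Longrightarrow> \<zeta> \<in> cball z\<^sub>0 r \<Longrightarrow>
      \<bar>Re ((disc_cauchy \<delta> \<zeta> + e \<zeta>) * v)\<bar> \<le> \<bar>Re (q \<zeta> * v)\<bar> + 1 * cmod v"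
    using disc_cauchy_bound[OF r(1), of 1] by auto
  have "bounded (q ` cball z\<^sub>0 r)"
    using r(1) by (intro compact_imp_bounded compact_continuous_image
        continuous_on_subset[OF holomorphic_on_imp_continuous_on[OF q_holo]]) auto
  then obtain Q where Q: "\<And>\<zeta>. \<zeta> \<in> cball z\<^sub>0 r \<Longrightarrow> cmod (q \<zeta>) \<le> Q" by (force simp: bounded_iff)
  let ?M = "(Q + 1) * cmod (w - p)"
  have "disc_potential \<delta> w \<le> potential p + Re (s p) - Re (s w) + ?M" if \<delta>: "0 < \<delta>" "\<delta> \<le> d" for \<delta>
  proof -
    have "\<bar>(disc_potential \<delta> w + Re (s w)) - (disc_potential \<delta> p + Re (s p))\<bar> \<le> ?M"
    proof (rule disc_potential_segment[OF \<delta>(1) p(1) w])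
      fix t :: real assume t: "t \<in> {0..1}"
      have seg: "p + of_real t * (w - p) \<in> cball z\<^sub>0 r"
        by (rule segment_in_convex[OF convex_cball r(2,3) t])
      have "\<bar>Re (q (p + of_real t * (w - p)) * (w - p))\<bar> \<le> Q * cmod (w - p)"
        by (rule abs_Re_mult_le[OF Q[OF seg]])
      then show "\<bar>Re ((disc_cauchy \<delta> (p + of_real t * (w - p)) + e (p + of_real t * (w - p))) * (w - p))\<bar> \<le> ?M"
        using d(2)[OF \<delta> seg, of "w - p"] unfolding distrib_right by linarith
    qed
    moreover have "disc_potential \<delta> p \<le> potential p" by (rule disc_potential_le[OF fp \<delta>(1)])
    ultimately show ?thesis by linarith
  qed
  then show ?thesis
    using d(1) by (intro disc_potential_tendsto(1)[of d w "potential p + Re (s p) - Re (s w) + ?M"]) (auto simp: divide_le_eq mult_le_cancel_left1)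
qed

text \<open>
  This is the limit of the preceding bounds as \<open>\<delta>\<close> tends to \<open>0\<close>. Only the values \<open>Re (q v)\<close> in the
  direction \<open>v\<close> of the segment enter, so that \<open>W\<close> is not only Lipschitz but also stationary in the
  directions with \<open>Re (q v) = 0\<close>.
\<close>
lemma W_segment:
  assumes ab: "a \<in> ball z\<^sub>0 \<rho>" "b \<in> ball z\<^sub>0 \<rho>"
    and bnd: "\<And>t. t \<in> {0..1} \<Longrightarrow> \<bar>Re (q (a + of_real t * (b - a)) * (b - a))\<bar> \<le> M"
  shows "\<bar>W b - W a\<bar> \<le> M"
proof -
  define r where "r = max (dist z\<^sub>0 a) (dist z\<^sub>0 b)"
  have r: "r < \<rho>" "a \<in> cball z\<^sub>0 r" "b \<in> cball z\<^sub>0 r" using ab by (auto simp: r_def)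
  have "\<bar>W b - W a\<bar> \<le> M + \<epsilon> * cmod (b - a)" if \<epsilon>: "\<epsilon> > 0" for \<epsilon>
  proof -
    obtain d where d: "d > 0" "\<And>\<delta> \<zeta> v. 0 < \<delta> \<Longrightarrow> \<delta> \<le> d \<Longrightarrow> \<zeta> \<in> cball z\<^sub>0 r \<Longrightarrow>
      \<bar>Re ((disc_cauchy \<delta> \<zeta> + e \<zeta>) * v)\<bar> \<le> \<bar>Re (q \<zeta> * v)\<bar> + \<epsilon> * cmod v"
      using disc_cauchy_bound[OF r(1) \<epsilon>] by auto
    let ?f = "\<lambda>n::nat. (disc_potential (d / Suc n) b + Re (s b)) - (disc_potential (d / Suc n) a + Re (s a))"
    have le: "\<bar>?f n\<bar> \<le> M + \<epsilon> * cmod (b - a)" for n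
    proof (rule disc_potential_segment[OF _ ab])
      show dn: "0 < d / Suc n" using d(1) by simp
      fix t :: real assume t: "t \<in> {0..1}"
      have seg: "a + of_real t * (b - a) \<in> cball z\<^sub>0 r"
        by (rule segment_in_convex[OF convex_cball r(2,3) t])
      have "d / Suc n \<le> d" using d(1) by (simp add: divide_le_eq mult_le_cancel_left1)
      from d(2)[OF dn this seg, of "b - a"] bnd[OF t]
      show "\<bar>Re ((disc_cauchy (d / Suc n) (a + of_real t * (b - a)) + e (a + of_real t * (b - a))) * (b - a))\<bar>
          \<le> M + \<epsilon> * cmod (b - a)"
        by linarith
    qed
    have "(\<lambda>n. \<bar>?f n\<bar>) \<longlonglongrightarrow> \<bar>W b - W a\<bar>"
      unfolding W_def using ab d(1)
      by (intro tendsto_intros disc_potential_tendsto_potential finite_potential_ball)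
    then show ?thesis by (rule LIMSEQ_le_const2) (use le in blast)
  qed
  note eps = this
  show ?thesis
  proof (rule field_le_epsilon)
    fix \<epsilon> :: real assume "\<epsilon> > 0"
    moreover have "\<epsilon> / (cmod (b - a) + 1) * cmod (b - a) \<le> \<epsilon>"
      using \<open>\<epsilon> > 0\<close> by (simp add: divide_le_eq add_pos_nonneg mult_left_mono add.commute)
    moreover have "0 < \<epsilon> / (cmod (b - a) + 1)"
      using \<open>\<epsilon> > 0\<close> by (simp add: add_nonneg_pos)
    ultimately show "\<bar>W b - W a\<bar> \<le> M + \<epsilon>"
      using eps[of "\<epsilon> / (cmod (b - a) + 1)"] by linarith
  qed
qed


text \<open>Near \<open>a\<close> the function \<open>q\<close> may be frozen at its value \<open>q a\<close>, up to a first order error.\<close>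
lemma W_near:
  assumes a: "a \<in> ball z\<^sub>0 \<rho>" and \<epsilon>: "\<epsilon> > 0"
  shows "\<forall>\<^sub>F b in nhds a. \<bar>W b - W a\<bar> \<le> \<bar>Re (q a * (b - a))\<bar> + \<epsilon> * cmod (b - a)"
proof -
  have "isCont q a"
    using holomorphic_on_imp_continuous_on[OF q_holo] a by (simp add: continuous_on_eq_continuous_at)
  then have "\<forall>\<^sub>F b in nhds a. dist (q b) (q a) < \<epsilon>"
    using \<epsilon> by (intro tendstoD) (simp_all add: continuous_at_imp_continuous_at_within isCont_def tendsto_at_iff_tendsto_nhds)
  moreover have "\<forall>\<^sub>F b in nhds a. b \<in> ball z\<^sub>0 \<rho>"
    using a by (intro eventually_nhds_in_open) auto
  ultimately have "\<forall>\<^sub>F b in nhds a. dist (q b) (q a) < \<epsilon> \<and> b \<in> ball z\<^sub>0 \<rho>"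
    by (rule eventually_conj)
  then obtain d where d: "d > 0" "\<And>b. dist b a < d \<Longrightarrow> dist (q b) (q a) < \<epsilon> \<and> b \<in> ball z\<^sub>0 \<rho>"
    unfolding eventually_nhds_metric by blast
  have "\<bar>W b - W a\<bar> \<le> \<bar>Re (q a * (b - a))\<bar> + \<epsilon> * cmod (b - a)" if b: "dist b a < d" for b
  proof (rule W_segment[OF a])
    show "b \<in> ball z\<^sub>0 \<rho>" using d(2)[OF b] by blast
    fix t :: real assume t: "t \<in> {0..1}"
    have "dist (a + of_real t * (b - a)) a \<le> dist b a"
      using t by (simp add: dist_norm norm_mult mult_left_le_one_le)
    then have "cmod (q (a + of_real t * (b - a)) - q a) \<le> \<epsilon>"
      using d(2)[of "a + of_real t * (b - a)"] b by (auto simp: dist_norm)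
    from abs_Re_mult_le[OF this, of "b - a"]
    have "\<bar>Re (q (a + of_real t * (b - a)) * (b - a)) - Re (q a * (b - a))\<bar> \<le> \<epsilon> * cmod (b - a)"
      by (simp only: left_diff_distrib minus_complex.simps)
    then show "\<bar>Re (q (a + of_real t * (b - a)) * (b - a))\<bar> \<le> \<bar>Re (q a * (b - a))\<bar> + \<epsilon> * cmod (b - a)"
      by linarith
  qed
  then show ?thesis using d(1) unfolding eventually_nhds_metric by blast
qed

lemma W_continuous: "continuous_on (ball z\<^sub>0 \<rho>) W"
proof -
  have "isCont W a" if a: "a \<in> ball z\<^sub>0 \<rho>" for a
  proof -
    have "((\<lambda>b. \<bar>Re (q a * (b - a))\<bar> + 1 * cmod (b - a)) \<longlongrightarrow> \<bar>Re (q a * (a - a))\<bar> + 1 * cmod (a - a)) (at a)"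
      by (intro tendsto_intros)
    then have "((\<lambda>b. \<bar>Re (q a * (b - a))\<bar> + 1 * cmod (b - a)) \<longlongrightarrow> 0) (at a)" by simp
    moreover have "\<forall>\<^sub>F b in at a. norm (W b - W a) \<le> \<bar>Re (q a * (b - a))\<bar> + 1 * cmod (b - a)"
      using W_near[OF a, of 1] by (simp add: eventually_at_filter eventually_mono)
    ultimately have "((\<lambda>b. W b - W a) \<longlongrightarrow> 0) (at a)" by (rule Lim_null_comparison[rotated])
    then show ?thesis unfolding isCont_def by (rule LIM_zero_cancel)
  qed
  then show ?thesis by (simp add: continuous_at_imp_continuous_on)
qed

lemma potential_continuous: "continuous_on (ball z\<^sub>0 \<rho>) potential"
proof -
  have "continuous_on (ball z\<^sub>0 \<rho>) (\<lambda>w. W w - Re (s w))"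
    using s_holo by (intro continuous_intros W_continuous holomorphic_on_imp_continuous_on)
  then show ?thesis by (simp add: W_def)
qed

lemma W_along_curve:
  fixes f :: "real \<Rightarrow> complex"
  assumes f: "(f has_vector_derivative L) (at t)" and a: "f t \<in> ball z\<^sub>0 \<rho>"
    and orth: "Re (q (f t) * L) = 0"
  shows "((\<lambda>u. W (f u)) has_real_derivative 0) (at t)"
proof (rule zero_derivative_along_curve[OF f orth, of UNIV])
  show "\<forall>\<^sub>F w in nhds (f t). w \<in> UNIV \<longrightarrow> \<bar>W w - W (f t)\<bar> \<le> \<bar>Re (q (f t) * (w - f t))\<bar> + \<epsilon> * cmod (w - f t)"
    if "\<epsilon> > 0" for \<epsilon>
    using W_near[OF a that] by simp
qed simp

text \<open>
  Off the support \<open>C + e\<close> is continuous, so the equation for its square holds at every point.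
\<close>
lemma W_off_msupp:
  assumes a: "a \<in> ball z\<^sub>0 \<rho>" "a \<notin> msupp \<mu>"
  obtains \<sigma> r c where "c = 1 \<or> c = -1" "r > 0" "(\<sigma> has_field_derivative of_real c * q a) (at a)"
    "\<And>w. w \<in> ball a r \<Longrightarrow> W w = Re (\<sigma> w)"
proof -
  obtain r0 where r0: "r0 > 0" "\<And>x w. x \<in> msupp \<mu> \<Longrightarrow> w \<in> ball a r0 \<Longrightarrow> r0 \<le> cmod (x - w)"
    using far_from_msupp[OF a(2)] by blast
  obtain r1 where r1: "r1 > 0" "ball a r1 \<subseteq> ball z\<^sub>0 \<rho>" using a(1) openE[OF open_ball] by blast
  define r where "r = min r0 r1"
  have r: "r > 0" "ball a r \<subseteq> ball a r0" "ball a r \<subseteq> ball z\<^sub>0 \<rho>" using r0(1) r1 by (auto simp: r_def)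
  have "\<exists>\<sigma>. \<forall>w\<in>ball a r. (\<sigma> has_field_derivative cauchy w) (at w) \<and> potential w = Re (\<sigma> w)"
    by (rule potential_eq_Re_holomorphic[OF convex_ball open_ball r0(1)]) (use r0(2) r(2) in blast)
  then obtain \<sigma> where \<sigma>: "\<And>w. w \<in> ball a r \<Longrightarrow> (\<sigma> has_field_derivative cauchy w) (at w)"
    "\<And>w. w \<in> ball a r \<Longrightarrow> potential w = Re (\<sigma> w)" by blast
  have ch: "cauchy holomorphic_on ball a r" using \<sigma>(1) by (rule holomorphic_primitive(2)[OF open_ball])
  let ?h = "\<lambda>w. (cauchy w + e w)\<^sup>2 - (q w)\<^sup>2"
  have cont: "continuous_on (ball a r) ?h"
    using r by (intro continuous_intros holomorphic_on_imp_continuous_on ch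
        holomorphic_on_subset[OF e_holo] holomorphic_on_subset[OF q_holo])
  have "?h a = 0"
    by (rule continuous_AE_zero[OF open_ball cont]) (use square r in \<open>auto elim!: eventually_mono\<close>)
  then have "(cauchy a + e a)\<^sup>2 = (q a)\<^sup>2" by simp
  then obtain c :: real where c: "c = 1 \<or> c = -1" "cauchy a + e a = of_real c * q a"
    unfolding power2_eq_iff by (elim disjE) (auto intro: that[of 1] that[of "-1"])
  show thesis
  proof (rule that[OF c(1) r(1)])
    show "((\<lambda>w. \<sigma> w + s w) has_field_derivative of_real c * q a) (at a)"
      unfolding c(2)[symmetric] using r(1) a by (intro derivative_intros \<sigma>(1) s_deriv) auto
    show "W w = Re (\<sigma> w + s w)" if "w \<in> ball a r" for w
      using \<sigma>(2)[OF that] by (simp add: W_def)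
  qed
qed

lemma W_eq_Re_imp_not_in_msupp:
  assumes a: "a \<in> ball z\<^sub>0 \<rho>" and r: "r > 0" and \<tau>: "\<tau> holomorphic_on ball a r"
    and eq: "\<And>w. w \<in> ball a r \<Longrightarrow> W w = Re (\<tau> w)"
  shows "a \<notin> msupp \<mu>"
proof -
  obtain r1 where r1: "r1 > 0" "ball a r1 \<subseteq> ball z\<^sub>0 \<rho>" using a(1) openE[OF open_ball] by blast
  show ?thesis
  proof (rule harmonic_imp_not_in_msupp)
    show "min r r1 > 0" using r r1 by simp
    show "(\<lambda>w. \<tau> w - s w) holomorphic_on ball a (min r r1)"
      by (intro holomorphic_intros holomorphic_on_subset[OF \<tau>] holomorphic_on_subset[OF s_holo])
         (use r1(2) in auto)
    show "potential w = Re (\<tau> w - s w)" if "w \<in> ball a (min r r1)" for w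
      using eq[of w] that by (simp add: W_def)
  qed (rule finite_potential_ball[OF a])
qed

lemma W_local_minimum:
  assumes a: "a \<in> ball z\<^sub>0 \<rho>" and r: "r > 0" and \<tau>: "\<tau> holomorphic_on ball a r"
    and min: "\<forall>\<^sub>F w in nhds a. W a + Re (\<tau> a) \<le> W w + Re (\<tau> w)"
  shows "\<forall>\<^sub>F w in nhds a. W w + Re (\<tau> w) = W a + Re (\<tau> a)"
proof -
  obtain r1 where r1: "r1 > 0" "ball a r1 \<subseteq> ball z\<^sub>0 \<rho>" using a(1) openE[OF open_ball] by blast
  obtain r2 where r2: "r2 > 0" "\<And>w. dist w a < r2 \<Longrightarrow> W a + Re (\<tau> a) \<le> W w + Re (\<tau> w)"
    using min unfolding eventually_nhds_metric by blast
  define R where "R = min (min r r1) r2"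
  have R: "R > 0" "ball a R \<subseteq> ball z\<^sub>0 \<rho>" "ball a R \<subseteq> ball a r" using r r1 r2 by (auto simp: R_def)
  have "W w + Re (\<tau> w) = W a + Re (\<tau> a)" if w: "w \<in> ball a R" for w
  proof -
    have "potential w + Re (s w + \<tau> w) = potential a + Re (s a + \<tau> a)"
    proof (rule minimum_principle[OF R(1) _ finite_potential_ball[OF a] _ _ w])
      show "(\<lambda>w. s w + \<tau> w) holomorphic_on ball a R"
        by (intro holomorphic_intros holomorphic_on_subset[OF \<tau>] holomorphic_on_subset[OF s_holo] R)
      show "continuous_on (ball a R) potential" by (rule continuous_on_subset[OF potential_continuous R(2)])
      show "potential a + Re (s a + \<tau> a) \<le> potential w + Re (s w + \<tau> w)" if "w \<in> ball a R" for w
        using r2(2)[of w] that by (simp add: W_def R_def dist_commute)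
    qed
    then show ?thesis by (simp add: W_def)
  qed
  then show ?thesis
    unfolding eventually_nhds_metric using R(1) by (metis dist_commute mem_ball)
qed


text \<open>
  In the coordinate \<open>P\<close> the potential is a function \<open>\<phi>\<close> of one real variable, to which
  \<open>affine_or_peak\<close> applies. An affine \<open>\<phi>\<close> near \<open>Re (P a)\<close> makes \<open>W\<close> harmonic near \<open>a\<close>; this
  excludes the affine alternative at \<open>z\<^sub>0\<close>, and also support points off the ridge.
\<close>
lemma W_roof:
  assumes q0: "q z\<^sub>0 \<noteq> 0" and supp: "z\<^sub>0 \<in> msupp \<mu>"
  obtains P d where "d > 0" "P z\<^sub>0 = 0" "(P has_field_derivative q z\<^sub>0) (at z\<^sub>0)"
    "\<And>w. w \<in> ball z\<^sub>0 d \<Longrightarrow> W w = W z\<^sub>0 - \<bar>Re (P w)\<bar>"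
    "\<And>w. w \<in> ball z\<^sub>0 d \<Longrightarrow> w \<in> msupp \<mu> \<Longrightarrow> Re (P w) = 0"
proof -
  have z0: "z\<^sub>0 \<in> ball z\<^sub>0 \<rho>" using rho by simp
  obtain P0 where "\<And>x. x \<in> ball z\<^sub>0 \<rho> \<Longrightarrow> (P0 has_field_derivative q x) (at x within ball z\<^sub>0 \<rho>)"
    using holomorphic_convex_primitive'[OF convex_ball open_ball q_holo] by blast
  then have P0: "\<And>x. x \<in> ball z\<^sub>0 \<rho> \<Longrightarrow> (P0 has_field_derivative q x) (at x)"
    using at_within_open[OF _ open_ball] by metis
  define P where "P = (\<lambda>x. P0 x - P0 z\<^sub>0)"
  have P: "(P has_field_derivative q x) (at x)" if "x \<in> ball z\<^sub>0 \<rho>" for x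
    unfolding P_def using P0[OF that] by (auto intro!: derivative_eq_intros)
  have Pz: "P z\<^sub>0 = 0" by (simp add: P_def)
  have Ph: "P holomorphic_on ball z\<^sub>0 \<rho>" by (rule holomorphic_primitive(1)[OF open_ball P])
  have "deriv P z\<^sub>0 \<noteq> 0" using DERIV_imp_deriv[OF P[OF z0]] q0 by simp
  then obtain r where r: "r > 0" "ball z\<^sub>0 r \<subseteq> ball z\<^sub>0 \<rho>" "open (P ` ball z\<^sub>0 r)" "inj_on P (ball z\<^sub>0 r)"
    using has_complex_derivative_locally_invertible[OF Ph z0 open_ball] by blast
  define N where "N = ball z\<^sub>0 r"
  obtain \<psi> where \<psi>: "\<psi> holomorphic_on (P ` N)" "\<And>z. z \<in> N \<Longrightarrow> deriv P z * deriv \<psi> (P z) = 1"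
      "\<And>z. z \<in> N \<Longrightarrow> \<psi> (P z) = z"
    using holomorphic_has_inverse[OF holomorphic_on_subset[OF Ph r(2)] open_ball r(4)] unfolding N_def by blast
  have "0 \<in> P ` N" using Pz r(1) by (force simp: N_def image_iff)
  then obtain \<eta> where \<eta>: "\<eta> > 0" "ball 0 \<eta> \<subseteq> P ` N" using openE[OF r(3)] unfolding N_def by metis
  have \<psi>N: "\<psi> w \<in> N" and P\<psi>: "P (\<psi> w) = w" if "w \<in> ball 0 \<eta>" for w
    using \<eta>(2) that \<psi>(3) by (auto simp: image_iff subset_iff)
  have NB: "x \<in> ball z\<^sub>0 \<rho>" if "x \<in> N" for x using that r(2) by (auto simp: N_def)
  have q_nz: "q x \<noteq> 0" if "x \<in> N" for x
    using \<psi>(2)[OF that] DERIV_imp_deriv[OF P[OF NB[OF that]]] by auto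
  have \<psi>d: "(\<psi> has_field_derivative 1 / q (\<psi> w)) (at w)" if w: "w \<in> ball 0 \<eta>" for w
  proof -
    have "w \<in> P ` N" using \<eta>(2) w by blast
    then have "(\<psi> has_field_derivative deriv \<psi> w) (at w)"
      using holomorphic_derivI[OF \<psi>(1)] r(3) by (simp add: N_def)
    moreover have "q (\<psi> w) * deriv \<psi> w = 1"
      using \<psi>(2)[OF \<psi>N[OF w]] DERIV_imp_deriv[OF P[OF NB[OF \<psi>N[OF w]]]] P\<psi>[OF w] by simp
    then have "deriv \<psi> w = 1 / q (\<psi> w)" using q_nz[OF \<psi>N[OF w]] by (simp add: field_simps)
    ultimately show ?thesis by simp
  qed
  have \<psi>0: "\<psi> 0 = z\<^sub>0" using \<psi>(3)[of z\<^sub>0] Pz r(1) by (simp add: N_def)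
  define \<phi> where "\<phi> = (\<lambda>x::real. W (\<psi> (of_real x)))"
  have real_in: "of_real x \<in> ball (0::complex) \<eta>" if "x \<in> {-\<eta><..<\<eta>}" for x using that by auto
  \<comment> \<open>in the coordinate \<open>P\<close>, the gradient of \<open>W\<close> is horizontal\<close>
  have W\<psi>: "W (\<psi> w) = \<phi> (Re w)" if w: "w \<in> ball 0 \<eta>" for w
  proof -
    let ?S = "{min 0 (Im w)..max 0 (Im w)}"
    let ?l = "\<lambda>y. Complex (Re w) y"
    have in_ball: "?l y \<in> ball 0 \<eta>" if "y \<in> ?S" for y
    proof -
      have "\<bar>y\<bar> \<le> \<bar>Im w\<bar>" using that by (auto simp: min_def max_def split: if_splits)
      then have "y\<^sup>2 \<le> (Im w)\<^sup>2" by (simp only: abs_le_square_iff)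
      then have "cmod (?l y) \<le> cmod w" by (simp add: cmod_def)
      then show ?thesis using w by simp
    qed
    have const: "\<exists>c. \<forall>y\<in>?S. W (\<psi> (?l y)) = c"
    proof (rule has_field_derivative_zero_constant)
      fix y assume y: "y \<in> ?S"
      have "((\<lambda>y. \<psi> (?l y)) has_vector_derivative \<i> * (1 / q (\<psi> (?l y)))) (at y)"
      proof -
        have "((\<lambda>y. of_real (Re w) + y *\<^sub>R \<i>) has_vector_derivative \<i>) (at y)"
          by (auto intro!: derivative_eq_intros)
        moreover have "?l = (\<lambda>y. of_real (Re w) + y *\<^sub>R \<i>)" by (auto simp: complex_eq_iff)
        ultimately have "(?l has_vector_derivative \<i>) (at y)" by simp
        from field_vector_diff_chain_at[OF this \<psi>d[OF in_ball[OF y]]]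
        show ?thesis by (simp only: o_def)
      qed
      then have "((\<lambda>y. W (\<psi> (?l y))) has_real_derivative 0) (at y)"
        by (rule W_along_curve) (use in_ball[OF y] NB \<psi>N q_nz in auto)
      then show "((\<lambda>y. W (\<psi> (?l y))) has_real_derivative 0) (at y within ?S)"
        by (rule has_field_derivative_at_within)
    qed simp
    have "Im w \<in> ?S" "0 \<in> ?S" by (auto simp: min_def max_def)
    with const have "W (\<psi> (?l (Im w))) = W (\<psi> (?l 0))" by metis
    then show ?thesis by (simp add: \<phi>_def complex_of_real_def)
  qed
  have P_in: "\<forall>\<^sub>F z in nhds a. z \<in> N \<and> P z \<in> ball 0 \<eta>" if "a \<in> N" "P a \<in> ball 0 \<eta>" for a
  proof -
    have "continuous_on N P" using Ph holomorphic_on_imp_continuous_on holomorphic_on_subset r(2) unfolding N_def by blast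
    then have "open (N \<inter> P -` ball 0 \<eta>)"
      by (rule continuous_open_preimage) (auto simp: N_def)
    then have "\<forall>\<^sub>F z in nhds a. z \<in> N \<inter> P -` ball 0 \<eta>"
      using that by (intro eventually_nhds_in_open) auto
    then show ?thesis by (rule eventually_mono) auto
  qed
  have WP: "W z = \<phi> (Re (P z))" if "z \<in> N" "P z \<in> ball 0 \<eta>" for z
    using W\<psi>[OF that(2)] \<psi>(3)[OF that(1)] by simp
  have cont_\<psi>: "isCont (\<lambda>x::real. \<psi> (of_real x)) x" if "x \<in> {-\<eta><..<\<eta>}" for x
    using DERIV_isCont[OF \<psi>d[OF real_in[OF that]]]
    by (intro isCont_o2[of _ of_real \<psi>]) (auto intro: continuous_intros)
  have cont_\<phi>: "continuous_on {-\<eta><..<\<eta>} \<phi>"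
    unfolding \<phi>_def
    by (rule continuous_on_compose2[OF W_continuous])
       (use cont_\<psi> NB \<psi>N real_in in \<open>auto intro!: continuous_at_imp_continuous_on simp del: mem_ball\<close>)
  have dense: "\<exists>p. a < p \<and> p < b \<and> ((\<phi> has_real_derivative 1) (at p) \<or> (\<phi> has_real_derivative -1) (at p))"
    if ab: "-\<eta> \<le> a" "a < b" "b \<le> \<eta>" for a b
  proof -
    define U where "U = N \<inter> P -` (ball 0 \<eta> \<inter> {w. a < Re w} \<inter> {w. Re w < b})"
    have "continuous_on N P" using Ph holomorphic_on_imp_continuous_on holomorphic_on_subset r(2) unfolding N_def by blast
    then have "open U" unfolding U_def
      by (rule continuous_open_preimage) (auto simp: N_def intro!: open_Int open_halfspace_Re_gt open_halfspace_Re_lt)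
    moreover have m: "of_real ((a + b) / 2) \<in> ball (0::complex) \<eta>" using ab by (intro real_in) auto
    then have "\<psi> (of_real ((a + b) / 2)) \<in> U"
      using \<psi>N[OF m] P\<psi>[OF m] ab unfolding U_def by (auto simp del: of_real_divide of_real_add)
    ultimately obtain z where z: "z \<in> U" "z \<notin> msupp \<mu>" using exists_point_off_msupp by blast
    define w where "w = P z"
    define p where "p = Re w"
    have zN: "z \<in> N" and w: "w \<in> ball 0 \<eta>" and p: "a < p" "p < b" using z by (auto simp: U_def w_def p_def)
    have \<psi>w: "\<psi> w = z" using \<psi>(3)[OF zN] by (simp add: w_def)
    obtain \<sigma> d c where \<sigma>: "c = 1 \<or> c = -1" "d > 0" "(\<sigma> has_field_derivative of_real c * q z) (at z)"
      "\<And>w. w \<in> ball z d \<Longrightarrow> W w = Re (\<sigma> w)"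
      by (rule W_off_msupp[OF NB[OF zN] z(2)]) (rule that)
    let ?l = "\<lambda>y. Complex y (Im w)"
    have lp: "?l p = w" by (simp add: p_def)
    have ldef: "?l = (\<lambda>y. Complex 0 (Im w) + y *\<^sub>R 1)" by (auto simp: complex_eq_iff)
    have lvd: "(?l has_vector_derivative 1) (at p)"
      unfolding ldef by (auto intro!: derivative_eq_intros)
    have "(\<psi> has_field_derivative 1 / q z) (at (?l p))" using \<psi>d[OF w] by (simp add: lp \<psi>w)
    with lvd have 1: "((\<lambda>y. \<psi> (?l y)) has_vector_derivative 1 / q z) (at p)"
      using field_vector_diff_chain_at[of ?l 1 p \<psi> "1 / q z"] by (simp add: o_def)
    moreover have "(\<sigma> has_field_derivative of_real c * q z) (at (\<psi> (?l p)))" using \<sigma>(3) by (simp add: lp \<psi>w)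
    ultimately have "((\<lambda>y. \<sigma> (\<psi> (?l y))) has_vector_derivative (1 / q z) * (of_real c * q z)) (at p)"
      using field_vector_diff_chain_at[of "\<lambda>y. \<psi> (?l y)" "1 / q z" p \<sigma> "of_real c * q z"] by (simp add: o_def)
    then have "((\<lambda>y. \<sigma> (\<psi> (?l y))) has_vector_derivative of_real c) (at p)"
      using q_nz[OF zN] by simp
    from bounded_linear.has_vector_derivative[OF bounded_linear_Re this]
    have 2: "((\<lambda>y. Re (\<sigma> (\<psi> (?l y)))) has_real_derivative c) (at p)"
      by (simp add: has_real_derivative_iff_has_vector_derivative)
    have "isCont ?l p" using lvd by (rule has_vector_derivative_continuous)
    then have l_lim: "filterlim ?l (nhds w) (nhds p)"
      using isCont_tendsto_nhds lp by metis
    have "isCont (\<lambda>y. \<psi> (?l y)) p" using 1 by (rule has_vector_derivative_continuous)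
    then have \<psi>l_lim: "filterlim (\<lambda>y. \<psi> (?l y)) (nhds z) (nhds p)"
      using isCont_tendsto_nhds lp \<psi>w by metis
    have ev1: "\<forall>\<^sub>F y in nhds p. ?l y \<in> ball 0 \<eta>"
      using eventually_compose_filterlim[OF eventually_nhds_in_open[OF open_ball w] l_lim] .
    have ev2: "\<forall>\<^sub>F y in nhds p. \<psi> (?l y) \<in> ball z d"
      using \<sigma>(2) by (intro eventually_compose_filterlim[OF eventually_nhds_in_open[OF open_ball] \<psi>l_lim]) simp
    have "\<forall>\<^sub>F y in nhds p. Re (\<sigma> (\<psi> (?l y))) = \<phi> y"
      using ev1 ev2
    proof eventually_elim
      case (elim y)
      then show ?case using W\<psi>[OF elim(1)] \<sigma>(4)[OF elim(2)] by simp
    qed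
    then have "(\<phi> has_real_derivative c) (at p)"
      using 2 by (subst (asm) DERIV_cong_ev[OF refl _ refl]) auto
    then show ?thesis using p \<sigma>(1) by auto
  qed
  \<comment> \<open>by the minimum principle \<open>\<phi>\<close> would have slope \<open>m\<close> on an interval, but its slope is \<open>1\<close> or \<open>-1\<close> somewhere\<close>
  have nomin: "\<not> (\<forall>\<^sub>F y in nhds x. \<phi> x - m * x \<le> \<phi> y - m * y)"
    if m: "m \<noteq> 1" "m \<noteq> -1" and x: "x \<in> {-\<eta><..<\<eta>}" for m x
  proof
    assume min: "\<forall>\<^sub>F y in nhds x. \<phi> x - m * x \<le> \<phi> y - m * y"
    define a where "a = \<psi> (of_real x)"
    have a: "a \<in> N" "P a = of_real x" using \<psi>N P\<psi> real_in[OF x] by (auto simp: a_def)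
    have aB: "a \<in> ball z\<^sub>0 \<rho>" using NB[OF a(1)] .
    define \<tau> where "\<tau> = (\<lambda>z. - (of_real m * P z))"
    have Re\<tau>: "Re (\<tau> z) = - (m * Re (P z))" for z by (simp add: \<tau>_def)
    obtain r1 where r1: "r1 > 0" "ball a r1 \<subseteq> ball z\<^sub>0 \<rho>" using openE[OF open_ball aB] by blast
    have \<tau>h: "\<tau> holomorphic_on ball a r1"
      unfolding \<tau>_def by (intro holomorphic_intros holomorphic_on_subset[OF Ph r1(2)])
    have "isCont (\<lambda>z. Re (P z)) a"
      using DERIV_isCont[OF P[OF aB]] by (rule isCont_Re)
    then have "filterlim (\<lambda>z. Re (P z)) (nhds x) (nhds a)"
      using isCont_tendsto_nhds a(2) Re_complex_of_real by metis
    from eventually_compose_filterlim[OF min this] P_in[OF a(1)] a(2) real_in[OF x]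
    have "\<forall>\<^sub>F z in nhds a. (\<phi> x - m * x \<le> \<phi> (Re (P z)) - m * Re (P z)) \<and> z \<in> N \<and> P z \<in> ball 0 \<eta>"
      by (auto intro: eventually_conj simp del: mem_ball)
    then have "\<forall>\<^sub>F z in nhds a. W a + Re (\<tau> a) \<le> W z + Re (\<tau> z)"
    proof eventually_elim
      case (elim z)
      then show ?case using WP[of z] WP[of a] a real_in[OF x] by (simp add: Re\<tau> del: mem_ball)
    qed
    from W_local_minimum[OF aB r1(1) \<tau>h this]
    have const: "\<forall>\<^sub>F z in nhds a. W z + Re (\<tau> z) = W a + Re (\<tau> a)" .
    have "filterlim (\<lambda>x. \<psi> (of_real x)) (nhds a) (nhds x)"
      using isCont_tendsto_nhds[OF cont_\<psi>[OF x]] unfolding a_def .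
    from eventually_compose_filterlim[OF const this]
    have "\<forall>\<^sub>F y in nhds x. W (\<psi> (of_real y)) + Re (\<tau> (\<psi> (of_real y))) = W a + Re (\<tau> a)" .
    moreover have "\<forall>\<^sub>F y in nhds x. y \<in> {-\<eta><..<\<eta>}" using x by (intro eventually_nhds_in_open) auto
    ultimately have "\<forall>\<^sub>F y in nhds x. y \<in> {-\<eta><..<\<eta>} \<and> \<phi> y = m * y + (\<phi> x - m * x)"
    proof eventually_elim
      case (elim y)
      then show ?case using P\<psi>[OF real_in[OF elim(2)]] a by (simp add: Re\<tau> \<phi>_def a_def)
    qed
    then obtain k where k: "k > 0" "\<And>y. dist y x < k \<Longrightarrow> y \<in> {-\<eta><..<\<eta>} \<and> \<phi> y = m * y + (\<phi> x - m * x)"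
      unfolding eventually_nhds_metric by blast
    have "x + k / 2 \<in> {-\<eta><..<\<eta>}" using k(2)[of "x + k / 2"] k(1) by (simp add: dist_real_def)
    then obtain p where p: "x < p" "p < x + k / 2" "(\<phi> has_real_derivative 1) (at p) \<or> (\<phi> has_real_derivative -1) (at p)"
      using dense[of x "x + k / 2"] x k(1) by auto
    have "\<forall>\<^sub>F y in nhds p. y \<in> {x<..<x + k / 2}" using p by (intro eventually_nhds_in_open) auto
    then have "\<forall>\<^sub>F y in nhds p. m * y + (\<phi> x - m * x) = \<phi> y"
    proof eventually_elim
      case (elim y)
      then have "dist y x < k" using k(1) by (simp add: dist_real_def)
      from k(2)[OF this] show ?case by metis
    qed
    moreover have "((\<lambda>y. m * y + (\<phi> x - m * x)) has_real_derivative m) (at p)"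
      by (auto intro!: derivative_eq_intros)
    ultimately have "(\<phi> has_real_derivative m) (at p)"
      by (subst (asm) DERIV_cong_ev[OF refl _ refl]) auto
    then show False using p(3) m DERIV_unique by blast
  qed
  have not_affine: False
    if a: "a \<in> N" "P a \<in> ball 0 \<eta>" "a \<in> msupp \<mu>" and c: "\<forall>\<^sub>F x in nhds (Re (P a)). \<phi> x = C + c * x" for a c C
  proof -
    have aB: "a \<in> ball z\<^sub>0 \<rho>" using NB[OF a(1)] .
    obtain r1 where r1: "r1 > 0" "ball a r1 \<subseteq> ball z\<^sub>0 \<rho>" using openE[OF open_ball aB] by blast
    have "isCont (\<lambda>z. Re (P z)) a"
      using DERIV_isCont[OF P[OF aB]] by (rule isCont_Re)
    then have "filterlim (\<lambda>z. Re (P z)) (nhds (Re (P a))) (nhds a)"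
      by (rule isCont_tendsto_nhds)
    from eventually_conj[OF eventually_compose_filterlim[OF c this] P_in[OF a(1,2)]]
    obtain r2 where r2: "r2 > 0" "\<And>z. dist z a < r2 \<Longrightarrow> \<phi> (Re (P z)) = C + c * Re (P z) \<and> z \<in> N \<and> P z \<in> ball 0 \<eta>"
      unfolding eventually_nhds_metric by blast
    have "a \<notin> msupp \<mu>"
    proof (rule W_eq_Re_imp_not_in_msupp[OF aB])
      show "min r1 r2 > 0" using r1 r2 by simp
      show "(\<lambda>z. of_real C + of_real c * P z) holomorphic_on ball a (min r1 r2)"
        by (intro holomorphic_intros holomorphic_on_subset[OF Ph]) (use r1(2) in auto)
      show "W w = Re (of_real C + of_real c * P w)" if "w \<in> ball a (min r1 r2)" for w
        using r2(2)[of w] WP[of w] that by (simp add: dist_commute)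
    qed
    with a(3) show False by blast
  qed
  have z0N: "z\<^sub>0 \<in> N" "P z\<^sub>0 \<in> ball 0 \<eta>" using r(1) \<eta>(1) Pz by (auto simp: N_def)
  have peak: "\<phi> x = \<phi> 0 - \<bar>x\<bar>" if "\<bar>x\<bar> < \<eta>" for x
  proof -
    have "\<not> (\<exists>c k. (c = 1 \<or> c = -1) \<and> k > 0 \<and> (\<forall>x. \<bar>x\<bar> < k \<longrightarrow> \<phi> x = \<phi> 0 + c * x))"
    proof
      assume "\<exists>c k. (c = 1 \<or> c = -1) \<and> k > 0 \<and> (\<forall>x. \<bar>x\<bar> < k \<longrightarrow> \<phi> x = \<phi> 0 + c * x)"
      then obtain c k where k: "k > 0" "\<And>x. \<bar>x\<bar> < k \<Longrightarrow> \<phi> x = \<phi> 0 + c * x" by blast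
      have "\<forall>\<^sub>F x in nhds (Re (P z\<^sub>0)). \<phi> x = \<phi> 0 + c * x"
        unfolding eventually_nhds_metric Pz
      proof (intro exI[of _ k] conjI allI impI)
        fix x assume "dist x (Re 0) < k"
        then have "\<bar>x\<bar> < k" by (simp add: dist_real_def)
        then show "\<phi> x = \<phi> 0 + c * x" by (rule k(2))
      qed (rule k(1))
      then show False using not_affine[OF z0N supp] by blast
    qed
    then show ?thesis
      using affine_or_peak[OF \<eta>(1) cont_\<phi> nomin dense] that by blast
  qed
  obtain d where d: "d > 0" "\<And>z. dist z z\<^sub>0 < d \<Longrightarrow> z \<in> N \<and> P z \<in> ball 0 \<eta>"
    using P_in[OF z0N] unfolding eventually_nhds_metric by blast
  show thesis
  proof (rule that[of d P])
    fix w assume "w \<in> ball z\<^sub>0 d"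
    then have w: "w \<in> N" "P w \<in> ball 0 \<eta>" using d(2)[of w] by (auto simp: dist_commute)
    have "\<bar>Re (P w)\<bar> < \<eta>" using w(2) abs_Re_le_cmod[of "P w"] by simp
    then show "W w = W z\<^sub>0 - \<bar>Re (P w)\<bar>"
      using WP[OF w] peak[of "Re (P w)"] by (simp add: \<phi>_def \<psi>0)
    assume ws: "w \<in> msupp \<mu>"
    show "Re (P w) = 0"
    proof (rule ccontr)
      assume nz: "Re (P w) \<noteq> 0"
      define x where "x = Re (P w)"
      have "\<forall>\<^sub>F y in nhds x. \<phi> y = \<phi> 0 + (- sgn x) * y"
        unfolding eventually_nhds_metric
      proof (intro exI[of _ "min \<bar>x\<bar> (\<eta> - \<bar>x\<bar>)"] conjI allI impI)
        show "min \<bar>x\<bar> (\<eta> - \<bar>x\<bar>) > 0" using nz \<open>\<bar>Re (P w)\<bar> < \<eta>\<close> by (simp add: x_def)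
        fix y assume "dist y x < min \<bar>x\<bar> (\<eta> - \<bar>x\<bar>)"
        then have y: "\<bar>y - x\<bar> < \<bar>x\<bar>" "\<bar>y\<bar> < \<eta>" by (auto simp: dist_real_def)
        then have "\<bar>y\<bar> = sgn x * y" by (auto simp: sgn_if abs_if split: if_splits)
        then show "\<phi> y = \<phi> 0 + (- sgn x) * y" using peak[OF y(2)] by simp
      qed
      then show False using not_affine[OF w ws] unfolding x_def by blast
    qed
  qed (use d Pz P[OF z0] in auto)
qed

text \<open>
  If \<open>q\<close> vanishes, so does the gradient of \<open>W\<close>. On a roof the slope in the direction \<open>n\<close> is
  \<open>- \<bar>Re (q n)\<bar>\<close>, an even function of \<open>n\<close>.
\<close>
lemma W_onesided_derivatives:
  assumes supp: "z\<^sub>0 \<in> msupp \<mu>"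
  shows "\<exists>d. has_onesided_derivative W z\<^sub>0 n d \<and> has_onesided_derivative W z\<^sub>0 (- n) d"
proof (cases "q z\<^sub>0 = 0")
  case True
  have "has_onesided_derivative W z\<^sub>0 m 0" for m
  proof -
    have "((\<lambda>t. z\<^sub>0 + t *\<^sub>R m) has_vector_derivative m) (at 0)"
      by (auto intro!: derivative_eq_intros)
    then have "((\<lambda>t. W (z\<^sub>0 + t *\<^sub>R m)) has_real_derivative 0) (at 0)"
      by (rule W_along_curve) (use rho True in auto)
    then show ?thesis unfolding has_onesided_derivative_def by (rule has_field_derivative_at_within)
  qed
  then show ?thesis by blast
next
  case False
  obtain P d where P: "d > 0" "P z\<^sub>0 = 0" "(P has_field_derivative q z\<^sub>0) (at z\<^sub>0)"
    "\<And>w. w \<in> ball z\<^sub>0 d \<Longrightarrow> W w = W z\<^sub>0 - \<bar>Re (P w)\<bar>"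
    using W_roof[OF False supp] by metis
  have "has_onesided_derivative W z\<^sub>0 m (- \<bar>Re (q z\<^sub>0 * m)\<bar>)" for m
  proof -
    have "((\<lambda>t. z\<^sub>0 + t *\<^sub>R m) has_vector_derivative m) (at 0)"
      by (auto intro!: derivative_eq_intros)
    then have "((\<lambda>t. P (z\<^sub>0 + t *\<^sub>R m)) has_vector_derivative m * q z\<^sub>0) (at 0)"
      using field_vector_diff_chain_at[of "\<lambda>t. z\<^sub>0 + t *\<^sub>R m" m 0 P "q z\<^sub>0"] P(3) by (simp add: o_def)
    from bounded_linear.has_vector_derivative[OF bounded_linear_Re this]
    have "((\<lambda>t. Re (P (z\<^sub>0 + t *\<^sub>R m))) has_real_derivative Re (q z\<^sub>0 * m)) (at 0)"
      by (simp add: has_real_derivative_iff_has_vector_derivative mult.commute)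
    then have "((\<lambda>t. Re (P (z\<^sub>0 + t *\<^sub>R m)) / t) \<longlongrightarrow> Re (q z\<^sub>0 * m)) (at_right 0)"
      using P(2) by (simp add: has_field_derivative_iff filterlim_at_split)
    then have lim: "((\<lambda>t. - \<bar>Re (P (z\<^sub>0 + t *\<^sub>R m)) / t\<bar>) \<longlongrightarrow> - \<bar>Re (q z\<^sub>0 * m)\<bar>) (at_right 0)"
      by (intro tendsto_intros)
    have "isCont (\<lambda>t. z\<^sub>0 + t *\<^sub>R m) 0" by (intro continuous_intros)
    then have "\<forall>\<^sub>F t in at_right 0. z\<^sub>0 + t *\<^sub>R m \<in> ball z\<^sub>0 d"
      using P(1) unfolding isCont_def
      by (intro topological_tendstoD[OF tendsto_mono[OF at_le[of "{0<..}" UNIV]]]) auto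
    moreover have "\<forall>\<^sub>F t in at_right 0. (0::real) < t" by (simp add: eventually_at_right_less)
    ultimately have "\<forall>\<^sub>F t in at_right 0. - \<bar>Re (P (z\<^sub>0 + t *\<^sub>R m)) / t\<bar> = (W (z\<^sub>0 + t *\<^sub>R m) - W (z\<^sub>0 + 0 *\<^sub>R m)) / (t - 0)"
      by eventually_elim (simp add: P(4) abs_divide)
    from Lim_transform_eventually[OF lim this]
    show ?thesis unfolding has_onesided_derivative_def has_field_derivative_iff .
  qed
  note der = this
  have "\<bar>Re (q z\<^sub>0 * - n)\<bar> = \<bar>Re (q z\<^sub>0 * n)\<bar>"
    by (simp only: mult_minus_right uminus_complex.simps abs_minus_cancel)
  then show ?thesis using der[of n] der[of "- n"] by metis
qed

lemma W_flat_on_msupp: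
  assumes supp: "z\<^sub>0 \<in> msupp \<mu>" and \<epsilon>: "\<epsilon> > 0"
  shows "\<forall>\<^sub>F w in nhds z\<^sub>0. w \<in> msupp \<mu> \<longrightarrow> \<bar>W w - W z\<^sub>0\<bar> \<le> \<epsilon> * cmod (w - z\<^sub>0)"
proof (cases "q z\<^sub>0 = 0")
  case True
  then show ?thesis using W_near[of z\<^sub>0 \<epsilon>] rho \<epsilon> by (auto elim: eventually_mono)
next
  case False
  obtain P d where P: "d > 0" "\<And>w. w \<in> ball z\<^sub>0 d \<Longrightarrow> W w = W z\<^sub>0 - \<bar>Re (P w)\<bar>"
    "\<And>w. w \<in> ball z\<^sub>0 d \<Longrightarrow> w \<in> msupp \<mu> \<Longrightarrow> Re (P w) = 0"
    using W_roof[OF False supp] by metis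
  have "\<forall>\<^sub>F w in nhds z\<^sub>0. w \<in> ball z\<^sub>0 d" using P(1) by (intro eventually_nhds_in_open) auto
  then show ?thesis
  proof eventually_elim
    case (elim w)
    show ?case
    proof
      assume "w \<in> msupp \<mu>"
      then have "W w - W z\<^sub>0 = 0" using P(2)[OF elim] P(3)[OF elim] by simp
      then show "\<bar>W w - W z\<^sub>0\<bar> \<le> \<epsilon> * cmod (w - z\<^sub>0)" using \<epsilon> by simp
    qed
  qed
qed

end


section \<open>The square root provided by the algebraic equation\<close>

lemma cubic_solutions_vieta:
  assumes "cubic_solutions R d a b c"
  shows "a + b + c = 0" and "(a - b)\<^sup>2 = 4 * R - 3 * c\<^sup>2"
proof -
  have id: "X ^ 3 - R * X + d = (X - a) * (X - b) * (X - c)" for X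
    using assms by (simp add: cubic_solutions_def)
  show sum: "a + b + c = 0"
    using id[of 0] id[of 1] id[of "-1"] by simp algebra
  show "(a - b)\<^sup>2 = 4 * R - 3 * c\<^sup>2"
    using id[of 0] id[of 1] id[of "-1"] sum by simp algebra
qed

lemma cubic_solutions_root: "cubic_solutions R d a b c \<Longrightarrow> X ^ 3 - R * X + d = 0 \<longleftrightarrow> X = a \<or> X = b \<or> X = c"
  by (simp add: cubic_solutions_def)

text \<open>
  The branch \<open>h\<close> that meets \<open>r\<close> infinitely often near \<open>z\<close> coincides with it, and by Vieta half the
  difference of the other two branches is a square root of the right-hand side. It has no pole since
  its square has a finite limit.
\<close>
lemma square_root_at_regular_point:
  assumes mero: "f meromorphic_on {z}" "g meromorphic_on {z}" "h meromorphic_on {z}"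
    and sol: "\<forall>\<^sub>F w in at z. cubic_solutions (poly R w) (D w) (f w) (g w) (h w)"
    and r: "r analytic_on {z}" and freq: "\<exists>\<^sub>F w in at z. r w = h w"
  obtains q where "q analytic_on {z}" "\<forall>\<^sub>F w in nhds z. (q w)\<^sup>2 = poly R w - 3 / 4 * (r w)\<^sup>2"
proof -
  have "r meromorphic_on {z}" using r by (rule analytic_on_imp_meromorphic_on)
  then have "(\<lambda>w. r w - h w) meromorphic_on {z}"
    using mero(3) by (intro meromorphic_intros)
  moreover have "\<exists>\<^sub>F w in at z. r w - h w = 0" using freq by simp
  ultimately have "\<forall>\<^sub>F w in at z. r w - h w = 0"
    by (intro not_essential_frequently_0_imp_eventually_0 meromorphic_on_isolated_singularity meromorphic_on_not_essential)
  with sol have sq: "\<forall>\<^sub>F w in at z. ((f w - g w) / 2)\<^sup>2 = poly R w - 3 / 4 * (r w)\<^sup>2"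
  proof eventually_elim
    case (elim w)
    then show ?case using cubic_solutions_vieta(2)[OF elim(1)] by (simp add: power_divide)
  qed
  let ?q = "\<lambda>w. (f w - g w) / 2" and ?T = "\<lambda>w. poly R w - 3 / 4 * (r w)\<^sup>2"
  have qm: "?q meromorphic_on {z}" using mero by (intro meromorphic_intros) auto
  have "isCont r z" using r by (rule analytic_at_imp_isCont)
  then have contT: "isCont ?T z" by (intro continuous_intros) auto
  then have limT: "?T \<midarrow>z\<rightarrow> ?T z" by (simp add: isCont_def)
  have lim2: "(\<lambda>w. (?q w)\<^sup>2) \<midarrow>z\<rightarrow> ?T z"
    by (rule Lim_transform_eventually[OF limT]) (use sq in \<open>auto elim: eventually_mono\<close>)
  have "\<not> is_pole ?q z"
  proof
    assume "is_pole ?q z"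
    then have "filterlim (\<lambda>w. (?q w)\<^sup>2) at_infinity (at z)"
      unfolding is_pole_def power2_eq_square using filterlim_at_infinity_times by blast
    with lim2 show False using not_tendsto_and_filterlim_at_infinity[of "at z"] by auto
  qed
  then obtain c where c: "?q \<midarrow>z\<rightarrow> c"
    using meromorphic_on_not_essential[OF qm] unfolding not_essential_def by blast
  have iso: "isolated_singularity_at ?q z" using qm by (rule meromorphic_on_isolated_singularity)
  show thesis
  proof (rule that)
    show "remove_sings ?q analytic_on {z}" by (rule remove_sings_analytic_at[OF iso c])
    have "remove_sings ?q z = c" using c by (rule remove_sings_eqI)
    moreover have "c\<^sup>2 = ?T z"
      using tendsto_power[OF c, of 2] lim2 by (intro tendsto_unique[of "at z"]) auto
    ultimately have at_z: "(remove_sings ?q z)\<^sup>2 = ?T z" by simp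
    have "\<forall>\<^sub>F w in at z. (remove_sings ?q w)\<^sup>2 = ?T w"
      using eventually_remove_sings_eq_at[OF iso] sq by eventually_elim (simp only:)
    then show "\<forall>\<^sub>F w in nhds z. (remove_sings ?q w)\<^sup>2 = ?T w"
      unfolding eventually_at_filter
    proof eventually_elim
      case (elim w)
      then show ?case using at_z by (cases "w = z") blast+
    qed
  qed
qed

text \<open>
  Away from the finitely many poles of \<open>D\<close>, continuity makes \<open>r\<close> a root at every point, so near \<open>z\<close> it
  takes one of three values; one of the three branches must then be met infinitely often.
\<close>
lemma square_root_off_branch_points:
  assumes rho: "\<rho> > 0" and r: "r holomorphic_on ball z \<rho>"
    and D: "rational_poles_le2 D"
    and root: "AE w in lborel. w \<in> ball z \<rho> \<longrightarrow> r w ^ 3 - poly R w * r w + D w = 0"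
    and nb: "\<not> branch_point R D z"
  obtains q \<rho>' where "0 < \<rho>'" "\<rho>' \<le> \<rho>" "q holomorphic_on ball z \<rho>'"
    "\<And>w. w \<in> ball z \<rho>' \<Longrightarrow> (q w)\<^sup>2 = poly R w - 3 / 4 * (r w)\<^sup>2"
proof -
  obtain A B where AB: "B \<noteq> 0" "D = (\<lambda>w. poly A w / poly B w)"
    using D unfolding rational_poles_le2_def by blast
  define U where "U = ball z \<rho> - {w. poly B w = 0}"
  have fin: "finite {w. poly B w = 0}" using AB(1) by (rule poly_roots_finite)
  have U: "open U" unfolding U_def by (intro open_Diff open_ball finite_imp_closed fin)
  let ?h = "\<lambda>w. r w ^ 3 - poly R w * r w + D w"
  have cont: "continuous_on U ?h"
    unfolding AB(2) by (intro continuous_intros continuous_on_subset[OF holomorphic_on_imp_continuous_on[OF r]])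
      (auto simp: U_def)
  have root': "?h w = 0" if "w \<in> U" for w
    by (rule continuous_AE_zero[OF U cont _ that]) (use root in \<open>auto elim!: eventually_mono simp: U_def\<close>)
  have "\<forall>\<^sub>F w in at z. w \<in> ball z \<rho>" using rho by (intro eventually_at_in_open') auto
  moreover have "\<forall>\<^sub>F w in at z. w \<notin> {w. poly B w = 0} - {z}"
  proof -
    have "open (- ({w. poly B w = 0} - {z}))" using fin by (intro open_Compl finite_imp_closed) auto
    then have "\<forall>\<^sub>F w in at z. w \<in> - ({w. poly B w = 0} - {z})" by (rule eventually_at_in_open') simp
    then show ?thesis by (rule eventually_mono) auto
  qed
  ultimately have inU: "\<forall>\<^sub>F w in at z. w \<in> U"
    unfolding eventually_at_filter by eventually_elim (auto simp: U_def)
  obtain f g h where fgh: "f meromorphic_on {z}" "g meromorphic_on {z}" "h meromorphic_on {z}"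
    and sol: "\<forall>\<^sub>F w in at z. cubic_solutions (poly R w) (D w) (f w) (g w) (h w)"
    using nb unfolding branch_point_def by blast
  have "\<forall>\<^sub>F w in at z. r w = f w \<or> r w = g w \<or> r w = h w"
    using inU sol
  proof eventually_elim
    case (elim w)
    then show ?case using root'[OF elim(1)] cubic_solutions_root[OF elim(2)] by blast
  qed
  then have "\<exists>\<^sub>F w in at z. r w = f w \<or> r w = g w \<or> r w = h w"
    by (intro eventually_frequently) auto
  then have freq: "(\<exists>\<^sub>F w in at z. r w = f w) \<or> (\<exists>\<^sub>F w in at z. r w = g w) \<or> (\<exists>\<^sub>F w in at z. r w = h w)"
    by (simp add: frequently_disj_iff)
  have sol': "\<forall>\<^sub>F w in at z. cubic_solutions (poly R w) (D w) (g w) (h w) (f w)"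
    "\<forall>\<^sub>F w in at z. cubic_solutions (poly R w) (D w) (f w) (h w) (g w)"
    using sol by (auto elim!: eventually_mono simp: cubic_solutions_def mult_ac)
  have ra: "r analytic_on {z}" using r rho by (intro holomorphic_on_imp_analytic_at[OF r]) auto
  obtain q where q: "q analytic_on {z}" "\<forall>\<^sub>F w in nhds z. (q w)\<^sup>2 = poly R w - 3 / 4 * (r w)\<^sup>2"
    using freq
  proof (elim disjE)
    assume "\<exists>\<^sub>F w in at z. r w = f w"
    then show thesis by (rule square_root_at_regular_point[OF fgh(2,3,1) sol'(1) ra]) (rule that)
  next
    assume "\<exists>\<^sub>F w in at z. r w = g w"
    then show thesis by (rule square_root_at_regular_point[OF fgh(1,3,2) sol'(2) ra]) (rule that)
  next
    assume "\<exists>\<^sub>F w in at z. r w = h w"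
    then show thesis by (rule square_root_at_regular_point[OF fgh sol ra]) (rule that)
  qed
  obtain \<rho>1 where \<rho>1: "\<rho>1 > 0" "q holomorphic_on ball z \<rho>1" using q(1) by (auto simp: analytic_on_def)
  obtain \<rho>2 where \<rho>2: "\<rho>2 > 0" "\<And>w. dist w z < \<rho>2 \<Longrightarrow> (q w)\<^sup>2 = poly R w - 3 / 4 * (r w)\<^sup>2"
    using q(2) unfolding eventually_nhds_metric by blast
  show thesis
  proof (rule that[of "min \<rho> (min \<rho>1 \<rho>2)" q])
    show "q holomorphic_on ball z (min \<rho> (min \<rho>1 \<rho>2))" using \<rho>1(2) by (rule holomorphic_on_subset) auto
    show "(q w)\<^sup>2 = poly R w - 3 / 4 * (r w)\<^sup>2" if "w \<in> ball z (min \<rho> (min \<rho>1 \<rho>2))" for w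
      using that by (intro \<rho>2(2)) (auto simp: dist_commute)
  qed (use rho \<rho>1 \<rho>2 in auto)
qed

lemma has_onesided_derivative_cong:
  assumes "\<forall>\<^sub>F w in nhds z. f w = g w" "has_onesided_derivative f z n d"
  shows "has_onesided_derivative g z n d"
proof -
  have "((\<lambda>t. z + t *\<^sub>R n) \<longlongrightarrow> z + 0 *\<^sub>R n) (at_right 0)" by (intro tendsto_intros)
  then have "((\<lambda>t. z + t *\<^sub>R n) \<longlongrightarrow> z) (at_right 0)" by simp
  from eventually_compose_filterlim[OF assms(1) this]
  have "\<forall>\<^sub>F t in at_right 0. f (z + t *\<^sub>R n) = g (z + t *\<^sub>R n)" .
  moreover have "f z = g z" using assms(1) by (rule eventually_nhds_x_imp_x)
  ultimately show ?thesis
    using assms(2) unfolding has_onesided_derivative_def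
    by (subst (asm) has_field_derivative_cong_eventually) auto
qed

section \<open>Equilibrium and \<open>S\<close>-property\<close>

text \<open>
  The index \<open>j\<close> of the measure under consideration and the two others \<open>k\<close>, \<open>l\<close> are kept abstract, so
  that the three cases differ only in coefficients: \<open>a\<close>, \<open>b\<close> are entries of the interaction matrix,
  while \<open>p\<close>, \<open>c\<close>, \<open>d\<close> describe the solution of the algebraic equation that does not involve \<open>\<mu> j\<close>.
  The last conclusion says that the derivative of \<open>V\<close> along the support vanishes, without
  assuming that the support is a curve.
\<close>
lemma equilibrium_and_S_property_at_point:
  fixes \<mu> :: "3 \<Rightarrow> complex measure"
  assumes pm: "plane_measure (\<mu> j)" "plane_measure (\<mu> k)" "plane_measure (\<mu> l)"
    and null: "msupp (\<mu> j) \<in> null_sets lborel"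
    and z: "z \<in> msupp (\<mu> j)" "z \<notin> msupp (\<mu> k)" "z \<notin> msupp (\<mu> l)"
    and total: "\<And>w. total_potential \<Phi> \<mu> j w = log_potential (\<mu> j) w + ereal a * log_potential (\<mu> k) w
        + ereal b * log_potential (\<mu> l) w + ereal (ext_field \<Phi> j w / 2)"
    and D: "rational_poles_le2 D" and nb: "\<not> branch_point R D z"
    and sol: "AE w in lborel. \<exists>x y. cubic_solutions (poly R w) (D w) x y
          (poly p w + of_real c * cauchy_transform (\<mu> k) w + of_real d * cauchy_transform (\<mu> l) w)
        \<and> x - y = 2 * (cauchy_transform (\<mu> j) w + of_real a * cauchy_transform (\<mu> k) w
            + of_real b * cauchy_transform (\<mu> l) w + poly (pderiv (\<Phi> j)) w / 2)"
  defines "V \<equiv> \<lambda>w. real_of_ereal (total_potential \<Phi> \<mu> j w)"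
  shows "total_potential \<Phi> \<mu> j z = ereal (V z)"
    and "\<exists>d. has_onesided_derivative V z n d \<and> has_onesided_derivative V z (- n) d"
    and "\<And>\<epsilon>. \<epsilon> > 0 \<Longrightarrow> \<forall>\<^sub>F w in nhds z. w \<in> msupp (\<mu> j) \<longrightarrow> \<bar>V w - V z\<bar> \<le> \<epsilon> * cmod (w - z)"
proof -
  interpret J: plane_measure "\<mu> j" by fact
  interpret K: plane_measure "\<mu> k" by fact
  interpret L: plane_measure "\<mu> l" by fact
  have far: "\<exists>d>0. (\<forall>w\<in>ball z d. plane_measure.finite_potential M w \<and> cauchy_transform M w = plane_measure.cauchy M w)
      \<and> (\<exists>\<sigma>. \<forall>w\<in>ball z d. (\<sigma> has_field_derivative plane_measure.cauchy M w) (at w)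
          \<and> plane_measure.potential M w = Re (\<sigma> w))"
    if M: "plane_measure M" "z \<notin> msupp M" for M
  proof -
    interpret M: plane_measure M by fact
    obtain r where r: "r > 0" and far: "\<And>x w. x \<in> msupp M \<Longrightarrow> w \<in> ball z r \<Longrightarrow> r \<le> cmod (x - w)"
      using M.far_from_msupp[OF M(2)] by blast
    have "M.finite_potential w \<and> cauchy_transform M w = M.cauchy w" if "w \<in> ball z r" for w
      using M.finite_potential_off_msupp[OF r] M.cauchy_transform_eq[OF M.integrable_inverse_off_msupp[OF r]] far that by blast
    moreover have "\<exists>\<sigma>. \<forall>w\<in>ball z r. (\<sigma> has_field_derivative M.cauchy w) (at w) \<and> M.potential w = Re (\<sigma> w)"
      by (rule M.potential_eq_Re_holomorphic[OF convex_ball open_ball r far])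
    ultimately show ?thesis using r by blast
  qed
  obtain d1 \<sigma>k where k: "d1 > 0" "\<And>w. w \<in> ball z d1 \<Longrightarrow> K.finite_potential w \<and> cauchy_transform (\<mu> k) w = K.cauchy w"
    "\<And>w. w \<in> ball z d1 \<Longrightarrow> (\<sigma>k has_field_derivative K.cauchy w) (at w)"
    "\<And>w. w \<in> ball z d1 \<Longrightarrow> K.potential w = Re (\<sigma>k w)"
    using far[OF pm(2) z(2)] by blast
  obtain d2 \<sigma>l where l: "d2 > 0" "\<And>w. w \<in> ball z d2 \<Longrightarrow> L.finite_potential w \<and> cauchy_transform (\<mu> l) w = L.cauchy w"
    "\<And>w. w \<in> ball z d2 \<Longrightarrow> (\<sigma>l has_field_derivative L.cauchy w) (at w)"
    "\<And>w. w \<in> ball z d2 \<Longrightarrow> L.potential w = Re (\<sigma>l w)"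
    using far[OF pm(3) z(3)] by blast
  define \<rho> where "\<rho> = min d1 d2"
  have \<rho>: "\<rho> > 0" "ball z \<rho> \<subseteq> ball z d1" "ball z \<rho> \<subseteq> ball z d2" using k(1) l(1) by (auto simp: \<rho>_def)
  have kh: "K.cauchy holomorphic_on ball z \<rho>"
    by (rule holomorphic_on_subset[OF holomorphic_primitive(2)[OF open_ball k(3)] \<rho>(2)])
  have lh: "L.cauchy holomorphic_on ball z \<rho>"
    by (rule holomorphic_on_subset[OF holomorphic_primitive(2)[OF open_ball l(3)] \<rho>(3)])
  define r where "r = (\<lambda>w. poly p w + of_real c * K.cauchy w + of_real d * L.cauchy w)"
  define e where "e = (\<lambda>w. of_real a * K.cauchy w + of_real b * L.cauchy w + poly (pderiv (\<Phi> j)) w / 2)"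
  define s where "s = (\<lambda>w. of_real a * \<sigma>k w + of_real b * \<sigma>l w + poly (\<Phi> j) w / 2)"
  have rh: "r holomorphic_on ball z \<rho>"
    unfolding r_def by (intro holomorphic_intros kh lh)
  have sd: "(s has_field_derivative e w) (at w)" if "w \<in> ball z \<rho>" for w
    unfolding s_def e_def using k(3)[of w] l(3)[of w] that \<rho>
    by (auto intro!: derivative_eq_intros poly_DERIV simp: subset_iff)
  have AE: "AE w in lborel. w \<in> ball z \<rho> \<longrightarrow> r w ^ 3 - poly R w * r w + D w = 0
      \<and> (J.cauchy w + e w)\<^sup>2 = poly R w - 3 / 4 * (r w)\<^sup>2"
    using sol J.AE_integrable_inverse
  proof eventually_elim
    case (elim w)
    show ?case
    proof
      assume w: "w \<in> ball z \<rho>"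
      obtain x y where xy: "cubic_solutions (poly R w) (D w) x y (r w)" "x - y = 2 * (J.cauchy w + e w)"
        using elim(1) k(2)[of w] l(2)[of w] w \<rho> J.cauchy_transform_eq[OF elim(2)]
        unfolding r_def e_def by (auto simp: add.assoc subset_iff)
      have "r w ^ 3 - poly R w * r w + D w = 0" using cubic_solutions_root[OF xy(1)] by blast
      moreover have "(2 * (J.cauchy w + e w))\<^sup>2 = 4 * poly R w - 3 * (r w)\<^sup>2"
        using cubic_solutions_vieta(2)[OF xy(1)] unfolding xy(2) .
      then have "4 * (J.cauchy w + e w)\<^sup>2 = 4 * poly R w - 3 * (r w)\<^sup>2"
        unfolding power_mult_distrib by simp
      then have "(J.cauchy w + e w)\<^sup>2 = (4 * poly R w - 3 * (r w)\<^sup>2) / 4"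
        by (simp add: eq_divide_eq mult.commute)
      then have "(J.cauchy w + e w)\<^sup>2 = poly R w - 3 / 4 * (r w)\<^sup>2"
        by (simp add: diff_divide_distrib)
      ultimately show "r w ^ 3 - poly R w * r w + D w = 0
        \<and> (J.cauchy w + e w)\<^sup>2 = poly R w - 3 / 4 * (r w)\<^sup>2" by blast
    qed
  qed
  obtain q \<rho>' where q: "0 < \<rho>'" "\<rho>' \<le> \<rho>" "q holomorphic_on ball z \<rho>'"
    "\<And>w. w \<in> ball z \<rho>' \<Longrightarrow> (q w)\<^sup>2 = poly R w - 3 / 4 * (r w)\<^sup>2"
    by (rule square_root_off_branch_points[OF \<rho>(1) rh D _ nb]) (use AE in \<open>auto elim: eventually_mono\<close>)
  interpret T: two_valued_gradient "\<mu> j" z \<rho>' e s q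
  proof
    show "AE \<zeta> in lborel. \<zeta> \<in> ball z \<rho>' \<longrightarrow> (J.cauchy \<zeta> + e \<zeta>)\<^sup>2 = (q \<zeta>)\<^sup>2"
      using AE
    proof eventually_elim
      case (elim w)
      then show ?case using q(2) q(4)[of w] by auto
    qed
  qed (use q null sd in auto)
  have tot: "total_potential \<Phi> \<mu> j w = ereal (T.W w)" if w: "w \<in> ball z \<rho>'" for w
  proof -
    have w': "w \<in> ball z d1" "w \<in> ball z d2" using w q(2) by (auto simp: \<rho>_def)
    have "log_potential (\<mu> j) w = ereal (J.potential w)"
      by (rule J.log_potential_eq[OF T.finite_potential_ball[OF w]])
    moreover have "log_potential (\<mu> k) w = ereal (Re (\<sigma>k w))" "log_potential (\<mu> l) w = ereal (Re (\<sigma>l w))"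
      using K.log_potential_eq L.log_potential_eq k(2,4)[OF w'(1)] l(2,4)[OF w'(2)] by auto
    moreover have "T.W w = J.potential w + Re (s w)" by (rule T.W_def)
    ultimately show ?thesis
      unfolding total by (simp add: s_def ext_field_def)
  qed
  have VW: "V w = T.W w" if "w \<in> ball z \<rho>'" for w using tot[OF that] by (simp add: V_def)
  have zb: "z \<in> ball z \<rho>'" using q(1) by simp
  show "total_potential \<Phi> \<mu> j z = ereal (V z)" using tot[OF zb] VW[OF zb] by simp
  have ev: "\<forall>\<^sub>F w in nhds z. T.W w = V w"
    using eventually_nhds_in_open[OF open_ball zb] by eventually_elim (simp add: VW)
  show "\<exists>d. has_onesided_derivative V z n d \<and> has_onesided_derivative V z (- n) d"
    using T.W_onesided_derivatives[OF z(1), of n] has_onesided_derivative_cong[OF ev] by blast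
  show "\<forall>\<^sub>F w in nhds z. w \<in> msupp (\<mu> j) \<longrightarrow> \<bar>V w - V z\<bar> \<le> \<epsilon> * cmod (w - z)" if "\<epsilon> > 0" for \<epsilon>
    using T.W_flat_on_msupp[OF z(1) that] ev
  proof eventually_elim
    case (elim w)
    then show ?case using VW[OF zb] by simp
  qed
qed

lemma constant_along_arc:
  assumes \<gamma>: "analytic_parametrization \<gamma> \<Sigma>"
    and flat: "\<And>z \<epsilon>. z \<in> \<Sigma> \<Longrightarrow> \<epsilon> > 0 \<Longrightarrow> \<forall>\<^sub>F w in nhds z. w \<in> \<Sigma> \<longrightarrow> \<bar>V w - V z\<bar> \<le> \<epsilon> * cmod (w - z)"
  shows "\<exists>l::real. \<forall>z\<in>\<Sigma>. V z = l"
proof -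
  let ?g = "\<lambda>t::real. \<gamma> (of_real t)"
  have an: "\<gamma> analytic_on (complex_of_real ` {0<..<1})" using \<gamma> by (simp add: analytic_parametrization_def)
  have im: "\<Sigma> = ?g ` {0<..<1}"
    using \<gamma> unfolding analytic_parametrization_def homeomorphism_def by (auto simp: image_image)
  have "\<exists>l. \<forall>t\<in>{0<..<1}. V (?g t) = l"
  proof (rule has_field_derivative_zero_constant)
    fix t :: real assume t: "t \<in> {0<..<1}"
    have "\<gamma> field_differentiable at (of_real t)"
      using analytic_on_imp_differentiable_at[OF an] t by blast
    then have "(\<gamma> has_field_derivative deriv \<gamma> (of_real t)) (at (of_real t))"
      by (simp add: DERIV_deriv_iff_field_differentiable)
    then have gd: "(?g has_vector_derivative deriv \<gamma> (of_real t)) (at t)"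
      using has_vector_derivative_real_field[of \<gamma> _ t UNIV] by simp
    have "((\<lambda>t. V (?g t)) has_real_derivative 0) (at t)"
    proof (rule zero_derivative_along_curve[OF gd, of 0 \<Sigma>])
      have "\<forall>\<^sub>F u in nhds t. u \<in> {0<..<1}" using t by (intro eventually_nhds_in_open) auto
      then show "\<forall>\<^sub>F u in nhds t. ?g u \<in> \<Sigma>" by (rule eventually_mono) (use im in blast)
      show "\<forall>\<^sub>F w in nhds (?g t). w \<in> \<Sigma> \<longrightarrow> \<bar>V w - V (?g t)\<bar> \<le> \<bar>Re (0 * (w - ?g t))\<bar> + \<epsilon> * cmod (w - ?g t)"
        if "\<epsilon> > 0" for \<epsilon>
        using flat[OF _ that, of "?g t"] t im by auto
    qed simp
    then show "((\<lambda>t. V (?g t)) has_real_derivative 0) (at t within {0<..<1})"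
      by (rule has_field_derivative_at_within)
  qed simp
  then show ?thesis using im by auto
qed


lemma plane_measure_if_admissible:
  assumes "admissible \<Phi> \<alpha> \<mu>"
  shows "plane_measure (\<mu> i)"
  using assms by (auto simp: admissible_def plane_measure_def plane_measure_axioms_def)

lemma interaction_entries [simp]:
  "interaction $ 1 $ 1 = 1" "interaction $ 1 $ 2 = 1/2" "interaction $ 1 $ 3 = 1/2"
  "interaction $ 2 $ 1 = 1/2" "interaction $ 2 $ 2 = 1" "interaction $ 2 $ 3 = -1/2"
  "interaction $ 3 $ 1 = 1/2" "interaction $ 3 $ 2 = -1/2" "interaction $ 3 $ 3 = 1"
  by (simp_all add: interaction_def)

lemma cubic_solutions_perm:
  assumes "cubic_solutions R d a b c"
  shows "cubic_solutions R d a c b" "cubic_solutions R d c b a"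
  using assms by (auto simp: cubic_solutions_def mult_ac)

text \<open>
  The relation between the external fields is what makes the difference of two solutions
  equal to twice the complex gradient of the total potential.
\<close>
lemma equilibrium_and_S_property_off_overlap:
  assumes compat: "pderiv (\<Phi> 1) - pderiv (\<Phi> 2) = pderiv (\<Phi> 3)"
    and adm: "admissible \<Phi> \<alpha> \<mu>" and eqn: "associated_equation \<Phi> \<mu> R D"
    and z: "z \<in> msupp (\<mu> j) - supp_overlap \<mu>" and nb: "\<not> branch_point R D z"
  defines "V \<equiv> \<lambda>w. real_of_ereal (total_potential \<Phi> \<mu> j w)"
  shows "total_potential \<Phi> \<mu> j z = ereal (V z)
    \<and> (\<forall>n. \<exists>d. has_onesided_derivative V z n d \<and> has_onesided_derivative V z (- n) d)
    \<and> (\<forall>\<epsilon>>0. \<forall>\<^sub>F w in nhds z. w \<in> msupp (\<mu> j) \<longrightarrow> \<bar>V w - V z\<bar> \<le> \<epsilon> * cmod (w - z))"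
proof -
  note pm = plane_measure_if_admissible[OF adm]
  have null: "msupp (\<mu> i) \<in> null_sets lborel" for i using adm by (simp add: admissible_def)
  have D: "rational_poles_le2 D"
    and sol: "AE w in lborel. cubic_solutions (poly R w) (D w) (xi1 \<Phi> \<mu> w) (xi2 \<Phi> \<mu> w) (xi3 \<Phi> \<mu> w)"
    using eqn by (auto simp: associated_equation_def)
  have c: "poly (pderiv (\<Phi> 1)) w = poly (pderiv (\<Phi> 2)) w + poly (pderiv (\<Phi> 3)) w" for w
    using compat by (metis diff_add_cancel poly_add add.commute)
  note point = equilibrium_and_S_property_at_point[OF pm pm pm null _ _ _ _ D nb]
  consider "j = 1" | "j = 2" | "j = 3" using exhaust_3[of j] by blast
  then show ?thesis
  proof cases
    case 1
    have z': "z \<in> msupp (\<mu> 1)" "z \<notin> msupp (\<mu> 2)" "z \<notin> msupp (\<mu> 3)"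
      using z 1 by (auto simp: supp_overlap_def)
    have total: "total_potential \<Phi> \<mu> 1 w = log_potential (\<mu> 1) w + ereal (1/2) * log_potential (\<mu> 2) w
        + ereal (1/2) * log_potential (\<mu> 3) w + ereal (ext_field \<Phi> 1 w / 2)" for w
      by (simp add: total_potential_def sum_3 one_ereal_def[symmetric])
    have "AE w in lborel. \<exists>x y. cubic_solutions (poly R w) (D w) x y
          (poly (smult (1/3) (pderiv (\<Phi> 3) - pderiv (\<Phi> 2))) w + of_real (-1) * cauchy_transform (\<mu> 2) w
            + of_real 1 * cauchy_transform (\<mu> 3) w)
        \<and> x - y = 2 * (cauchy_transform (\<mu> 1) w + of_real (1/2) * cauchy_transform (\<mu> 2) w
            + of_real (1/2) * cauchy_transform (\<mu> 3) w + poly (pderiv (\<Phi> 1)) w / 2)"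
      using sol
    proof eventually_elim
      case (elim w)
      have "poly (smult (1/3) (pderiv (\<Phi> 3) - pderiv (\<Phi> 2))) w + of_real (-1) * cauchy_transform (\<mu> 2) w
            + of_real 1 * cauchy_transform (\<mu> 3) w = xi3 \<Phi> \<mu> w"
        by (simp add: xi3_def field_simps)
      moreover have "xi1 \<Phi> \<mu> w - xi2 \<Phi> \<mu> w = 2 * (cauchy_transform (\<mu> 1) w + of_real (1/2) * cauchy_transform (\<mu> 2) w
            + of_real (1/2) * cauchy_transform (\<mu> 3) w + poly (pderiv (\<Phi> 1)) w / 2)"
        by (simp add: xi1_def xi2_def c field_simps)
      ultimately show ?case using elim by metis
    qed
    from point[OF z' total this] show ?thesis unfolding V_def 1 by blast
  next
    case 2
    have z': "z \<in> msupp (\<mu> 2)" "z \<notin> msupp (\<mu> 1)" "z \<notin> msupp (\<mu> 3)"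
      using z 2 by (auto simp: supp_overlap_def)
    have total: "total_potential \<Phi> \<mu> 2 w = log_potential (\<mu> 2) w + ereal (1/2) * log_potential (\<mu> 1) w
        + ereal (-1/2) * log_potential (\<mu> 3) w + ereal (ext_field \<Phi> 2 w / 2)" for w
      by (simp add: total_potential_def sum_3 one_ereal_def[symmetric] ac_simps)
    have "AE w in lborel. \<exists>x y. cubic_solutions (poly R w) (D w) x y
          (poly (smult (-1/3) (pderiv (\<Phi> 1) + pderiv (\<Phi> 3))) w + of_real (-1) * cauchy_transform (\<mu> 1) w
            + of_real (-1) * cauchy_transform (\<mu> 3) w)
        \<and> x - y = 2 * (cauchy_transform (\<mu> 2) w + of_real (1/2) * cauchy_transform (\<mu> 1) w
            + of_real (-1/2) * cauchy_transform (\<mu> 3) w + poly (pderiv (\<Phi> 2)) w / 2)"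
      using sol
    proof eventually_elim
      case (elim w)
      have "poly (smult (-1/3) (pderiv (\<Phi> 1) + pderiv (\<Phi> 3))) w + of_real (-1) * cauchy_transform (\<mu> 1) w
            + of_real (-1) * cauchy_transform (\<mu> 3) w = xi2 \<Phi> \<mu> w"
        by (simp add: xi2_def field_simps)
      moreover have "xi1 \<Phi> \<mu> w - xi3 \<Phi> \<mu> w = 2 * (cauchy_transform (\<mu> 2) w + of_real (1/2) * cauchy_transform (\<mu> 1) w
            + of_real (-1/2) * cauchy_transform (\<mu> 3) w + poly (pderiv (\<Phi> 2)) w / 2)"
        by (simp add: xi1_def xi3_def c field_simps)
      ultimately show ?case using cubic_solutions_perm(1)[OF elim] by metis
    qed
    from point[OF z' total this] show ?thesis unfolding V_def 2 by blast
  next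
    case 3
    have z': "z \<in> msupp (\<mu> 3)" "z \<notin> msupp (\<mu> 1)" "z \<notin> msupp (\<mu> 2)"
      using z 3 by (auto simp: supp_overlap_def)
    have total: "total_potential \<Phi> \<mu> 3 w = log_potential (\<mu> 3) w + ereal (1/2) * log_potential (\<mu> 1) w
        + ereal (-1/2) * log_potential (\<mu> 2) w + ereal (ext_field \<Phi> 3 w / 2)" for w
      by (simp add: total_potential_def sum_3 one_ereal_def[symmetric] ac_simps)
    have "AE w in lborel. \<exists>x y. cubic_solutions (poly R w) (D w) x y
          (poly (smult (1/3) (pderiv (\<Phi> 1) + pderiv (\<Phi> 2))) w + of_real 1 * cauchy_transform (\<mu> 1) w
            + of_real 1 * cauchy_transform (\<mu> 2) w)
        \<and> x - y = 2 * (cauchy_transform (\<mu> 3) w + of_real (1/2) * cauchy_transform (\<mu> 1) w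
            + of_real (-1/2) * cauchy_transform (\<mu> 2) w + poly (pderiv (\<Phi> 3)) w / 2)"
      using sol
    proof eventually_elim
      case (elim w)
      have "poly (smult (1/3) (pderiv (\<Phi> 1) + pderiv (\<Phi> 2))) w + of_real 1 * cauchy_transform (\<mu> 1) w
            + of_real 1 * cauchy_transform (\<mu> 2) w = xi1 \<Phi> \<mu> w"
        by (simp add: xi1_def field_simps)
      moreover have "xi3 \<Phi> \<mu> w - xi2 \<Phi> \<mu> w = 2 * (cauchy_transform (\<mu> 3) w + of_real (1/2) * cauchy_transform (\<mu> 1) w
            + of_real (-1/2) * cauchy_transform (\<mu> 2) w + poly (pderiv (\<Phi> 3)) w / 2)"
        by (simp add: xi2_def xi3_def c field_simps)
      ultimately show ?case using cubic_solutions_perm(2)[OF elim] by metis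
    qed
    from point[OF z' total this] show ?thesis unfolding V_def 3 by blast
  qed
qed

theorem theorem1p8:
  fixes \<Phi> :: "3 \<Rightarrow> complex poly"
    and \<alpha> :: real
    and \<mu> :: "3 \<Rightarrow> complex measure"
    and R :: "complex poly"
    and D :: "complex \<Rightarrow> complex"
    and j :: 3
    and \<Sigma> :: "complex set"
  assumes "pderiv (\<Phi> 1) - pderiv (\<Phi> 2) = pderiv (\<Phi> 3)"
    and "0 \<le> \<alpha>" and "\<alpha> \<le> 1"
    and "critical \<Phi> \<alpha> \<mu>"
    and "associated_equation \<Phi> \<mu> R D"
    and "open_analytic_arc \<Sigma>"
    and "\<Sigma> \<subseteq> msupp (\<mu> j) - supp_overlap \<mu>"
    and "\<forall>z\<in>\<Sigma>. \<not> branch_point R D z"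
  shows "\<exists>l::real. \<forall>z\<in>\<Sigma>.
           total_potential \<Phi> \<mu> j z = ereal l \<and>
           (\<forall>n. unit_normal \<Sigma> z n \<longrightarrow>
              (\<exists>d. has_onesided_derivative (\<lambda>w. real_of_ereal (total_potential \<Phi> \<mu> j w)) z n d \<and>
                   has_onesided_derivative (\<lambda>w. real_of_ereal (total_potential \<Phi> \<mu> j w)) z (- n) d))"
proof -
  define V where "V = (\<lambda>w. real_of_ereal (total_potential \<Phi> \<mu> j w))"
  obtain \<gamma> where \<gamma>: "analytic_parametrization \<gamma> \<Sigma>"
    using assms(6) by (auto simp: open_analytic_arc_def)
  have adm: "admissible \<Phi> \<alpha> \<mu>" using assms(4) by (simp add: critical_def)
  have loc: "total_potential \<Phi> \<mu> j z = ereal (V z)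
      \<and> (\<forall>n. \<exists>d. has_onesided_derivative V z n d \<and> has_onesided_derivative V z (- n) d)
      \<and> (\<forall>\<epsilon>>0. \<forall>\<^sub>F w in nhds z. w \<in> msupp (\<mu> j) \<longrightarrow> \<bar>V w - V z\<bar> \<le> \<epsilon> * cmod (w - z))" if "z \<in> \<Sigma>" for z
    unfolding V_def
    by (rule equilibrium_and_S_property_off_overlap[OF assms(1) adm assms(5)]) (use assms(7,8) that in auto)
  have "\<exists>l::real. \<forall>z\<in>\<Sigma>. V z = l"
  proof (rule constant_along_arc[OF \<gamma>])
    fix z and \<epsilon> :: real assume "z \<in> \<Sigma>" "\<epsilon> > 0"
    then have "\<forall>\<^sub>F w in nhds z. w \<in> msupp (\<mu> j) \<longrightarrow> \<bar>V w - V z\<bar> \<le> \<epsilon> * cmod (w - z)"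
      using loc by blast
    then show "\<forall>\<^sub>F w in nhds z. w \<in> \<Sigma> \<longrightarrow> \<bar>V w - V z\<bar> \<le> \<epsilon> * cmod (w - z)"
      by (rule eventually_mono) (use assms(7) in auto)
  qed
  then obtain l where "\<And>z. z \<in> \<Sigma> \<Longrightarrow> V z = l" by blast
  with loc show ?thesis unfolding V_def[symmetric] by metis
qed

end
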